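(* Let $X$ and $Y$ be finite connected multigraphs with no vertices of degree one, and let $Y/X$ be an abelian cover of degree $d$ with automorphism group $G$. Let $I_G$ be the augmentation ideal of $\mathbb{Z}[G]$, let $e=1-e_{\chi_1}$ where $\chi_1$ is the trivial character of $G$, let $\theta_{Y/X}^{*}(1)=\sum_{\chi\in\widehat{G}} L_{Y/X}^{*}(1,\chi)\, e_{\overline{\chi}}\in\mathbb{C}[G]$, and let $r_X=|E_X|-|V_X|+1$. Then $$\left|I_G/\left(\theta_{Y/X}^{*}(1)\cdot e\cdot\mathbb{Z}[G]\right)\right| = 2^{(d-1)(r_X-1)}\cdot\frac{\kappa_Y}{\kappa_X}.$$
   Context: Multigraphs. A multigraph $X$ consists of a set $V_X$ of vertices and a multiset $E_X$ of unordered pairs of vertices (edges); loops and multiple edges are allowed. The degree $d_X(v)$ of a vertex is the number of edges incident to $v$, each loop counted twice. $\kappa_X$ is the number of spanning trees of $X$ (parallel edges being distinguished). Covers. Multigraphs are viewed as one-dimensional CW-complexes. A cover $Y/X$ of multigraphs is a topological covering map $\pi:Y\to X$ that is a morphism of multigraphs; its degree is the integer $d$ such that $\pi$ is $d$-to-$1$. $\mathrm{Aut}(Y/X)$ is its group of deck transformations (which are multigraph automorphisms of $Y$). The cover is Galois if $\mathrm{Aut}(Y/X)$ acts transitively on each fiber (it acts freely, so $|\mathrm{Aut}(Y/X)|=d$), and abelian if moreover $G=\mathrm{Aut}(Y/X)$ is abelian. $\widehat{G}$ is the group of complex characters of $G$. Primes. Each edge (including a loop) has two orientations; $e^{-1}$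 denotes the oriented edge $e$ with the opposite orientation. A path is a sequence of oriented edges $e_1\cdots e_m$ with the terminal vertex of $e_i$ equal to the initial vertex of $e_{i+1}$; its length is $m$. It is closed if its initial and terminal vertices agree. A prime path is a closed path with no backtrack ($e_{i+1}\ne e_i^{-1}$ for all $i=1,\dots,m-1$), no tail ($e_1\neq e_m^{-1}$), and which is not of the form $C^a$ with $C$ a closed path and $a\ge 2$. Two closed paths are equivalent if one is obtained from the other by a cyclic rotation of its edges. A prime $\mathfrak{p}$ of $X$ is an equivalence class of prime paths; $\nu(\mathfrak{p})$ is its length. Frobenius. For an abelian cover $Y/X$ and a prime $\mathfrak{p}$ of $X$, represent $\mathfrak p$ by a prime path starting at a vertex $v$, choose a vertex $w$ of $Y$ above $v$, lift the path to $Y$ starting at $w$, and let $w'$ be the terminal vertex of the lift. The Frobenius automorphism $\left(\frac{Y/X}{\mathfrak{p}}\right)$ is the unique $g\in G$ with $g\cdot w=w'$; it depends only on $\mathfrak{p}$. $L$-functions. For $\chi\in\widehat{G}$, $L_{Y/X}(u,\chi)=\prod_{\mathfrak{p}}\left(1-\chi\left(\left(\frac{Y/X}{\mathfrak{p}}\right)\right)u^{\nu(\mathfrak{p})}\right)^{-1}$, the product over all primes $\mathfrak p$ of $X$. It converges for $|u|$ small and $L_{Y/X}(u,\chi)^{-1}$ is a polynomial in $u$. $L_{Y/X}^{*}(1,\chi)$ denotes the first non-vanishing Taylor coefficient of $L_{Y/X}(u,\chi)^{-1}$ at $u=1$ (coefficient of the lowest power of $u-1$). Idempotents. $e_\chi=\frac{1}{|G|}\sum_{\sigma\in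 G}\chi(\sigma)\,\sigma^{-1}\in\mathbb{C}[G]$. The augmentation ideal $I_G$ is the kernel of the map $s:\mathbb{Z}[G]\to\mathbb{Z}$ with $s(\sigma)=1$ for all $\sigma\in G$. The element $\theta_{Y/X}^{*}(1)\cdot e$ lies in $I_G$. *)

theory Defs
  imports
    "HOL-Analysis.Analysis"
    "HOL-Computational_Algebra.Polynomial"
    "HOL-Algebra.Ring"
    "HOL-Algebra.Coset"
    "HOL-Algebra.Bij"
begin

section \<open>Multigraphs\<close>

text \<open>
  The multiset of edges is a family of unordered pairs indexed by a set of edge names, so that
  parallel edges are distinguished. The unordered pair of end points of an edge is listed in an
  arbitrary order, which serves only as a reference orientation (the characteristic map of the
  1-cell).
\<close>

record ('v, 'e) multigraph =
  verts :: "'v set"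
  edges :: "'e set"
  ends  :: "'e \<Rightarrow> 'v \<times> 'v"

definition finite_multigraph :: "('v, 'e) multigraph \<Rightarrow> bool" where
  "finite_multigraph X \<longleftrightarrow>
     finite (verts X) \<and> finite (edges X) \<and> (\<forall>e\<in>edges X. ends X e \<in> verts X \<times> verts X)"

text \<open>Loops are counted twice.\<close>

definition vdegree :: "('v, 'e) multigraph \<Rightarrow> 'v \<Rightarrow> nat" where
  "vdegree X v = card {e \<in> edges X. fst (ends X e) = v} + card {e \<in> edges X. snd (ends X e) = v}"

text \<open>
  An oriented edge is an edge with a flag telling whether it is traversed along its reference
  orientation; in particular a loop has two distinct orientations.
\<close>

type_synonym 'e oedge = "'e \<times> bool"

definition oedges :: "('v, 'e) multigraph \<Rightarrow> 'e oedge set" where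
  "oedges X = edges X \<times> UNIV"

definition orev :: "'e oedge \<Rightarrow> 'e oedge" where
  "orev a = (fst a, \<not> snd a)"

definition initial :: "('v, 'e) multigraph \<Rightarrow> 'e oedge \<Rightarrow> 'v" where
  "initial X a = (if snd a then fst (ends X (fst a)) else snd (ends X (fst a)))"

definition terminal :: "('v, 'e) multigraph \<Rightarrow> 'e oedge \<Rightarrow> 'v" where
  "terminal X a = initial X (orev a)"

definition is_path :: "('v, 'e) multigraph \<Rightarrow> 'e oedge list \<Rightarrow> bool" where
  "is_path X p \<longleftrightarrow> set p \<subseteq> oedges X \<and>
     (\<forall>i. Suc i < length p \<longrightarrow> terminal X (p ! i) = initial X (p ! Suc i))"

definition closed_path :: "('v, 'e) multigraph \<Rightarrow> 'e oedge list \<Rightarrow> bool" where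
  "closed_path X p \<longleftrightarrow> p \<noteq> [] \<and> is_path X p \<and> initial X (hd p) = terminal X (last p)"

definition connected_multigraph :: "('v, 'e) multigraph \<Rightarrow> bool" where
  "connected_multigraph X \<longleftrightarrow> verts X \<noteq> {} \<and>
     (\<forall>v\<in>verts X. \<forall>w\<in>verts X. v \<noteq> w \<longrightarrow>
        (\<exists>p. p \<noteq> [] \<and> is_path X p \<and> initial X (hd p) = v \<and> terminal X (last p) = w))"

text \<open>A loop is a cycle of length 1, and two parallel edges form a cycle of length 2.\<close>

definition is_cycle :: "('v, 'e) multigraph \<Rightarrow> 'e oedge list \<Rightarrow> bool" where
  "is_cycle X p \<longleftrightarrow> closed_path X p \<and> distinct (map fst p) \<and> distinct (map (initial X) p)"

definition is_tree :: "('v, 'e) multigraph \<Rightarrow> bool" where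
  "is_tree X \<longleftrightarrow> connected_multigraph X \<and> (\<nexists>p. is_cycle X p)"

definition num_spanning_trees :: "('v, 'e) multigraph \<Rightarrow> nat" where
  "num_spanning_trees X = card {T. T \<subseteq> edges X \<and> is_tree (X\<lparr>edges := T\<rparr>)}"

definition betti :: "('v, 'e) multigraph \<Rightarrow> int" where
  "betti X = int (card (edges X)) - int (card (verts X)) + 1"


section \<open>Multigraphs as one-dimensional CW-complexes\<close>

datatype ('v, 'e) point = Vertex 'v | Inner 'e real

definition points :: "('v, 'e) multigraph \<Rightarrow> ('v, 'e) point set" where
  "points X = Vertex ` verts X \<union> {Inner e t | e t. e \<in> edges X \<and> 0 < t \<and> t < 1}"

text \<open>The characteristic map from the unit interval of an oriented edge.\<close>

definition cell :: "('v, 'e) multigraph \<Rightarrow> 'e oedge \<Rightarrow> real \<Rightarrow> ('v, 'e) point" where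
  "cell X a t =
     (if t = 0 then Vertex (initial X a)
      else if t = 1 then Vertex (terminal X a)
      else Inner (fst a) (if snd a then t else 1 - t))"

text \<open>The weak topology: a set is open if its preimage under each characteristic map is open.\<close>

definition cw_open :: "('v, 'e) multigraph \<Rightarrow> ('v, 'e) point set \<Rightarrow> bool" where
  "cw_open X U \<longleftrightarrow> U \<subseteq> points X \<and>
     (\<forall>a\<in>oedges X. openin (top_of_set {0..1}) {t \<in> {0..1}. cell X a t \<in> U})"

definition realization :: "('v, 'e) multigraph \<Rightarrow> ('v, 'e) point topology" where
  "realization X = topology (cw_open X)"

lemma istopology_cw_open: "istopology (cw_open X)"
  unfolding istopology_def
proof (intro conjI allI impI)
  fix S T assume S: "cw_open X S" and T: "cw_open X T"
  have "{t \<in> {0..1}. cell X a t \<in> S \<inter> T} =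
      {t \<in> {0..1}. cell X a t \<in> S} \<inter> {t \<in> {0..1}. cell X a t \<in> T}" for a
    by auto
  then show "cw_open X (S \<inter> T)"
    using S T unfolding cw_open_def by (auto intro: openin_Int)
next
  fix \<K> assume K: "\<forall>K\<in>\<K>. cw_open X K"
  have "{t \<in> {0..1}. cell X a t \<in> \<Union>\<K>} = (\<Union>K\<in>\<K>. {t \<in> {0..1}. cell X a t \<in> K})" for a
    by auto
  then show "cw_open X (\<Union>\<K>)"
    using K unfolding cw_open_def by (auto intro!: openin_Union)
qed

lemma openin_realization: "openin (realization X) U \<longleftrightarrow> cw_open X U"
  by (simp add: realization_def istopology_cw_open topology_inverse')

lemma topspace_realization:
  assumes "finite_multigraph X"
  shows "topspace (realization X) = points X"
proof -
  have "cell X a t \<in> points X" if "a \<in> oedges X" "t \<in> {0..1}" for a t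
    using that assms
    by (cases a; cases "ends X (fst a)")
      (auto simp: cell_def points_def oedges_def initial_def terminal_def orev_def
        finite_multigraph_def)
  then have "{t \<in> {0..1}. cell X a t \<in> points X} = {0..1}" if "a \<in> oedges X" for a
    using that by (cases a) auto
  then have "cw_open X (points X)"
    unfolding cw_open_def by simp
  then show ?thesis
    unfolding topspace_def openin_realization by (auto simp: cw_open_def)
qed


section \<open>Covers\<close>

record ('w, 'f, 'v, 'e) multigraph_map =
  vmap :: "'w \<Rightarrow> 'v"
  emap :: "'f oedge \<Rightarrow> 'e oedge"

definition multigraph_hom ::
  "('w, 'f) multigraph \<Rightarrow> ('v, 'e) multigraph \<Rightarrow> ('w, 'f, 'v, 'e) multigraph_map \<Rightarrow> bool" where
  "multigraph_hom Y X \<pi> \<longleftrightarrow>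
     vmap \<pi> ` verts Y \<subseteq> verts X \<and> emap \<pi> ` oedges Y \<subseteq> oedges X \<and>
     (\<forall>a\<in>oedges Y. emap \<pi> (orev a) = orev (emap \<pi> a) \<and>
        initial X (emap \<pi> a) = vmap \<pi> (initial Y a) \<and>
        terminal X (emap \<pi> a) = vmap \<pi> (terminal Y a))"

text \<open>The continuous map underlying a morphism: affine on each edge.\<close>

definition realization_map ::
  "('v, 'e) multigraph \<Rightarrow> ('w, 'f, 'v, 'e) multigraph_map \<Rightarrow> ('w, 'f) point \<Rightarrow> ('v, 'e) point" where
  "realization_map X \<pi> x =
     (case x of Vertex w \<Rightarrow> Vertex (vmap \<pi> w) | Inner f t \<Rightarrow> cell X (emap \<pi> (f, True)) t)"

text \<open>
  The counterpart of \<^const>\<open>covering_space\<close> for topologies that are not given by a type class.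
\<close>

definition covering_map :: "'a topology \<Rightarrow> 'b topology \<Rightarrow> ('a \<Rightarrow> 'b) \<Rightarrow> bool" where
  "covering_map C S p \<longleftrightarrow>
     continuous_map C S p \<and> p ` topspace C = topspace S \<and>
     (\<forall>x\<in>topspace S. \<exists>T. x \<in> T \<and> openin S T \<and>
        (\<exists>v. \<Union>v = topspace C \<inter> p -` T \<and> (\<forall>u\<in>v. openin C u) \<and> pairwise disjnt v \<and>
             (\<forall>u\<in>v. homeomorphic_map (subtopology C u) (subtopology S T) p)))"

definition cover ::
  "('w, 'f) multigraph \<Rightarrow> ('v, 'e) multigraph \<Rightarrow> ('w, 'f, 'v, 'e) multigraph_map \<Rightarrow> bool" where
  "cover Y X \<pi> \<longleftrightarrow>
     multigraph_hom Y X \<pi> \<and> covering_map (realization Y) (realization X) (realization_map X \<pi>)"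

definition has_cover_degree ::
  "('w, 'f) multigraph \<Rightarrow> ('v, 'e) multigraph \<Rightarrow> ('w, 'f, 'v, 'e) multigraph_map \<Rightarrow> nat \<Rightarrow> bool" where
  "has_cover_degree Y X \<pi> d \<longleftrightarrow>
     (\<forall>x\<in>topspace (realization X).
        finite {y \<in> topspace (realization Y). realization_map X \<pi> y = x} \<and>
        card {y \<in> topspace (realization Y). realization_map X \<pi> y = x} = d)"

text \<open>
  Deck transformations are self-homeomorphisms of the total space over the base. As in
  \<^const>\<open>BijGroup\<close>, they are taken extensional, and the product is composition.
\<close>

definition deck_group ::
  "('w, 'f) multigraph \<Rightarrow> ('v, 'e) multigraph \<Rightarrow> ('w, 'f, 'v, 'e) multigraph_map
     \<Rightarrow> (('w, 'f) point \<Rightarrow> ('w, 'f) point) monoid" where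
  "deck_group Y X \<pi> = BijGroup (topspace (realization Y))
     \<lparr>carrier := {h \<in> extensional (topspace (realization Y)).
        homeomorphic_map (realization Y) (realization Y) h \<and>
        (\<forall>y\<in>topspace (realization Y). realization_map X \<pi> (h y) = realization_map X \<pi> y)}\<rparr>"

definition galois_cover ::
  "('w, 'f) multigraph \<Rightarrow> ('v, 'e) multigraph \<Rightarrow> ('w, 'f, 'v, 'e) multigraph_map \<Rightarrow> bool" where
  "galois_cover Y X \<pi> \<longleftrightarrow> cover Y X \<pi> \<and>
     (\<forall>y\<in>topspace (realization Y). \<forall>z\<in>topspace (realization Y).
        realization_map X \<pi> y = realization_map X \<pi> z \<longrightarrow>
        (\<exists>g\<in>carrier (deck_group Y X \<pi>). g y = z))"

definition abelian_cover ::
  "('w, 'f) multigraph \<Rightarrow> ('v, 'e) multigraph \<Rightarrow> ('w, 'f, 'v, 'e) multigraph_map \<Rightarrow> bool" where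
  "abelian_cover Y X \<pi> \<longleftrightarrow> galois_cover Y X \<pi> \<and> comm_group (deck_group Y X \<pi>)"


section \<open>Primes and the Frobenius automorphism\<close>

definition prime_path :: "('v, 'e) multigraph \<Rightarrow> 'e oedge list \<Rightarrow> bool" where
  "prime_path X p \<longleftrightarrow> closed_path X p \<and>
     (\<forall>i. Suc i < length p \<longrightarrow> p ! Suc i \<noteq> orev (p ! i)) \<and>
     hd p \<noteq> orev (last p) \<and>
     (\<nexists>c a. closed_path X c \<and> a \<ge> 2 \<and> p = concat (replicate a c))"

definition graph_primes :: "('v, 'e) multigraph \<Rightarrow> 'e oedge list set set" where
  "graph_primes X = {p. prime_path X p} //
     {(p, q). closed_path X p \<and> closed_path X q \<and> (\<exists>n. q = rotate n p)}"

definition prime_length :: "'e oedge list set \<Rightarrow> nat" where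
  "prime_length P = length (SOME p. p \<in> P)"

text \<open>
  The lift of a path in X is a path q in Y that maps to it; it automatically starts at a vertex
  above the initial vertex of the given path.
\<close>

definition frobenius ::
  "('w, 'f) multigraph \<Rightarrow> ('v, 'e) multigraph \<Rightarrow> ('w, 'f, 'v, 'e) multigraph_map
     \<Rightarrow> 'e oedge list set \<Rightarrow> (('w, 'f) point \<Rightarrow> ('w, 'f) point)" where
  "frobenius Y X \<pi> P = (THE g. g \<in> carrier (deck_group Y X \<pi>) \<and>
     (\<exists>p\<in>P. \<exists>q. is_path Y q \<and> map (emap \<pi>) q = p \<and>
        g (Vertex (initial Y (hd q))) = Vertex (terminal Y (last q))))"


section \<open>Characters and group rings\<close>

text \<open>Characters are set to 0 outside the carrier, so that they are determined by the group.\<close>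

definition characters :: "('g, 'm) monoid_scheme \<Rightarrow> ('g \<Rightarrow> complex) set" where
  "characters G = {\<psi>. (\<forall>g\<in>carrier G. \<psi> g \<noteq> 0) \<and>
     (\<forall>g\<in>carrier G. \<forall>h\<in>carrier G. \<psi> (g \<otimes>\<^bsub>G\<^esub> h) = \<psi> g * \<psi> h) \<and>
     (\<forall>g. g \<notin> carrier G \<longrightarrow> \<psi> g = 0)}"

definition trivial_character :: "('g, 'm) monoid_scheme \<Rightarrow> 'g \<Rightarrow> complex" where
  "trivial_character G g = (if g \<in> carrier G then 1 else 0)"

text \<open>
  The group ring of a finite group G with coefficients in a subring K of the complex numbers:
  an element is the function giving its coefficients, extended by 0 outside the carrier of G.
  Thus the integral group ring is literally a subset of the complex one.
\<close>

definition group_elem :: "'g \<Rightarrow> 'g \<Rightarrow> complex" where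
  "group_elem \<sigma> = (\<lambda>\<tau>. if \<tau> = \<sigma> then 1 else 0)"

definition group_ring :: "complex set \<Rightarrow> ('g, 'm) monoid_scheme \<Rightarrow> ('g \<Rightarrow> complex) ring" where
  "group_ring K G =
     \<lparr>carrier = {f. (\<forall>\<sigma>\<in>carrier G. f \<sigma> \<in> K) \<and> (\<forall>\<sigma>. \<sigma> \<notin> carrier G \<longrightarrow> f \<sigma> = 0)},
      mult = (\<lambda>f h \<tau>. if \<tau> \<in> carrier G
                then \<Sum>\<sigma>\<in>carrier G. f \<sigma> * h (inv\<^bsub>G\<^esub> \<sigma> \<otimes>\<^bsub>G\<^esub> \<tau>) else 0),
      one = group_elem \<one>\<^bsub>G\<^esub>,
      zero = (\<lambda>_. 0),
      add = (\<lambda>f h \<tau>. f \<tau> + h \<tau>)\<rparr>"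

abbreviation int_group_ring :: "('g, 'm) monoid_scheme \<Rightarrow> ('g \<Rightarrow> complex) ring" where
  "int_group_ring G \<equiv> group_ring \<int> G"

abbreviation complex_group_ring :: "('g, 'm) monoid_scheme \<Rightarrow> ('g \<Rightarrow> complex) ring" where
  "complex_group_ring G \<equiv> group_ring UNIV G"

definition augmentation_ideal :: "('g, 'm) monoid_scheme \<Rightarrow> ('g \<Rightarrow> complex) set" where
  "augmentation_ideal G = {f \<in> carrier (int_group_ring G). (\<Sum>\<sigma>\<in>carrier G. f \<sigma>) = 0}"

definition char_idempotent :: "('g, 'm) monoid_scheme \<Rightarrow> ('g \<Rightarrow> complex) \<Rightarrow> 'g \<Rightarrow> complex" where
  "char_idempotent G \<psi> =
     (\<lambda>\<tau>. 1 / of_nat (card (carrier G)) * (\<Sum>\<sigma>\<in>carrier G. \<psi> \<sigma> * group_elem (inv\<^bsub>G\<^esub> \<sigma>) \<tau>))"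


section \<open>L-functions\<close>

text \<open>The Euler product is unordered, i.e. the limit over the finite sets of primes.\<close>

definition L_function ::
  "('w, 'f) multigraph \<Rightarrow> ('v, 'e) multigraph \<Rightarrow> ('w, 'f, 'v, 'e) multigraph_map
     \<Rightarrow> ((('w, 'f) point \<Rightarrow> ('w, 'f) point) \<Rightarrow> complex) \<Rightarrow> complex \<Rightarrow> complex" where
  "L_function Y X \<pi> \<psi> u = Lim (finite_subsets_at_top (graph_primes X))
     (\<lambda>F. \<Prod>P\<in>F. inverse (1 - \<psi> (frobenius Y X \<pi> P) * u ^ prime_length P))"

text \<open>The polynomial to which the reciprocal of the L-function extends from a neighbourhood of 0.\<close>

definition L_inverse ::
  "('w, 'f) multigraph \<Rightarrow> ('v, 'e) multigraph \<Rightarrow> ('w, 'f, 'v, 'e) multigraph_map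
     \<Rightarrow> ((('w, 'f) point \<Rightarrow> ('w, 'f) point) \<Rightarrow> complex) \<Rightarrow> complex poly" where
  "L_inverse Y X \<pi> \<psi> =
     (THE Q. \<forall>\<^sub>F u in nhds 0. poly Q u = inverse (L_function Y X \<pi> \<psi> u))"

text \<open>Composing with \<open>1 + u\<close> turns the Taylor coefficients at 1 into ordinary coefficients.\<close>

definition L_star ::
  "('w, 'f) multigraph \<Rightarrow> ('v, 'e) multigraph \<Rightarrow> ('w, 'f, 'v, 'e) multigraph_map
     \<Rightarrow> ((('w, 'f) point \<Rightarrow> ('w, 'f) point) \<Rightarrow> complex) \<Rightarrow> complex" where
  "L_star Y X \<pi> \<psi> =
     (let Q = pcompose (L_inverse Y X \<pi> \<psi>) [:1, 1:] in coeff Q (LEAST k. coeff Q k \<noteq> 0))"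

definition theta_star ::
  "('w, 'f) multigraph \<Rightarrow> ('v, 'e) multigraph \<Rightarrow> ('w, 'f, 'v, 'e) multigraph_map
     \<Rightarrow> (('w, 'f) point \<Rightarrow> ('w, 'f) point) \<Rightarrow> complex" where
  "theta_star Y X \<pi> =
     (\<lambda>\<tau>. \<Sum>\<psi>\<in>characters (deck_group Y X \<pi>).
        L_star Y X \<pi> \<psi> * char_idempotent (deck_group Y X \<pi>) (\<lambda>\<sigma>. cnj (\<psi> \<sigma>)) \<tau>)"

end

theory Submission
  imports Defs "Jordan_Normal_Form.Schur_Decomposition"
begin

text \<open>
  A section of the cover turns \<open>Y\<close> into a voltage graph over \<open>X\<close>, and a character \<open>\<psi>\<close> of \<open>G\<close>
  into a twist of the edges of \<open>X\<close>. The Euler product over primes is the reciprocal of the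
  determinant of the twisted non-backtracking operator, and Bass's identity rewrites it as
  \<open>(1 - u\<^sup>2) ^ (r - 1)\<close> times a determinant which at \<open>u = 1\<close> is that of the twisted Laplacian \<open>L \<psi>\<close>.
  For nontrivial \<open>\<psi>\<close> this is nonzero, so the leading coefficient is \<open>(-2) ^ (r - 1) * det (L \<psi>)\<close>.

  The Laplacian of \<open>Y\<close> is block-diagonalised by the characters. Comparing linear terms in \<open>t\<close> of
  \<open>det (L\<^sub>Y + t) = \<Prod> det (L \<psi> + t)\<close>, the matrix-tree theorem expresses the ratio of the numbers of
  spanning trees as \<open>1 / d\<close> times the product of \<open>det (L \<psi>)\<close> over nontrivial \<open>\<psi>\<close>.

  Finally \<open>\<psi> \<mapsto> det (L \<psi>)\<close> is the Fourier transform of an element of the integral group ring, and it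
  vanishes at the trivial character. In the coordinates of the augmentation ideal away from the
  identity, the principal ideal generated by \<open>\<theta>\<^sup>* e\<close> is spanned by the columns of a principal submatrix of a
  group matrix, whose determinant is evaluated by the same comparison of linear terms in a group
  determinant.
\<close>

text \<open>A deck transformation is given only as a homeomorphism, so it must first be shown to act
  on vertices and oriented edges; continuity at a vertex and connectedness of an open edge do this.
  The Laplacians of \<open>X\<close> and \<open>Y\<close> are singular because the trivial character
  contributes a zero factor. Adding t on the diagonal and differentiating at 0 keeps exactly the
  product over the other characters. The derivatives are sums of principal minors: for
  \<open>X\<close> and \<open>Y\<close> they equal |V| times the number of spanning trees, and |V_Y|
  = d |V_X| is the origin of 1 / d. In the group determinant all d minors agree, and the factor d
  this produces cancels the earlier one. Nonvanishing at nontrivial characters is read off from the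
  spanning tree identity, since \<open>Y\<close> has a spanning tree. The leading coefficient at the
  trivial character never has to be computed: e removes it, and the value zero of det (L \<psi>) can
  stand in its place. The powers of -2 come from 1 - (1 + u)^2 = u (-2 - u); their sign disappears
  because an index is the absolute value of a determinant.\<close>

section \<open>Determinants over finite index sets\<close>

text \<open>A determinant over an arbitrary finite index set, so that vertices, oriented edges and group
  elements can serve as indices directly.\<close>

definition fdet :: "'a set \<Rightarrow> ('a \<Rightarrow> 'a \<Rightarrow> 'b) \<Rightarrow> 'b::comm_ring_1" where
  "fdet S M = (\<Sum>p | p permutes S. of_int (sign p) * (\<Prod>i\<in>S. M i (p i)))"

lemma fdet_cong:
  assumes "S = T" "\<And>i j. i \<in> T \<Longrightarrow> j \<in> T \<Longrightarrow> M i j = N i j"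
  shows "fdet S M = fdet T N"
  unfolding fdet_def using assms
  by (auto intro!: sum.cong prod.cong simp: permutes_in_image)

lemma fdet_reindex:
  assumes f: "bij_betw f S T" and S: "finite S"
  shows "fdet T M = fdet S (\<lambda>i j. M (f i) (f j))"
proof -
  have inj: "inj_on f S" and T: "T = f ` S" using f by (auto simp: bij_betw_def)
  define F where "F = (\<lambda>\<pi> x. if x \<in> T then f (\<pi> (inv_into S f x)) else x)"
  have bij: "bij_betw F {\<pi>. \<pi> permutes S} {\<pi>. \<pi> permutes T}"
    unfolding F_def by (rule bij_betw_permutations[OF f])
  have "fdet T M = (\<Sum>p | p permutes S. of_int (sign (F p)) * (\<Prod>i\<in>T. M i (F p i)))"
    unfolding fdet_def by (rule sum.reindex_bij_betw[OF bij, symmetric])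
  also have "\<dots> = (\<Sum>p | p permutes S. of_int (sign p) * (\<Prod>i\<in>S. M (f i) (f (p i))))"
  proof (rule sum.cong[OF refl])
    fix p assume "p \<in> {p. p permutes S}"
    then have p: "p permutes S" by simp
    have "F p = map_permutation S f p"
      unfolding F_def map_permutation_def restrict_id_def T by (auto simp: fun_eq_iff)
    then have sgn: "sign (F p) = sign p" by (simp add: sign_map_permutation[OF inj p S])
    have "(\<Prod>i\<in>T. M i (F p i)) = (\<Prod>i\<in>S. M (f i) (F p (f i)))"
      by (rule prod.reindex_bij_betw[OF f, symmetric])
    also have "\<dots> = (\<Prod>i\<in>S. M (f i) (f (p i)))"
      by (rule prod.cong) (auto simp: F_def T inv_into_f_f[OF inj])
    finally show "of_int (sign (F p)) * (\<Prod>i\<in>T. M i (F p i)) = of_int (sign p) * (\<Prod>i\<in>S. M (f i) (f (p i)))"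
      by (simp add: sgn)
  qed
  finally show ?thesis unfolding fdet_def .
qed

text \<open>Together with \<open>fdet_reindex\<close> along an enumeration of \<open>S\<close>, this
  imports multiplicativity, the kernel criterion and the Schur form from matrices indexed by
  numbers.\<close>

lemma fdet_mat: "fdet {0..<n} M = Determinant.det (mat n n (\<lambda>(i,j). M i j))"
  unfolding fdet_def Determinant.det_def
  by (auto intro!: sum.cong prod.cong simp: permutes_in_image)

lemma fdet_mult:
  assumes "finite S"
  shows "fdet S (\<lambda>i j. \<Sum>k\<in>S. A i k * B k j) = fdet S A * fdet S B"
proof -
  define n where "n = card S"
  obtain e where e: "bij_betw e {0..<n} S" using ex_bij_betw_nat_finite[OF assms] n_def by blast
  let ?m = "\<lambda>A. mat n n (\<lambda>(i,j). A (e i) (e j))"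
  have *: "fdet S A = Determinant.det (?m A)" for A :: "'a \<Rightarrow> 'a \<Rightarrow> 'b"
    by (simp add: fdet_reindex[OF e] fdet_mat)
  have "?m (\<lambda>i j. \<Sum>k\<in>S. A i k * B k j) = ?m A * ?m B"
    by (auto intro!: eq_matI simp: scalar_prod_def sum.reindex_bij_betw[OF e, symmetric])
  then show ?thesis unfolding * by (simp add: det_mult[of _ n])
qed

lemma fdet_empty [simp]: "fdet {} M = 1"
  by (simp add: fdet_def)

lemma fdet_diag:
  assumes "finite S" and "\<And>i j. i \<in> S \<Longrightarrow> j \<in> S \<Longrightarrow> i \<noteq> j \<Longrightarrow> M i j = 0"
  shows "fdet S M = (\<Prod>i\<in>S. M i i)"
proof -
  have "fdet S M = (\<Sum>p\<in>{id}. of_int (sign p) * (\<Prod>i\<in>S. M i (p i)))"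
    unfolding fdet_def
  proof (rule sum.mono_neutral_right)
    show "finite {p. p permutes S}" by (rule finite_permutations[OF assms(1)])
    show "{id} \<subseteq> {p. p permutes S}" by (simp add: permutes_id)
    show "\<forall>p\<in>{p. p permutes S} - {id}. of_int (sign p) * (\<Prod>i\<in>S. M i (p i)) = 0"
    proof
      fix p assume "p \<in> {p. p permutes S} - {id}"
      then have p: "p permutes S" "p \<noteq> id" by auto
      then obtain i where i: "p i \<noteq> i" by (auto simp: fun_eq_iff)
      then have iS: "i \<in> S" using permutes_not_in[OF p(1)] by blast
      then have "M i (p i) = 0" using assms(2)[of i "p i"] i permutes_in_image[OF p(1)] by metis
      then have "(\<Prod>i\<in>S. M i (p i)) = 0" using iS assms(1) by (auto intro: prod_zero)
      then show "of_int (sign p) * (\<Prod>i\<in>S. M i (p i)) = 0" by simp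
    qed
  qed
  then show ?thesis by simp
qed

lemma fdet_one: "finite S \<Longrightarrow> fdet S (\<lambda>i j. if i = j then 1 else 0) = 1"
  by (subst fdet_diag) auto

lemma fdet_singleton: "fdet {a} M = M a a"
  by (subst fdet_diag) auto

lemma fdet_scale: "finite S \<Longrightarrow> fdet S (\<lambda>i j. k * M i j) = k ^ card S * fdet S M"
  by (simp add: fdet_def prod.distrib sum_distrib_left mult_ac)

lemma poly_fdet: "poly (fdet S P) u = fdet S (\<lambda>i j. poly (P i j) u)"
  by (simp add: fdet_def poly_sum poly_prod poly_mult)

lemma of_int_fdet: "of_int (fdet S A) = fdet S (\<lambda>i j. of_int (A i j) :: complex)"
  by (simp add: fdet_def)

text \<open>An injective map of the finite set \<open>S\<close> into itself is onto, so
  \<open>p\<close> cannot send a point of \<open>T\<close> into \<open>S\<close>. Its two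
  restrictions, continued by the identity, are the factors.\<close>

lemma permutes_split:
  assumes "p permutes (S \<union> T)" "S \<inter> T = {}" "finite S" "\<And>i. i \<in> S \<Longrightarrow> p i \<in> S"
  shows "\<exists>q r. q permutes S \<and> r permutes T \<and> p = q \<circ> r"
proof -
  have "inj_on p S" by (metis assms(1) inj_on_subset permutes_inj subset_UNIV)
  then have pS: "p ` S = S"
    by (meson assms(3,4) endo_inj_surj image_subsetI)
  have injp: "inj p" using assms(1) permutes_inj by blast
  have pT: "p i \<in> T" if "i \<in> T" for i
  proof -
    have "p i \<in> S \<union> T" using that permutes_in_image[OF assms(1)] by blast
    moreover have "p i \<notin> S"
    proof
      assume "p i \<in> S" then obtain j where "j \<in> S" "p j = p i" using pS by (metis imageE)
      then show False using injp that assms(2) by (metis IntI empty_iff inj_eq)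
    qed
    ultimately show ?thesis by blast
  qed
  have out: "i \<notin> S \<Longrightarrow> i \<notin> T \<Longrightarrow> p i = i" for i using permutes_not_in[OF assms(1)] by blast
  define q where "q = (\<lambda>i. if i \<in> S then p i else i)"
  define r where "r = (\<lambda>i. if i \<in> T then p i else i)"
  have "q permutes S"
  proof (rule bij_imp_permutes)
    have "bij_betw p S S" using pS \<open>inj_on p S\<close> by (simp add: bij_betw_def)
    then show "bij_betw q S S" by (rule bij_betw_cong[THEN iffD1, rotated]) (auto simp: q_def)
  qed (auto simp: q_def)
  moreover have "r permutes T"
  proof (rule bij_imp_permutes)
    have "p ` T = T"
    proof -
      have "p ` (S \<union> T) = S \<union> T" using assms(1) permutes_image by blast
      then show ?thesis using pS pT assms(2) assms(1) injp by blast
    qed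
    then have "bij_betw p T T" using injp by (simp add: bij_betw_def inj_on_def inj_def)
    then show "bij_betw r T T" by (rule bij_betw_cong[THEN iffD1, rotated]) (auto simp: r_def)
  qed (auto simp: r_def)
  moreover have "p = q \<circ> r"
    using assms(2) pT out by (auto simp: fun_eq_iff q_def r_def)
  ultimately show ?thesis by blast
qed

text \<open>A permutation avoids the zero block only if it preserves \<open>S\<close>. By
  \<open>permutes_split\<close> the surviving terms are indexed by pairs of permutations of
  \<open>S\<close> and of \<open>T\<close>, and sign and product split accordingly.\<close>

lemma fdet_block:
  assumes fin: "finite S" "finite T" and ST: "S \<inter> T = {}"
    and z: "\<And>i j. i \<in> S \<Longrightarrow> j \<in> T \<Longrightarrow> M i j = 0"
  shows "fdet (S \<union> T) M = fdet S M * fdet T M"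
proof -
  let ?P = "{q. q permutes S} \<times> {r. r permutes T}"
  let ?c = "\<lambda>(q, r). q \<circ> r"
  have qT: "q i = i" if "q permutes S" "i \<in> T" for q i
    using that ST permutes_not_in by fastforce
  have rS: "r i = i" if "r permutes T" "i \<in> S" for r i
    using that ST permutes_not_in by fastforce
  have rT: "r i \<in> T" if "r permutes T" "i \<in> T" for r i
    using that permutes_in_image by fastforce
  have qS: "q i \<in> S" if "q permutes S" "i \<in> S" for q i
    using that permutes_in_image by fastforce
  have inj: "inj_on ?c ?P"
  proof (rule inj_onI, clarsimp)
    fix q r q' r' assume h: "q permutes S" "r permutes T" "q' permutes S" "r' permutes T" "q \<circ> r = q' \<circ> r'"
    have "q i = q' i" for i
    proof (cases "i \<in> S")
      case True then show ?thesis using fun_cong[OF h(5), of i] rS[OF h(2)] rS[OF h(4)] by simp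
    next
      case False then show ?thesis using h permutes_not_in by metis
    qed
    moreover have "r i = r' i" for i
    proof (cases "i \<in> T")
      case True then show ?thesis using fun_cong[OF h(5), of i] qT rT h by (metis comp_apply)
    next
      case False then show ?thesis using h permutes_not_in by metis
    qed
    ultimately show "q = q' \<and> r = r'" by blast
  qed
  have img: "?c ` ?P \<subseteq> {p. p permutes (S \<union> T)}"
    by (auto intro!: permutes_compose intro: permutes_subset)
  have "fdet (S \<union> T) M = (\<Sum>p\<in>?c ` ?P. of_int (sign p) * (\<Prod>i\<in>S \<union> T. M i (p i)))"
    unfolding fdet_def
  proof (rule sum.mono_neutral_right[OF _ img])
    show "finite {p. p permutes (S \<union> T)}" using fin by (simp add: finite_permutations)
    show "\<forall>p\<in>{p. p permutes (S \<union> T)} - ?c ` ?P. of_int (sign p) * (\<Prod>i\<in>S \<union> T. M i (p i)) = 0"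
    proof
      fix p assume p: "p \<in> {p. p permutes (S \<union> T)} - ?c ` ?P"
      have "\<exists>i\<in>S. p i \<notin> S"
      proof (rule ccontr)
        assume "\<not> ?thesis"
        then obtain q r where "q permutes S" "r permutes T" "p = q \<circ> r"
          using permutes_split[of p S T] p ST fin by blast
        then have "p \<in> ?c ` ?P" by (auto intro!: image_eqI[of _ _ "(q, r)"])
        then show False using p by blast
      qed
      then obtain i where i: "i \<in> S" "p i \<notin> S" by blast
      then have "p i \<in> T" using p permutes_in_image[of p "S \<union> T" i] by auto
      then have "M i (p i) = 0" using z i by blast
      then have "(\<Prod>i\<in>S \<union> T. M i (p i)) = 0" using i fin by (auto intro: prod_zero)
      then show "of_int (sign p) * (\<Prod>i\<in>S \<union> T. M i (p i)) = 0" by simp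
    qed
  qed
  also have "\<dots> = (\<Sum>(q,r)\<in>?P. of_int (sign (q \<circ> r)) * (\<Prod>i\<in>S \<union> T. M i ((q \<circ> r) i)))"
    by (subst sum.reindex[OF inj]) (simp add: case_prod_unfold)
  also have "\<dots> = (\<Sum>(q,r)\<in>?P. (of_int (sign q) * (\<Prod>i\<in>S. M i (q i))) * (of_int (sign r) * (\<Prod>i\<in>T. M i (r i))))"
  proof (rule sum.cong[OF refl], clarify)
    fix q r assume q: "q permutes S" and r: "r permutes T"
    have s: "sign (q \<circ> r) = sign q * sign r"
      using q r fin by (intro sign_compose) (auto intro: permutes_imp_permutation)
    have "(\<Prod>i\<in>S \<union> T. M i ((q \<circ> r) i)) = (\<Prod>i\<in>S. M i ((q \<circ> r) i)) * (\<Prod>i\<in>T. M i ((q \<circ> r) i))"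
      by (rule prod.union_disjoint[OF fin ST])
    also have "(\<Prod>i\<in>S. M i ((q \<circ> r) i)) = (\<Prod>i\<in>S. M i (q i))"
      by (rule prod.cong) (use rS[OF r] in auto)
    also have "(\<Prod>i\<in>T. M i ((q \<circ> r) i)) = (\<Prod>i\<in>T. M i (r i))"
      by (rule prod.cong) (use qT[OF q] rT[OF r] in auto)
    finally show "of_int (sign (q \<circ> r)) * (\<Prod>i\<in>S \<union> T. M i ((q \<circ> r) i)) =
      (of_int (sign q) * (\<Prod>i\<in>S. M i (q i))) * (of_int (sign r) * (\<Prod>i\<in>T. M i (r i)))"
      by (simp add: s mult_ac)
  qed
  also have "\<dots> = fdet S M * fdet T M"
    unfolding fdet_def by (simp add: sum_product sum.cartesian_product)
  finally show ?thesis .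
qed

lemma fdet_block_upper:
  assumes fin: "finite S" "finite T" and ST: "S \<inter> T = {}"
    and z: "\<And>i j. i \<in> T \<Longrightarrow> j \<in> S \<Longrightarrow> M i j = 0"
  shows "fdet (S \<union> T) M = fdet S M * fdet T M"
  using fdet_block[OF fin(2,1), of M] ST z by (simp add: Int_commute Un_commute mult.commute)

lemma fdet_block_diagonal:
  assumes "finite I" "finite V"
  shows "fdet (I \<times> V) (\<lambda>p q. if fst p = fst q then B (fst p) (snd p) (snd q) else 0) = (\<Prod>i\<in>I. fdet V (B i))"
  using assms(1)
proof (induction I rule: finite_induct)
  case (insert i I)
  let ?M = "\<lambda>p q. if fst p = fst q then B (fst p) (snd p) (snd q) else 0"
  have "insert i I \<times> V = {i} \<times> V \<union> I \<times> V" by auto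
  moreover have "fdet ({i} \<times> V \<union> I \<times> V) ?M = fdet ({i} \<times> V) ?M * fdet (I \<times> V) ?M"
    by (rule fdet_block) (use insert.hyps assms(2) in auto)
  moreover have "fdet ({i} \<times> V) ?M = fdet V (B i)"
    by (subst fdet_reindex[of "\<lambda>v. (i, v)" V]) (auto simp: bij_betw_def inj_on_def assms(2))
  ultimately show ?case using insert by simp
qed simp

lemma fdet_2:
  assumes "a \<noteq> b"
  shows "fdet {a, b} M = M a a * M b b - M a b * M b a"
proof -
  have "Transposition.transpose a b \<noteq> id" using assms by (metis id_apply transpose_apply_first)
  then have "id \<noteq> Transposition.transpose a b" by simp
  moreover have "{p. p permutes {a,b}} = {id, Transposition.transpose a b}"
    by (auto simp: permutes_doubleton_iff)
  ultimately show ?thesis unfolding fdet_def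
    using assms by (simp add: sign_swap_id)
qed

lemma fdet_kernel:
  fixes M :: "'a \<Rightarrow> 'a \<Rightarrow> complex"
  assumes S: "finite S" and x: "s \<in> S" "x s \<noteq> 0" and ker: "\<And>i. i \<in> S \<Longrightarrow> (\<Sum>j\<in>S. M i j * x j) = 0"
  shows "fdet S M = 0"
proof -
  define n where "n = card S"
  obtain e where e: "bij_betw e {0..<n} S" using ex_bij_betw_nat_finite[OF S] n_def by blast
  let ?M = "mat n n (\<lambda>(i,j). M (e i) (e j))"
  let ?v = "Matrix.vec n (\<lambda>i. x (e i))"
  obtain k where k: "k < n" "e k = s" using e x(1) by (auto simp: bij_betw_def)
  have "?v \<noteq> 0\<^sub>v n"
  proof
    assume "?v = 0\<^sub>v n"
    then have "vec_index ?v k = 0" using k by simp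
    then show False using k x(2) by simp
  qed
  moreover have "?M *\<^sub>v ?v = 0\<^sub>v n"
  proof (rule eq_vecI)
    fix i assume "i < dim_vec (0\<^sub>v n)"
    then have i: "i < n" by simp
    then have "e i \<in> S" using e by (auto simp: bij_betw_def)
    from ker[OF this] have "(\<Sum>j\<in>{0..<n}. M (e i) (e j) * x (e j)) = 0"
      by (simp add: sum.reindex_bij_betw[OF e, of "\<lambda>j. M (e i) j * x j"])
    then show "vec_index (?M *\<^sub>v ?v) i = vec_index (0\<^sub>v n) i" using i by (simp add: scalar_prod_def)
  qed simp
  ultimately have "Determinant.det ?M = 0"
    by (intro det_0_iff_vec_prod_zero_field[of ?M n, THEN iffD2] exI[of _ ?v] conjI) simp_all
  then show ?thesis by (simp add: fdet_reindex[OF e] fdet_mat)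
qed

text \<open>Sum types carry the block index, so that the two diagonal blocks may live on unrelated
  types, such as oriented edges and vertices.\<close>

definition blocks :: "('a \<Rightarrow> 'a \<Rightarrow> 'c) \<Rightarrow> ('a \<Rightarrow> 'b \<Rightarrow> 'c) \<Rightarrow> ('b \<Rightarrow> 'a \<Rightarrow> 'c) \<Rightarrow> ('b \<Rightarrow> 'b \<Rightarrow> 'c)
    \<Rightarrow> 'a + 'b \<Rightarrow> 'a + 'b \<Rightarrow> 'c" where
  "blocks A B C D = (\<lambda>x y. case x of
      Inl i \<Rightarrow> (case y of Inl j \<Rightarrow> A i j | Inr j \<Rightarrow> B i j)
    | Inr i \<Rightarrow> (case y of Inl j \<Rightarrow> C i j | Inr j \<Rightarrow> D i j))"

lemma blocks_simps [simp]:
  "blocks A B C D (Inl i) (Inl j) = A i j" "blocks A B C D (Inl i) (Inr k) = B i k"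
  "blocks A B C D (Inr l) (Inl j) = C l j" "blocks A B C D (Inr l) (Inr k) = D l k"
  by (simp_all add: blocks_def)

lemma fdet_Inl: "finite S \<Longrightarrow> fdet (Inl ` S) (blocks A B C D) = fdet S A"
  by (subst fdet_reindex[of Inl S]) (auto simp: bij_betw_def)

lemma fdet_Inr: "finite T \<Longrightarrow> fdet (Inr ` T) (blocks A B C D) = fdet T D"
  by (subst fdet_reindex[of Inr T]) (auto simp: bij_betw_def)

lemma fdet_blocks_lower:
  assumes "finite S" "finite T"
  shows "fdet (Inl ` S \<union> Inr ` T) (blocks A (\<lambda>_ _. 0) C D) = fdet S A * fdet T D"
  using assms by (subst fdet_block) (auto simp: fdet_Inl fdet_Inr)

lemma fdet_blocks_upper:
  assumes "finite S" "finite T"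
  shows "fdet (Inl ` S \<union> Inr ` T) (blocks A B (\<lambda>_ _. 0) D) = fdet S A * fdet T D"
  using assms by (subst fdet_block_upper) (auto simp: fdet_Inl fdet_Inr)

text \<open>In block form \<open>M\<close> has rows (1, A), (B, 1) and the unitriangular
  \<open>N\<close> has rows (1, 0), (-B, 1). The product \<open>M N\<close> is upper triangular with
  1 - AB on the diagonal, \<open>N M\<close> with 1 - BA, and both have the determinant of
  \<open>M\<close>.\<close>

lemma fdet_sylvester:
  fixes A :: "'a \<Rightarrow> 'b \<Rightarrow> 'c::comm_ring_1"
  assumes S: "finite S" and T: "finite T"
  shows "fdet S (\<lambda>i j. (if i = j then 1 else 0) - (\<Sum>k\<in>T. A i k * B k j)) =
         fdet T (\<lambda>i j. (if i = j then 1 else 0) - (\<Sum>k\<in>S. B i k * A k j))"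
proof -
  let ?U = "Inl ` S \<union> Inr ` T :: ('a + 'b) set"
  let ?d = "\<lambda>i j. if i = j then 1 else 0"
  define M where "M = blocks (\<lambda>i j::'a. if i = j then 1 else 0) A B (\<lambda>i j::'b. if i = j then 1 else (0::'c))"
  define N where "N = blocks (\<lambda>i j::'a. if i = j then 1 else 0) (\<lambda>_ _. 0) (\<lambda>i j. - B i j) (\<lambda>i j::'b. if i = j then 1 else (0::'c))"
  have U: "finite ?U" using S T by simp
  have sumU: "(\<Sum>k\<in>?U. f k) = (\<Sum>k\<in>S. f (Inl k)) + (\<Sum>k\<in>T. f (Inr k))" for f :: "_ \<Rightarrow> 'c"
    by (subst sum.union_disjoint) (use S T in \<open>auto simp: sum.reindex\<close>)
  have detN: "fdet ?U N = 1"
    unfolding N_def fdet_blocks_lower[OF S T] by (simp add: fdet_one S T)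
  have "fdet ?U M = fdet ?U (\<lambda>i j. \<Sum>k\<in>?U. M i k * N k j)"
    by (simp add: fdet_mult[OF U] detN)
  also have "\<dots> = fdet ?U (blocks (\<lambda>i j. ?d i j - (\<Sum>k\<in>T. A i k * B k j)) A (\<lambda>_ _. 0) ?d)"
    unfolding sumU
    by (rule fdet_cong[OF refl]) (elim UnE imageE; simp add: M_def N_def S T mult_delta_left mult_delta_right sum_negf)+
  also have "\<dots> = fdet S (\<lambda>i j. ?d i j - (\<Sum>k\<in>T. A i k * B k j))"
    unfolding fdet_blocks_upper[OF S T] by (simp add: fdet_one T)
  finally have 1: "fdet ?U M = fdet S (\<lambda>i j. ?d i j - (\<Sum>k\<in>T. A i k * B k j))" .
  have "fdet ?U M = fdet ?U (\<lambda>i j. \<Sum>k\<in>?U. N i k * M k j)"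
    by (simp add: fdet_mult[OF U] detN)
  also have "\<dots> = fdet ?U (blocks ?d A (\<lambda>_ _. 0) (\<lambda>i j. ?d i j - (\<Sum>k\<in>S. B i k * A k j)))"
    unfolding sumU
    by (rule fdet_cong[OF refl]) (elim UnE imageE; simp add: M_def N_def S T mult_delta_left mult_delta_right sum_negf)+
  also have "\<dots> = fdet T (\<lambda>i j. ?d i j - (\<Sum>k\<in>S. B i k * A k j))"
    unfolding fdet_blocks_upper[OF S T] by (simp add: fdet_one S)
  finally show ?thesis using 1 by simp
qed

text \<open>Expand every factor of every permutation term. Taking the scalar part at the indices in
  \<open>S - T\<close> forces the permutation to fix them, which leaves the principal minor on
  \<open>T\<close>.\<close>

lemma fdet_add_scalar:
  fixes t :: "'c::comm_ring_1"
  assumes S: "finite S"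
  shows "fdet S (\<lambda>i j. M i j + (if i = j then t else 0)) = (\<Sum>T\<in>Pow S. t ^ card (S - T) * fdet T M)"
proof -
  have "fdet S (\<lambda>i j. M i j + (if i = j then t else 0)) =
    (\<Sum>p | p permutes S. \<Sum>T\<in>Pow S. of_int (sign p) * ((\<Prod>i\<in>T. M i (p i)) * (\<Prod>i\<in>S-T. if i = p i then t else 0)))"
    unfolding fdet_def by (simp add: prod_add[OF S] sum_distrib_left)
  also have "\<dots> = (\<Sum>T\<in>Pow S. \<Sum>p | p permutes S. of_int (sign p) * ((\<Prod>i\<in>T. M i (p i)) * (\<Prod>i\<in>S-T. if i = p i then t else 0)))"
    by (rule sum.swap)
  also have "\<dots> = (\<Sum>T\<in>Pow S. t ^ card (S - T) * fdet T M)"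
  proof (rule sum.cong[OF refl])
    fix T assume T: "T \<in> Pow S"
    then have finT: "finite T" using S finite_subset by blast
    have "(\<Sum>p | p permutes S. of_int (sign p) * ((\<Prod>i\<in>T. M i (p i)) * (\<Prod>i\<in>S-T. if i = p i then t else 0))) =
      (\<Sum>p | p permutes T. of_int (sign p) * ((\<Prod>i\<in>T. M i (p i)) * (\<Prod>i\<in>S-T. if i = p i then t else 0)))"
    proof (rule sum.mono_neutral_right)
      show "finite {p. p permutes S}" by (rule finite_permutations[OF S])
      show "{p. p permutes T} \<subseteq> {p. p permutes S}" using T permutes_subset by blast
      show "\<forall>p\<in>{p. p permutes S} - {p. p permutes T}. of_int (sign p) * ((\<Prod>i\<in>T. M i (p i)) * (\<Prod>i\<in>S-T. if i = p i then t else 0)) = 0"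
      proof
        fix p assume p: "p \<in> {p. p permutes S} - {p. p permutes T}"
        have "\<exists>i\<in>S-T. p i \<noteq> i"
        proof (rule ccontr)
          assume "\<not> ?thesis"
          then have "p permutes T" using p permutes_superset[of p S T] by auto
          then show False using p by blast
        qed
        then have "\<exists>i\<in>S-T. (if i = p i then t else 0) = 0" by (metis (full_types))
        then have "(\<Prod>i\<in>S-T. if i = p i then t else 0) = 0" using S by (intro prod_zero) simp_all
        then show "of_int (sign p) * ((\<Prod>i\<in>T. M i (p i)) * (\<Prod>i\<in>S-T. if i = p i then t else 0)) = 0" by simp
      qed
    qed
    also have "\<dots> = (\<Sum>p | p permutes T. t ^ card (S - T) * (of_int (sign p) * (\<Prod>i\<in>T. M i (p i))))"
    proof (rule sum.cong[OF refl], clarify)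
      fix p assume "p permutes T"
      then have "(\<Prod>i\<in>S-T. if i = p i then t else 0) = (\<Prod>i\<in>S-T. t)"
        by (intro prod.cong) (auto simp: permutes_not_in)
      then show "of_int (sign p) * ((\<Prod>i\<in>T. M i (p i)) * (\<Prod>i\<in>S-T. if i = p i then t else 0)) =
        t ^ card (S - T) * (of_int (sign p) * (\<Prod>i\<in>T. M i (p i)))" by (simp add: mult_ac)
    qed
    finally show "(\<Sum>p | p permutes S. of_int (sign p) * ((\<Prod>i\<in>T. M i (p i)) * (\<Prod>i\<in>S-T. if i = p i then t else 0))) =
      t ^ card (S - T) * fdet T M" by (simp add: fdet_def sum_distrib_left)
  qed
  finally show ?thesis .
qed

text \<open>In \<open>fdet_add_scalar\<close> the linear term comes from the subsets that omit a
  single index. It can survive when the determinant itself is zero, which is the case of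
  Laplacians.\<close>

lemma DERIV_fdet_add_scalar:
  fixes M :: "'a \<Rightarrow> 'a \<Rightarrow> complex"
  assumes S: "finite S"
  shows "((\<lambda>t. fdet S (\<lambda>i j. M i j + (if i = j then t else 0))) has_field_derivative (\<Sum>s\<in>S. fdet (S - {s}) M)) (at 0)"
proof -
  have d: "((\<lambda>t. t ^ card (S - T) * fdet T M) has_field_derivative (if card (S - T) = 1 then fdet T M else 0)) (at 0)" for T
  proof -
    have e: "of_nat n * 0 ^ (n - 1) * c = (if n = 1 then c else (0::complex))" for n c
      by (cases n) (auto simp: power_0_left)
    have "((\<lambda>t. t ^ card (S - T)) has_field_derivative of_nat (card (S - T)) * 0 ^ (card (S - T) - 1)) (at 0)"
      by (rule DERIV_cong[OF DERIV_power[OF DERIV_ident]]) simp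
    then have "((\<lambda>t. t ^ card (S - T) * fdet T M) has_field_derivative of_nat (card (S - T)) * 0 ^ (card (S - T) - 1) * fdet T M) (at 0)"
      by (rule DERIV_cmult_right)
    then show ?thesis unfolding e .
  qed
  have "((\<lambda>t. \<Sum>T\<in>Pow S. t ^ card (S - T) * fdet T M) has_field_derivative
      (\<Sum>T\<in>Pow S. if card (S - T) = 1 then fdet T M else 0)) (at 0)"
    by (rule DERIV_sum) (rule d)
  moreover have "(\<Sum>T\<in>Pow S. if card (S - T) = 1 then fdet T M else 0) = (\<Sum>s\<in>S. fdet (S - {s}) M)"
  proof -
    have "(\<Sum>T\<in>Pow S. if card (S - T) = 1 then fdet T M else 0) = (\<Sum>T | T \<in> Pow S \<and> card (S - T) = 1. fdet T M)"
      using S by (intro sum.inter_filter[symmetric]) simp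
    also have "\<dots> = (\<Sum>s\<in>S. fdet (S - {s}) M)"
    proof (rule sum.reindex_bij_witness[of _ "\<lambda>s. S - {s}" "\<lambda>T. THE s. S - T = {s}"])
      fix T assume "T \<in> {T \<in> Pow S. card (S - T) = 1}"
      then obtain s where s: "T \<subseteq> S" "S - T = {s}" by (auto simp: card_1_singleton_iff)
      then have t: "(THE s. S - T = {s}) = s" by (intro the_equality) auto
      have e: "S - {s} = T" using s by blast
      show "S - {THE s. S - T = {s}} = T" "(THE s. S - T = {s}) \<in> S"
        "fdet (S - {THE s. S - T = {s}}) M = fdet T M"
        unfolding t e using s by blast+
    next
      fix s assume s: "s \<in> S"
      then have "S - (S - {s}) = {s}" by blast
      then show "(THE s'. S - (S - {s}) = {s'}) = s" "S - {s} \<in> {T \<in> Pow S. card (S - T) = 1}"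
        by (auto intro!: the_equality)
    qed
    finally show ?thesis .
  qed
  ultimately show ?thesis by (simp only: fdet_add_scalar[OF S])
qed

section \<open>Powers of triangular matrices\<close>

lemma upper_triangular_mult:
  fixes A B :: "'a::semiring_0 mat"
  assumes A: "A \<in> carrier_mat n n" "upper_triangular A" and B: "B \<in> carrier_mat n n" "upper_triangular B"
  shows "upper_triangular (A * B)" and "i < n \<Longrightarrow> (A * B) $$ (i, i) = A $$ (i, i) * B $$ (i, i)"
proof -
  have e: "(A * B) $$ (i, j) = (\<Sum>k\<in>{0..<n}. A $$ (i, k) * B $$ (k, j))" if "i < n" "j < n" for i j
    using that A B by (simp add: scalar_prod_def)
  have z: "A $$ (i, k) = 0" "B $$ (i, k) = 0" if "k < i" "i < n" for i k
    using that A B by (auto simp: upper_triangular_def)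
  show "upper_triangular (A * B)"
  proof (rule upper_triangularI)
    fix i j assume ij: "j < i" "i < dim_row (A * B)"
    then have "i < n" "j < n" using A by auto
    have "A $$ (i, k) * B $$ (k, j) = 0" if "k < n" for k
      using z(1)[of k i] z(2)[of j k] ij \<open>i < n\<close> that by (cases "k < i") auto
    then show "(A * B) $$ (i, j) = 0" using e[OF \<open>i < n\<close> \<open>j < n\<close>] by simp
  qed
  show "(A * B) $$ (i, i) = A $$ (i, i) * B $$ (i, i)" if i: "i < n"
  proof -
    have "(A * B) $$ (i, i) = (\<Sum>k\<in>{i}. A $$ (i, k) * B $$ (k, i))"
      unfolding e[OF i i]
    proof (rule sum.mono_neutral_right)
      show "\<forall>k\<in>{0..<n} - {i}. A $$ (i, k) * B $$ (k, i) = 0"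
      proof
        fix k assume "k \<in> {0..<n} - {i}"
        then show "A $$ (i, k) * B $$ (k, i) = 0" using z(1)[of k i] z(2)[of i k] i by (cases "k < i") auto
      qed
    qed (use i in auto)
    then show ?thesis by simp
  qed
qed

lemma upper_triangular_power:
  fixes B :: "'a::comm_semiring_1 mat"
  assumes B: "B \<in> carrier_mat n n" "upper_triangular B"
  shows "upper_triangular (B ^\<^sub>m k) \<and> (\<forall>i<n. (B ^\<^sub>m k) $$ (i, i) = B $$ (i, i) ^ k)"
proof (induction k)
  case 0 then show ?case using B by auto
next
  case (Suc k)
  have c: "B ^\<^sub>m k \<in> carrier_mat n n" using B by simp
  show ?case using upper_triangular_mult[OF c _ B] Suc by (auto simp: mult.commute)
qed

section \<open>Traces of powers\<close>

fun mpow :: "'a set \<Rightarrow> ('a \<Rightarrow> 'a \<Rightarrow> 'b::comm_ring_1) \<Rightarrow> nat \<Rightarrow> 'a \<Rightarrow> 'a \<Rightarrow> 'b" where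
  "mpow S W 0 i j = (if i = j then 1 else 0)"
| "mpow S W (Suc n) i j = (\<Sum>k\<in>S. mpow S W n i k * W k j)"

lemma mpow_mat:
  assumes e: "bij_betw e {0..<n} S" and "i < n" "j < n"
  shows "mpow S W k (e i) (e j) = (mat n n (\<lambda>(i,j). W (e i) (e j)) ^\<^sub>m k) $$ (i, j)"
  using assms(2,3)
proof (induction k arbitrary: i j)
  case 0
  then show ?case using e by (auto simp: bij_betw_def inj_on_def)
next
  case (Suc k)
  let ?M = "mat n n (\<lambda>(i,j). W (e i) (e j))"
  have c: "?M ^\<^sub>m k \<in> carrier_mat n n" by simp
  have "mpow S W (Suc k) (e i) (e j) = (\<Sum>l\<in>{0..<n}. mpow S W k (e i) (e l) * W (e l) (e j))"
    by (simp add: sum.reindex_bij_betw[OF e, of "\<lambda>l. mpow S W k (e i) l * W l (e j)"])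
  also have "\<dots> = (\<Sum>l\<in>{0..<n}. (?M ^\<^sub>m k) $$ (i, l) * W (e l) (e j))"
    by (rule sum.cong) (use Suc in auto)
  finally show ?case using Suc.prems c by (simp add: scalar_prod_def)
qed

lemma index_mult_mat_sum:
  assumes "A \<in> carrier_mat n m" "B \<in> carrier_mat m k" "i < n" "j < k"
  shows "(A * B) $$ (i, j) = (\<Sum>l<m. A $$ (i, l) * B $$ (l, j))"
  using assms by (simp add: scalar_prod_def atLeast0LessThan)

lemma trace_conjugate:
  fixes P X Q :: "'a::comm_semiring_1 mat"
  assumes c: "P \<in> carrier_mat n n" "X \<in> carrier_mat n n" "Q \<in> carrier_mat n n" and QP: "Q * P = 1\<^sub>m n"
  shows "(\<Sum>i<n. (P * X * Q) $$ (i, i)) = (\<Sum>i<n. X $$ (i, i))"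
proof -
  have PX: "P * X \<in> carrier_mat n n" using c by simp
  have "(\<Sum>i<n. (P * X * Q) $$ (i, i)) = (\<Sum>i<n. \<Sum>k<n. (P * X) $$ (i, k) * Q $$ (k, i))"
    by (rule sum.cong[OF refl], rule index_mult_mat_sum[OF PX c(3)]) auto
  also have "\<dots> = (\<Sum>k<n. \<Sum>i<n. Q $$ (k, i) * (P * X) $$ (i, k))"
    by (subst sum.swap) (simp only: mult.commute)
  also have "\<dots> = (\<Sum>k<n. (Q * (P * X)) $$ (k, k))"
    by (rule sum.cong[OF refl], rule index_mult_mat_sum[OF c(3) PX, symmetric]) auto
  also have "Q * (P * X) = X"
    using QP assoc_mult_mat[OF c(3,1,2)] left_mult_one_mat[OF c(2)] by metis
  finally show ?thesis .
qed

lemma minus_Ln_sums: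
  fixes z :: complex
  assumes "norm z < 1"
  shows "(\<lambda>k. z ^ Suc k / of_nat (Suc k)) sums (- Ln (1 - z))"
proof -
  have "(\<lambda>k. (-1) ^ Suc k / of_nat k * (- z) ^ k) sums Ln (1 + - z)"
    using Ln_series[of "- z"] assms by simp
  then have "(\<lambda>k. - ((-1) ^ Suc k / of_nat k * (- z) ^ k)) sums - Ln (1 + - z)"
    by (rule sums_minus)
  also have "(\<lambda>k. - ((-1) ^ Suc k / of_nat k * (- z) ^ k)) = (\<lambda>k. z ^ k / of_nat k)"
    by (rule ext, subst power_minus) (simp add: minus_one_power_iff)
  finally have "(\<lambda>k. z ^ k / of_nat k) sums - Ln (1 - z)" by simp
  \<comment> \<open>The term of index 0 is a division by zero, hence 0, so dropping it only shifts
    the index.\<close>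
  from sums_split_initial_segment[OF this, of 1] show ?thesis by simp
qed

text \<open>Schur triangularisation writes traces of powers as power sums of the eigenvalues and the
  determinant as the product of the 1 - u \<open>ev i\<close>, and the logarithm series connects the
  two. The exponential form avoids choosing a logarithm of the determinant.\<close>

lemma exp_trace_mpow:
  fixes W :: "'a \<Rightarrow> 'a \<Rightarrow> complex"
  assumes S: "finite S"
  shows "\<exists>r>0. \<forall>u. norm u < r \<longrightarrow> (\<exists>l. (\<lambda>k. u ^ Suc k / of_nat (Suc k) * (\<Sum>i\<in>S. mpow S W (Suc k) i i)) sums l \<and>
    exp l * fdet S (\<lambda>i j. (if i = j then 1 else 0) - u * W i j) = 1)"
proof -
  define n where "n = card S"
  obtain e where e: "bij_betw e {0..<n} S" using ex_bij_betw_nat_finite[OF S] n_def by blast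
  define A where "A = mat n n (\<lambda>(i,j). W (e i) (e j))"
  have A: "A \<in> carrier_mat n n" by (simp add: A_def)
  obtain es where es: "char_poly A = (\<Prod>a\<leftarrow>es. [:- a, 1:])" using char_poly_factorized[OF A] by blast
  obtain B P Q where BPQ: "schur_decomposition A es = (B, P, Q)" by (cases "schur_decomposition A es") auto
  have w: "similar_mat_wit A B P Q" and ut: "upper_triangular B"
    using schur_decomposition[OF A es BPQ] by auto
  have c: "B \<in> carrier_mat n n" "P \<in> carrier_mat n n" "Q \<in> carrier_mat n n"
      "P * Q = 1\<^sub>m n" "Q * P = 1\<^sub>m n" "A = P * B * Q"
    using w A unfolding similar_mat_wit_def Let_def by auto
  define ev where "ev i = B $$ (i, i)" for i
  have tr: "(\<Sum>i\<in>S. mpow S W k i i) = (\<Sum>i<n. ev i ^ k)" for k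
  proof -
    have "(\<Sum>i\<in>S. mpow S W k i i) = (\<Sum>i<n. (A ^\<^sub>m k) $$ (i, i))"
      by (subst sum.reindex_bij_betw[OF e, symmetric]) (auto simp: mpow_mat[OF e] A_def atLeast0LessThan)
    also have "\<dots> = (\<Sum>i<n. (B ^\<^sub>m k) $$ (i, i))"
      unfolding similar_mat_wit_pow_id[OF w] by (rule trace_conjugate) (use c in auto)
    also have "\<dots> = (\<Sum>i<n. ev i ^ k)"
      using upper_triangular_power[OF c(1) ut] by (simp add: ev_def)
    finally show ?thesis .
  qed
  have dt: "fdet S (\<lambda>i j. (if i = j then 1 else 0) - u * W i j) = (\<Prod>i<n. 1 - u * ev i)" for u
  proof -
    have "fdet S (\<lambda>i j. (if i = j then 1 else 0) - u * W i j) = Determinant.det (1\<^sub>m n + (- u) \<cdot>\<^sub>m A)"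
      unfolding fdet_reindex[OF e finite_atLeastLessThan] fdet_mat
      by (rule arg_cong[of _ _ Determinant.det], rule eq_matI) (use e in \<open>auto simp: A_def bij_betw_def inj_on_def\<close>)
    also have "1\<^sub>m n + (- u) \<cdot>\<^sub>m A = P * (1\<^sub>m n + (- u) \<cdot>\<^sub>m B) * Q"
    proof -
      have "P * (1\<^sub>m n + (- u) \<cdot>\<^sub>m B) * Q = (P + (- u) \<cdot>\<^sub>m (P * B)) * Q"
        using c by (simp add: mult_add_distrib_mat[of P n n _ n] mult_smult_distrib[of P n n B n])
      also have "\<dots> = P * Q + ((- u) \<cdot>\<^sub>m (P * B)) * Q"
        by (rule add_mult_distrib_mat) (use c in auto)
      also have "((- u) \<cdot>\<^sub>m (P * B)) * Q = (- u) \<cdot>\<^sub>m (P * B * Q)"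
        by (rule mult_smult_assoc_mat) (use c in auto)
      finally show ?thesis using c by simp
    qed
    also have "Determinant.det (P * (1\<^sub>m n + (- u) \<cdot>\<^sub>m B) * Q) = Determinant.det P * Determinant.det (1\<^sub>m n + (- u) \<cdot>\<^sub>m B) * Determinant.det Q"
      using c(1-3) det_mult[of P n "1\<^sub>m n + (- u) \<cdot>\<^sub>m B"] det_mult[of "P * (1\<^sub>m n + (- u) \<cdot>\<^sub>m B)" n Q] by simp
    also have "\<dots> = Determinant.det (1\<^sub>m n + (- u) \<cdot>\<^sub>m B) * (Determinant.det Q * Determinant.det P)" by simp
    also have "Determinant.det Q * Determinant.det P = 1"
      using det_mult[OF c(3,2)] c by simp
    also have "Determinant.det (1\<^sub>m n + (- u) \<cdot>\<^sub>m B) = (\<Prod>i<n. 1 - u * ev i)"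
    proof -
      have "upper_triangular (1\<^sub>m n + (- u) \<cdot>\<^sub>m B)"
        using ut c by (auto simp: upper_triangular_def)
      then have "Determinant.det (1\<^sub>m n + (- u) \<cdot>\<^sub>m B) = prod_list (diag_mat (1\<^sub>m n + (- u) \<cdot>\<^sub>m B))"
        by (rule det_upper_triangular[of _ n]) (use c in simp)
      also have "\<dots> = (\<Prod>i<n. 1 - u * ev i)"
        using c unfolding diag_mat_def
        by (simp add: prod.list_conv_set_nth ev_def atLeast0LessThan)
      finally show ?thesis .
    qed
    finally show ?thesis by simp
  qed
  \<comment> \<open>\<open>K\<close> bounds every eigenvalue, so the logarithm series converge for
    |u| < 1 / K; the summand 1 keeps it positive when all eigenvalues vanish.\<close>
  define K where "K = 1 + (\<Sum>i<n. norm (ev i))"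
  have K: "K > 0" unfolding K_def by (smt (verit) norm_ge_zero sum_nonneg)
  show ?thesis
  proof (intro exI[of _ "1 / K"] conjI allI impI)
    show "1 / K > 0" using K by simp
    fix u :: complex assume u: "norm u < 1 / K"
    have small: "norm (u * ev i) < 1" if "i < n" for i
    proof -
      have "norm (ev i) \<le> (\<Sum>i<n. norm (ev i))" using that by (intro member_le_sum) auto
      then have "norm (ev i) \<le> K" by (simp add: K_def)
      then have "norm (u * ev i) \<le> norm u * K" by (simp add: norm_mult mult_left_mono)
      also have "\<dots> < 1" using u K by (simp add: field_simps)
      finally show ?thesis .
    qed
    define l where "l = (\<Sum>i<n. - Ln (1 - u * ev i))"
    have s1: "(\<lambda>k. (u * ev i) ^ Suc k / of_nat (Suc k)) sums (- Ln (1 - u * ev i))" if "i < n" for i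
      by (rule minus_Ln_sums[OF small[OF that]])
    have "(\<lambda>k. u ^ Suc k / of_nat (Suc k) * (\<Sum>i\<in>S. mpow S W (Suc k) i i)) = (\<lambda>k. \<Sum>i<n. (u * ev i) ^ Suc k / of_nat (Suc k))"
      unfolding tr by (simp add: sum_distrib_left power_mult_distrib field_simps)
    moreover have "(\<lambda>k. \<Sum>i<n. (u * ev i) ^ Suc k / of_nat (Suc k)) sums l"
      unfolding l_def by (rule sums_sum) (use s1 in auto)
    moreover have "exp l * fdet S (\<lambda>i j. (if i = j then 1 else 0) - u * W i j) = 1"
    proof -
      have "1 - u * ev i \<noteq> 0" if "i < n" for i using small[OF that] by auto
      then have "exp l = (\<Prod>i<n. inverse (1 - u * ev i))"
        unfolding l_def exp_sum[OF finite_lessThan] by (intro prod.cong) (auto simp: exp_minus)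
      then show ?thesis unfolding dt using \<open>\<And>i. i < n \<Longrightarrow> 1 - u * ev i \<noteq> 0\<close> by (simp flip: prod.distrib)
    qed
    ultimately show "\<exists>l. (\<lambda>k. u ^ Suc k / of_nat (Suc k) * (\<Sum>i\<in>S. mpow S W (Suc k) i i)) sums l \<and>
      exp l * fdet S (\<lambda>i j. (if i = j then 1 else 0) - u * W i j) = 1" by (intro exI[of _ l] conjI) simp_all
  qed
qed

section \<open>Necklaces and the Euler product\<close>

definition primitive :: "'a list \<Rightarrow> bool" where
  "primitive p \<longleftrightarrow> p \<noteq> [] \<and> (\<nexists>c a. a \<ge> 2 \<and> p = concat (replicate a c))"

definition necklace :: "'a list \<Rightarrow> 'a list set" where
  "necklace p = range (\<lambda>n. rotate n p)"

lemma length_concat_replicate [simp]: "length (concat (replicate k p)) = k * length p"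
  by (induction k) auto

lemma set_concat_replicate_subset: "set (concat (replicate k p)) \<subseteq> set p"
  by (induction k) auto

lemma concat_replicate_commute: "concat (replicate k p) @ p = p @ concat (replicate k p)"
  by (induction k) auto

lemma rotate_length_concat_replicate:
  "rotate (length p) (concat (replicate k p)) = concat (replicate k p)"
  by (cases k) (simp_all add: rotate_append concat_replicate_commute)

lemma rotate_cancel: "rotate n xs = rotate n ys \<longleftrightarrow> xs = ys"
proof (induction n)
  case (Suc n)
  have "rotate1 as = rotate1 bs \<longleftrightarrow> as = bs" for as bs :: "'a list"
    by (cases as; cases bs) auto
  then show ?case using Suc by simp
qed simp

text \<open>Comparing prefixes shows that a nonempty \<open>d\<close> begins with \<open>t\<close>.
  Cancelling this copy leaves a shorter word that still commutes with \<open>t\<close>.\<close>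

lemma commuting_append_power:
  assumes "t @ d = d @ t" "t \<noteq> []" "length t dvd length d"
  shows "d = concat (replicate (length d div length t) t)"
  using assms
proof (induction "length d" arbitrary: d rule: less_induct)
  case less
  show ?case
  proof (cases "d = []")
    case False
    then have le: "length t \<le> length d" using less.prems by (simp add: dvd_imp_le)
    then have "take (length t) d = t"
      using arg_cong[OF less.prems(1), of "take (length t)"] by simp
    then obtain d' where d': "d = t @ d'" by (metis append_take_drop_id)
    then have "t @ d' = d' @ t" using less.prems(1) by simp
    moreover have "length d' < length d" using d' less.prems(2) by simp
    moreover have "length t dvd length d'" using less.prems(3) d' by simp
    ultimately have "d' = concat (replicate (length d' div length t) t)" using less.hyps less.prems(2) by blast
    moreover have "length d div length t = Suc (length d' div length t)"
      using d' less.prems(2) by simp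
    ultimately show ?thesis using d' by simp
  qed simp
qed

text \<open>Invariance under rotation by \<open>g\<close> says that the first \<open>g\<close>
  letters commute with the remaining ones.\<close>

lemma rotate_fixed_power:
  assumes "rotate g x = x" "g dvd length x" "g > 0" "x \<noteq> []"
  shows "x = concat (replicate (length x div g) (take g x))"
proof -
  have g: "g \<le> length x" using assms by (simp add: dvd_imp_le)
  have c: "take g x @ drop g x = drop g x @ take g x"
    using assms(1) g rotate_drop_take[of g x] by (cases "g = length x") auto
  have l: "length (take g x) = g" using g by simp
  have "drop g x = concat (replicate (length (drop g x) div length (take g x)) (take g x))"
    by (rule commuting_append_power[OF c]) (use assms l g in \<open>auto simp: dvd_diff_nat\<close>)
  then have d: "drop g x = concat (replicate ((length x - g) div g) (take g x))" using l by simp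
  have "length x div g = Suc ((length x - g) div g)"
    using g assms(3) by (simp add: le_div_geq)
  then have "concat (replicate (length x div g) (take g x)) = take g x @ drop g x"
    using d by simp
  then show ?thesis by simp
qed

lemma rotate_fixed_mult: "rotate n x = x \<Longrightarrow> rotate (a * n) x = x"
  by (induction a) (simp_all add: rotate_add)

text \<open>Bezout's identity is used in the form a n = b m + gcd, because rotations exist only by
  natural numbers.\<close>

lemma rotate_fixed_gcd:
  assumes "rotate n x = x" "rotate m x = x" "n > 0"
  shows "rotate (gcd n m) x = x"
proof -
  obtain a b where "a * n = b * m + gcd n m" using bezout_nat[of n m] assms(3) by (metis mult.commute neq0_conv)
  then have "rotate (gcd n m) (rotate (b * m) x) = rotate (a * n) x"
    by (simp add: rotate_rotate add.commute)
  then show ?thesis using assms by (simp add: rotate_fixed_mult)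
qed

text \<open>A proper power is the same as a proper period that divides the length. In this form
  primitivity is visibly invariant under rotation.\<close>

lemma primitive_iff_rotate:
  "primitive p \<longleftrightarrow> p \<noteq> [] \<and> (\<forall>g. g dvd length p \<longrightarrow> 0 < g \<longrightarrow> g < length p \<longrightarrow> rotate g p \<noteq> p)"
proof (cases "p = []")
  case False
  show ?thesis
  proof
    assume P: "primitive p"
    have "rotate g p \<noteq> p" if g: "g dvd length p" "0 < g" "g < length p" for g
    proof
      assume "rotate g p = p"
      then have "p = concat (replicate (length p div g) (take g p))"
        using rotate_fixed_power g False by blast
      moreover have "length p div g \<ge> 2"
      proof -
        obtain k where k: "length p = g * k" using g(1) by (elim dvdE)
        have "k \<noteq> 0" "k \<noteq> 1" using k g False by auto
        then show ?thesis using k g by simp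
      qed
      ultimately show False using P unfolding primitive_def by blast
    qed
    then show "p \<noteq> [] \<and> (\<forall>g. g dvd length p \<longrightarrow> 0 < g \<longrightarrow> g < length p \<longrightarrow> rotate g p \<noteq> p)" using False by blast
  next
    assume R: "p \<noteq> [] \<and> (\<forall>g. g dvd length p \<longrightarrow> 0 < g \<longrightarrow> g < length p \<longrightarrow> rotate g p \<noteq> p)"
    have False if "a \<ge> 2" "p = concat (replicate a c)" for a c
    proof -
      have len: "length p = a * length c" using that by simp
      have "length c > 0" using len False by (cases c) auto
      then have "length c < length p" using len that(1) by simp
      then show False using R that(2) rotate_length_concat_replicate[of c a] len \<open>length c > 0\<close>
        by (metis dvd_triv_right)
    qed
    then show "primitive p" using False unfolding primitive_def by blast
  qed
qed (simp add: primitive_def)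

lemma primitive_rotate: "primitive (rotate n p) \<longleftrightarrow> primitive p"
proof -
  have "rotate g (rotate n p) = rotate n p \<longleftrightarrow> rotate g p = p" for g
    using rotate_cancel[of n "rotate g p" p] by (simp add: rotate_rotate add.commute)
  then show ?thesis by (simp add: primitive_iff_rotate)
qed

text \<open>Both lengths are periods of the common power \<open>x\<close>, hence so is their gcd
  \<open>g\<close>. Both roots are then powers of the first \<open>g\<close> letters of
  \<open>x\<close>, and primitivity makes both exponents one.\<close>

lemma primitive_root_unique:
  assumes "primitive p" "primitive q" "concat (replicate (Suc k) p) = concat (replicate (Suc m) q)"
  shows "p = q \<and> k = m"
proof -
  define x where "x = concat (replicate (Suc k) p)"
  have xq: "x = concat (replicate (Suc m) q)" using assms x_def by simp
  have ne: "p \<noteq> []" "q \<noteq> []" using assms by (auto simp: primitive_def)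
  define g where "g = gcd (length p) (length q)"
  have g: "g > 0" "g dvd length p" "g dvd length q" using ne by (auto simp: g_def)
  have "rotate (length p) x = x" "rotate (length q) x = x"
    using rotate_length_concat_replicate x_def xq by metis+
  then have "rotate g x = x" unfolding g_def using ne by (intro rotate_fixed_gcd) auto
  moreover have "g dvd length x" using g by (simp add: x_def)
  moreover have "x \<noteq> []" using ne by (simp add: x_def)
  ultimately have x: "x = concat (replicate (length x div g) (take g x))"
    using g rotate_fixed_power by blast
  have pq: "p = take (length p) x" "q = take (length q) x"
    by (simp add: x_def, simp add: xq)
  have t: "take (j * g) x = concat (replicate j (take g x))" if "j * g \<le> length x" for j
  proof -
    have gl: "length (take g x) = g"
      using \<open>g dvd length x\<close> \<open>x \<noteq> []\<close> by (simp add: dvd_imp_le)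
    have jl: "j \<le> length x div g" using that g by (simp add: less_eq_div_iff_mult_less_eq)
    then have "replicate (length x div g) (take g x) = replicate j (take g x) @ replicate (length x div g - j) (take g x)"
      by (simp flip: replicate_add)
    then have "x = concat (replicate j (take g x)) @ concat (replicate (length x div g - j) (take g x))"
      using x by (metis concat_append)
    then have "take (j * g) x = take (j * g) (concat (replicate j (take g x)) @ concat (replicate (length x div g - j) (take g x)))" by metis
    then show ?thesis using gl by simp
  qed
  have root: "r = take g x" if r: "primitive r" "r = take (length r) x" "g dvd length r" "length r \<le> length x" for r
  proof -
    obtain j where j: "length r = j * g" using r(3) by (metis dvdE mult.commute)
    then have "r = concat (replicate j (take g x))" using t[of j] r by metis
    moreover have "j \<noteq> 0" using j r(1) by (cases j) (simp_all add: primitive_def)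
    moreover have "\<not> j \<ge> 2" using r(1) calculation unfolding primitive_def by blast
    ultimately have "j = 1" by linarith
    then show ?thesis using \<open>r = concat (replicate j (take g x))\<close> by simp
  qed
  have "p = take g x" by (rule root) (use assms pq g in \<open>auto simp: x_def\<close>)
  moreover have "q = take g x" by (rule root) (use assms pq g in \<open>auto simp: xq\<close>)
  ultimately have "p = q" by simp
  moreover have "Suc k * length p = Suc m * length q" using assms(3) by (metis length_concat_replicate)
  ultimately show ?thesis using ne by simp
qed

lemma primitive_root_exists:
  assumes "x \<noteq> []"
  shows "\<exists>p k. primitive p \<and> x = concat (replicate (Suc k) p)"
  using assms
proof (induction "length x" arbitrary: x rule: less_induct)
  case less
  show ?case
  proof (cases "primitive x")
    case True
    then show ?thesis by (intro exI[of _ x] exI[of _ 0]) simp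
  next
    case False
    then obtain c a where ca: "a \<ge> 2" "x = concat (replicate a c)" using less.prems unfolding primitive_def by blast
    have "c \<noteq> []" using ca less.prems by auto
    moreover have "length c < length x" using ca \<open>c \<noteq> []\<close> by simp
    ultimately obtain p k where p: "primitive p" "c = concat (replicate (Suc k) p)" using less.hyps by blast
    have "concat (replicate a (concat (replicate b p))) = concat (replicate (a * b) p)" for a b
      by (induction a) (simp_all add: replicate_add)
    then have "x = concat (replicate (a * Suc k) p)" using ca p by metis
    moreover obtain j where "a * Suc k = Suc j" using ca by (cases a) auto
    ultimately show ?thesis using p by metis
  qed
qed

text \<open>This regroups a sum over all words, as it arises from traces, into a sum over primitive
  words and exponents; the exponents start at one.\<close>

lemma bij_betw_powers:
  "bij_betw (\<lambda>(p, k). concat (replicate (Suc k) p)) ({p. primitive p \<and> set p \<subseteq> S} \<times> UNIV) {x. x \<noteq> [] \<and> set x \<subseteq> S}"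
proof (rule bij_betw_imageI)
  show "inj_on (\<lambda>(p, k). concat (replicate (Suc k) p)) ({p. primitive p \<and> set p \<subseteq> S} \<times> UNIV)"
  proof (rule inj_onI, clarify)
    fix p k q m
    assume "primitive p" "primitive q" "concat (replicate (Suc k) p) = concat (replicate (Suc m) q)"
    then show "p = q \<and> k = m" by (rule primitive_root_unique)
  qed
  show "(\<lambda>(p, k). concat (replicate (Suc k) p)) ` ({p. primitive p \<and> set p \<subseteq> S} \<times> UNIV) = {x. x \<noteq> [] \<and> set x \<subseteq> S}"
  proof (intro equalityI subsetI)
    fix x assume "x \<in> (\<lambda>(p, k). concat (replicate (Suc k) p)) ` ({p. primitive p \<and> set p \<subseteq> S} \<times> UNIV)"
    then show "x \<in> {x. x \<noteq> [] \<and> set x \<subseteq> S}"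
    proof (elim imageE SigmaE, clarify)
      fix p k assume p: "primitive p" "set p \<subseteq> S"
      have "concat (replicate (Suc k) p) \<noteq> []" using p(1) by (simp add: primitive_def)
      moreover have "set (concat (replicate (Suc k) p)) \<subseteq> S"
        using set_concat_replicate_subset[of "Suc k" p] p(2) by (rule subset_trans)
      ultimately show "concat (replicate (Suc k) p) \<noteq> [] \<and> set (concat (replicate (Suc k) p)) \<subseteq> S" by blast
    qed
  next
    fix x assume "x \<in> {x. x \<noteq> [] \<and> set x \<subseteq> S}"
    then have x: "x \<noteq> []" "set x \<subseteq> S" by auto
    obtain p k where p: "primitive p" "x = concat (replicate (Suc k) p)"
      using primitive_root_exists[OF x(1)] by blast
    have "set p \<subseteq> set x" unfolding p(2) by simp
    then show "x \<in> (\<lambda>(p, k). concat (replicate (Suc k) p)) ` ({p. primitive p \<and> set p \<subseteq> S} \<times> UNIV)"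
      using p x(2) by (intro image_eqI[of _ _ "(p, k)"]) (simp_all del: replicate_Suc)
  qed
qed

lemma necklace_eq:
  assumes "p \<noteq> []"
  shows "necklace p = (\<lambda>n. rotate n p) ` {..<length p}"
proof
  show "necklace p \<subseteq> (\<lambda>n. rotate n p) ` {..<length p}"
    unfolding necklace_def
  proof (rule image_subsetI)
    fix n
    show "rotate n p \<in> (\<lambda>n. rotate n p) ` {..<length p}"
      by (subst rotate_conv_mod, rule imageI) (simp add: assms)
  qed
qed (auto simp: necklace_def)

text \<open>Two equal rotations give a period below the length, and its gcd with the length
  contradicts primitivity. The count later cancels the denominators of the logarithm series.\<close>

lemma card_necklace:
  assumes "primitive p"
  shows "finite (necklace p)" "card (necklace p) = length p"
proof -
  have ne: "p \<noteq> []" using assms by (simp add: primitive_def)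
  have *: "i = j" if "i \<le> j" "j < length p" "rotate i p = rotate j p" for i j
  proof (rule ccontr)
    assume "i \<noteq> j"
    then have d: "j - i > 0" "j - i < length p" using that by auto
    have "rotate i (rotate (j - i) p) = rotate i p" using that by (simp add: rotate_rotate)
    then have "rotate (j - i) p = p" using rotate_cancel by blast
    moreover have "rotate (length p) p = p" by simp
    ultimately have "rotate (gcd (j - i) (length p)) p = p" using rotate_fixed_gcd d by blast
    moreover have "gcd (j - i) (length p) < length p"
      using gcd_le1_nat[of "j - i" "length p"] d by linarith
    moreover have "gcd (j - i) (length p) > 0" using d by simp
    ultimately show False using assms unfolding primitive_iff_rotate by blast
  qed
  have "inj_on (\<lambda>n. rotate n p) {..<length p}"
  proof (rule inj_onI)
    fix i j assume "i \<in> {..<length p}" "j \<in> {..<length p}" "rotate i p = rotate j p"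
    then show "i = j" using *[of i j] *[of j i] by (cases "i \<le> j") auto
  qed
  then show "finite (necklace p)" "card (necklace p) = length p"
    unfolding necklace_eq[OF ne] by (auto simp: card_image)
qed

lemma necklace_self: "p \<in> necklace p"
  unfolding necklace_def by (rule range_eqI[of _ _ 0]) simp

lemma necklace_cong:
  assumes "q \<in> necklace p"
  shows "necklace q = necklace p"
proof (cases "p = []")
  case False
  obtain n where q: "q = rotate n p" using assms by (auto simp: necklace_def)
  have "necklace q \<subseteq> necklace p" unfolding q necklace_def by (auto simp: rotate_rotate)
  moreover have "rotate m p \<in> necklace q" for m
  proof -
    let ?l = "length p"
    \<comment> \<open>Adding \<open>n\<close> full turns makes it possible to undo the rotation by
      \<open>n\<close> without rotating backwards.\<close>
    have "rotate (m + n * ?l) p = rotate ((m + n * ?l) mod ?l) p" by (rule rotate_conv_mod)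
    also have "\<dots> = rotate (m mod ?l) p" by simp
    also have "\<dots> = rotate m p" by (rule rotate_conv_mod[symmetric])
    finally have "rotate (m + n * ?l) p = rotate m p" .
    moreover have "m + n * ?l = (m + n * (?l - 1)) + n" using False by (cases ?l) auto
    ultimately have "rotate (m + n * (?l - 1)) q = rotate m p" unfolding q by (simp add: rotate_rotate)
    then show ?thesis unfolding necklace_def by (metis rangeI)
  qed
  ultimately show ?thesis unfolding necklace_def[of p] by blast
qed (use assms in \<open>auto simp: necklace_def\<close>)

section \<open>Traces as sums over cyclic words, and the Euler product\<close>

fun chain :: "('a \<Rightarrow> 'a \<Rightarrow> 'b::comm_ring_1) \<Rightarrow> 'a \<Rightarrow> 'a list \<Rightarrow> 'a \<Rightarrow> 'b" where
  "chain W i [] j = W i j"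
| "chain W i (x # xs) j = W i x * chain W x xs j"

definition cyc :: "('a \<Rightarrow> 'a \<Rightarrow> 'b::comm_ring_1) \<Rightarrow> 'a list \<Rightarrow> 'b" where
  "cyc W xs = (case xs of [] \<Rightarrow> 1 | x # ys \<Rightarrow> chain W x ys x)"

lemma chain_append: "chain W i (xs @ y # ys) j = chain W i xs y * chain W y ys j"
  by (induction xs arbitrary: i) (auto simp: mult_ac)

lemma cyc_rotate1: "cyc W (rotate1 xs) = cyc W xs"
proof (cases xs)
  case (Cons x ys)
  show ?thesis
  proof (cases ys)
    case (Cons y zs)
    then show ?thesis using \<open>xs = x # ys\<close> chain_append[of W y zs x "[]" y]
      by (simp add: cyc_def mult.commute)
  qed (use Cons in \<open>simp add: cyc_def\<close>)
qed simp

lemma cyc_rotate: "cyc W (rotate n xs) = cyc W xs"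
  by (induction n) (simp_all add: cyc_rotate1)

lemma cyc_power: "p \<noteq> [] \<Longrightarrow> cyc W (concat (replicate (Suc k) p)) = cyc W p ^ Suc k"
proof (induction k)
  case (Suc k)
  obtain x xs where p: "p = x # xs" using Suc.prems by (cases p) auto
  define zs where "zs = xs @ concat (replicate k p)"
  have z: "concat (replicate (Suc k) p) = x # zs" by (simp add: p zs_def)
  have "concat (replicate (Suc (Suc k)) p) = x # (xs @ x # zs)" using z p by simp
  then have "cyc W (concat (replicate (Suc (Suc k)) p)) = chain W x xs x * chain W x zs x"
    by (simp add: cyc_def chain_append del: replicate_Suc)
  also have "\<dots> = cyc W p * cyc W (concat (replicate (Suc k) p))"
    unfolding z by (simp add: p cyc_def)
  finally show ?case using Suc by simp
qed simp

definition words :: "'a set \<Rightarrow> nat \<Rightarrow> 'a list set" where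
  "words S n = {xs. set xs \<subseteq> S \<and> length xs = n}"

lemma finite_words: "finite S \<Longrightarrow> finite (words S n)"
  unfolding words_def by (rule finite_lists_length_eq)

lemma card_words: "finite S \<Longrightarrow> card (words S n) = card S ^ n"
  unfolding words_def by (rule card_lists_length_eq)

lemma sum_words_Suc: 
  assumes "finite S"
  shows "(\<Sum>xs\<in>words S (Suc n). f xs) = (\<Sum>x\<in>S. \<Sum>xs\<in>words S n. f (x # xs))"
proof -
  have "bij_betw (\<lambda>(x, xs). x # xs) (S \<times> words S n) (words S (Suc n))"
  proof (rule bij_betw_imageI)
    show "(\<lambda>(x, xs). x # xs) ` (S \<times> words S n) = words S (Suc n)"
      by (force simp: words_def image_iff length_Suc_conv)
  qed (auto simp: inj_on_def)
  from sum.reindex_bij_betw[OF this, of f] show ?thesis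
    by (simp add: sum.cartesian_product case_prod_unfold)
qed

lemma mpow_Suc_left: "mpow S W (Suc n) i j = (\<Sum>k\<in>S. W i k * mpow S W n k j)" if "finite S" "i \<in> S" "j \<in> S"
  using that(2,3)
proof (induction n arbitrary: i j)
  case 0
  then show ?case using that(1) by (simp add: mult_delta_left mult_delta_right)
next
  case (Suc n)
  have "mpow S W (Suc (Suc n)) i j = (\<Sum>k\<in>S. mpow S W (Suc n) i k * W k j)" by simp
  also have "\<dots> = (\<Sum>k\<in>S. (\<Sum>l\<in>S. W i l * mpow S W n l k) * W k j)"
    by (rule sum.cong[OF refl]) (simp only: Suc.IH[OF Suc.prems(1)])
  also have "\<dots> = (\<Sum>k\<in>S. \<Sum>l\<in>S. W i l * mpow S W n l k * W k j)"
    by (simp add: sum_distrib_right)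
  also have "\<dots> = (\<Sum>l\<in>S. \<Sum>k\<in>S. W i l * mpow S W n l k * W k j)" by (rule sum.swap)
  also have "\<dots> = (\<Sum>l\<in>S. W i l * mpow S W (Suc n) l j)" by (simp add: sum_distrib_left mult.assoc)
  finally show ?case .
qed

lemma mpow_chain:
  assumes "finite S" "i \<in> S" "j \<in> S"
  shows "(\<Sum>xs\<in>words S n. chain W i xs j) = mpow S W (Suc n) i j"
  using assms(2)
proof (induction n arbitrary: i)
  case 0
  have "words S 0 = {[]}" by (auto simp: words_def)
  then show ?case using assms 0 by (simp add: mult_delta_left)
next
  case (Suc n)
  have "(\<Sum>xs\<in>words S (Suc n). chain W i xs j) = (\<Sum>x\<in>S. W i x * mpow S W (Suc n) x j)"
    unfolding sum_words_Suc[OF assms(1)] using Suc by (simp add: sum_distrib_left[symmetric] del: mpow.simps(2))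
  also have "\<dots> = mpow S W (Suc (Suc n)) i j"
    by (rule mpow_Suc_left[OF assms(1) Suc.prems assms(3), symmetric])
  finally show ?case .
qed

lemma trace_mpow_words:
  assumes "finite S"
  shows "(\<Sum>i\<in>S. mpow S W (Suc n) i i) = (\<Sum>xs\<in>words S (Suc n). cyc W xs)"
  unfolding sum_words_Suc[OF assms]
  by (rule sum.cong[OF refl]) (simp add: cyc_def mpow_chain[OF assms] del: mpow.simps(2))

definition necklaces :: "'a set \<Rightarrow> 'a list set set" where
  "necklaces S = necklace ` {p. primitive p \<and> set p \<subseteq> S}"

text \<open>The chosen representative does not matter, since \<open>cyc\<close> and length are
  constant on a necklace. For the twisted edge matrix this is the term inside an Euler factor, see
  \<open>frobenius_weight\<close>.\<close>

definition necklace_weight :: "('a \<Rightarrow> 'a \<Rightarrow> complex) \<Rightarrow> complex \<Rightarrow> 'a list set \<Rightarrow> complex" where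
  "necklace_weight W u N = cyc W (SOME p. p \<in> N) * u ^ length (SOME p. p \<in> N)"

lemma necklace_length: "q \<in> necklace p \<Longrightarrow> length q = length p"
  by (auto simp: necklace_def)

lemma necklace_cyc: "q \<in> necklace p \<Longrightarrow> cyc W q = cyc W p"
  by (auto simp: necklace_def cyc_rotate)

lemma necklace_weight_eq:
  assumes "q \<in> necklace p"
  shows "necklace_weight W u (necklace p) = cyc W q * u ^ length q"
proof -
  have "(SOME q. q \<in> necklace p) \<in> necklace p" using necklace_self by (rule someI)
  then show ?thesis
    unfolding necklace_weight_def using assms by (simp add: necklace_cyc necklace_length)
qed

lemma norm_chain_le:
  assumes "\<And>i j. i \<in> S \<Longrightarrow> j \<in> S \<Longrightarrow> norm (W i j) \<le> K" "K \<ge> 0" "i \<in> S" "j \<in> S" "set xs \<subseteq> S"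
  shows "norm (chain W i xs j :: complex) \<le> K ^ Suc (length xs)"
  using assms(3,5)
proof (induction xs arbitrary: i)
  case (Cons x xs)
  then have "norm (chain W x xs j) \<le> K ^ Suc (length xs)" "norm (W i x) \<le> K" using assms(1) by auto
  then show ?case using assms(2) by (simp add: norm_mult mult_mono)
qed (use assms in auto)

lemma norm_cyc_le:
  assumes "\<And>i j. i \<in> S \<Longrightarrow> j \<in> S \<Longrightarrow> norm (W i j) \<le> K" "K \<ge> 0" "set xs \<subseteq> S"
  shows "norm (cyc W xs :: complex) \<le> K ^ length xs"
proof (cases xs)
  case (Cons x ys)
  then show ?thesis using norm_chain_le[of S W K x x ys] assms by (simp add: cyc_def)
qed (simp add: cyc_def)

text \<open>The bridge is the sum of \<open>cyc W x * u ^ |x| / |x|\<close> over all nonempty words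
  \<open>x\<close>. Grouped by length it is the trace series of \<open>exp_trace_mpow\<close>.
  Grouped by primitive root it is a sum of logarithm series divided by \<open>|p|\<close>, and the
  \<open>|p|\<close> rotations in a necklace cancel that denominator. Absolute convergence near 0
  justifies the regrouping.\<close>

theorem euler_product_necklaces:
  fixes W :: "'a \<Rightarrow> 'a \<Rightarrow> complex"
  assumes S: "finite S"
  shows "\<exists>r>0. \<forall>u. norm u < r \<longrightarrow> (\<forall>N\<in>necklaces S. norm (necklace_weight W u N) < 1) \<and>
    (\<exists>l. ((\<lambda>N. - Ln (1 - necklace_weight W u N)) has_sum l) (necklaces S) \<and>
    exp l * fdet S (\<lambda>i j. (if i = j then 1 else 0) - u * W i j) = 1)"
proof -
  obtain r0 where r0: "r0 > 0" "\<And>u. norm u < r0 \<Longrightarrow>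
      (\<exists>l. (\<lambda>k. u ^ Suc k / of_nat (Suc k) * (\<Sum>i\<in>S. mpow S W (Suc k) i i)) sums l \<and>
      exp l * fdet S (\<lambda>i j. (if i = j then 1 else 0) - u * W i j) = 1)"
    using exp_trace_mpow[OF S, of W] by blast
  define K where "K = 1 + (\<Sum>i\<in>S. \<Sum>j\<in>S. norm (W i j))"
  have K: "K \<ge> 1" unfolding K_def by (simp add: sum_nonneg)
  have WK: "norm (W i j) \<le> K" if "i \<in> S" "j \<in> S" for i j
  proof -
    have "norm (W i j) \<le> (\<Sum>j\<in>S. norm (W i j))" using that S by (intro member_le_sum) auto
    also have "\<dots> \<le> (\<Sum>i\<in>S. \<Sum>j\<in>S. norm (W i j))"
      using that S member_le_sum[of i S "\<lambda>i. \<Sum>j\<in>S. norm (W i j)"] by (simp add: sum_nonneg)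
    finally show ?thesis by (simp add: K_def)
  qed
  \<comment> \<open>There are \<open>card S ^ n\<close> words of length \<open>n\<close>, each of
    weight at most \<open>(K * |u|) ^ n\<close>. For |u| < 1 / (K s) the norms are therefore
    dominated by a geometric series.\<close>
  define s where "s = real (card S) + 1"
  have s: "s \<ge> 1" by (simp add: s_def)
  define r where "r = min r0 (1 / (K * s))"
  have rpos: "r > 0" using r0 K s by (simp add: r_def)
  have main: "(\<forall>N\<in>necklaces S. norm (necklace_weight W u N) < 1) \<and>
      (\<exists>l. ((\<lambda>N. - Ln (1 - necklace_weight W u N)) has_sum l) (necklaces S) \<and>
      exp l * fdet S (\<lambda>i j. (if i = j then 1 else 0) - u * W i j) = 1)" if u: "norm u < r" for u
  proof -
    define q where "q = K * s * norm u"
    have q: "0 \<le> q" "q < 1" using u K s by (auto simp: q_def r_def field_simps)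
    have Ku: "K * norm u < 1"
    proof -
      have "K * norm u * 1 \<le> K * norm u * s" using K s by (intro mult_left_mono) auto
      then show ?thesis using q by (simp add: q_def mult_ac)
    qed
    define z where "z p = cyc W p * u ^ length p" for p
    have zle: "norm (z p) \<le> (K * norm u) ^ length p" if "set p \<subseteq> S" for p
      using norm_cyc_le[OF WK _ that] K
      by (simp add: z_def norm_mult norm_power power_mult_distrib mult_right_mono)
    have z1: "norm (z p) < 1" if "set p \<subseteq> S" "p \<noteq> []" for p
    proof -
      have "(K * norm u) ^ length p \<le> (K * norm u) ^ 1"
        using Ku K that by (intro power_decreasing) (auto simp: Suc_le_eq)
      then have "(K * norm u) ^ length p < 1" using Ku by simp
      then show ?thesis using zle[OF that(1)] by linarith
    qed
    define f where "f x = z x / of_nat (length x)" for x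
    have sumf: "(\<lambda>(n::nat, x). norm (f x)) summable_on (Sigma UNIV (\<lambda>n. words S (Suc n)))"
    proof (rule summable_on_SigmaI[where g = "\<lambda>n. \<Sum>x\<in>words S (Suc n). norm (f x)"])
      show "((\<lambda>y. case (n, y) of (n, x) \<Rightarrow> norm (f x)) has_sum (\<Sum>x\<in>words S (Suc n). norm (f x))) (words S (Suc n))" for n
        using finite_words[OF S] by simp
      have b: "(\<Sum>x\<in>words S (Suc n). norm (f x)) \<le> q ^ Suc n" for n
      proof -
        have "(\<Sum>x\<in>words S (Suc n). norm (f x)) \<le> (\<Sum>x\<in>words S (Suc n). (K * norm u) ^ Suc n)"
        proof (rule sum_mono)
          fix x assume x: "x \<in> words S (Suc n)"
          have "norm (f x) \<le> norm (z x)" using x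
            by (simp add: f_def words_def norm_divide divide_le_eq mult_le_cancel_left1 del: of_nat_Suc)
          also have "\<dots> \<le> (K * norm u) ^ Suc n" using zle[of x] x by (simp add: words_def)
          finally show "norm (f x) \<le> (K * norm u) ^ Suc n" .
        qed
        also have "\<dots> = (real (card S)) ^ Suc n * (K * norm u) ^ Suc n"
          using card_words[OF S, of "Suc n"] by simp
        also have "\<dots> = (card S * (K * norm u)) ^ Suc n" by (simp add: power_mult_distrib)
        also have "\<dots> \<le> q ^ Suc n"
          by (rule power_mono) (use K in \<open>auto simp: q_def s_def algebra_simps\<close>)
        finally show ?thesis .
      qed
      have "summable (\<lambda>n. q ^ Suc n)" using q by (simp add: summable_mult)
      then have "summable (\<lambda>n. norm (\<Sum>x\<in>words S (Suc n). norm (f x)))"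
        by (rule summable_comparison_test'[of _ 0]) (use b in \<open>simp add: sum_nonneg\<close>)
      then show "(\<lambda>n. \<Sum>x\<in>words S (Suc n). norm (f x)) summable_on UNIV"
        by (rule norm_summable_imp_summable_on)
    qed auto
    define l where "l = infsum (\<lambda>(n::nat, x). f x) (Sigma UNIV (\<lambda>n. words S (Suc n)))"
    have "(\<lambda>nx. norm (case nx of (n::nat, x) \<Rightarrow> f x)) summable_on (Sigma UNIV (\<lambda>n. words S (Suc n)))"
      using sumf by (simp add: case_prod_unfold)
    then have "(\<lambda>(n::nat, x). f x) summable_on (Sigma UNIV (\<lambda>n. words S (Suc n)))"
      by (rule Infinite_Sum.abs_summable_summable)
    then have hs: "((\<lambda>(n::nat, x). f x) has_sum l) (Sigma UNIV (\<lambda>n. words S (Suc n)))"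
      unfolding l_def by (rule has_sum_infsum)
    have "((\<lambda>n. \<Sum>x\<in>words S (Suc n). f x) has_sum l) UNIV"
      by (rule has_sum_SigmaD[OF hs]) (use finite_words[OF S] in simp)
    then have "(\<lambda>n. \<Sum>x\<in>words S (Suc n). f x) sums l" by (rule has_sum_imp_sums)
    moreover have "(\<Sum>x\<in>words S (Suc n). f x) = u ^ Suc n / of_nat (Suc n) * (\<Sum>i\<in>S. mpow S W (Suc n) i i)" for n
      unfolding trace_mpow_words[OF S] sum_distrib_left
      by (rule sum.cong) (auto simp: f_def z_def words_def)
    ultimately have l: "(\<lambda>k. u ^ Suc k / of_nat (Suc k) * (\<Sum>i\<in>S. mpow S W (Suc k) i i)) sums l" by simp
    have "norm u < r0" using u by (simp add: r_def)
    from r0(2)[OF this] have expl: "exp l * fdet S (\<lambda>i j. (if i = j then 1 else 0) - u * W i j) = 1"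
      using sums_unique2[OF l] by blast
    let ?P = "{p. primitive p \<and> set p \<subseteq> S}"
    have "bij_betw snd (Sigma UNIV (\<lambda>n. words S (Suc n))) {x. x \<noteq> [] \<and> set x \<subseteq> S}"
    proof (rule bij_betw_byWitness[where f' = "\<lambda>x. (length x - 1, x)"])
      show "snd ` (Sigma UNIV (\<lambda>n. words S (Suc n))) \<subseteq> {x. x \<noteq> [] \<and> set x \<subseteq> S}"
        by (auto simp: words_def)
      show "(\<lambda>x. (length x - 1, x)) ` {x. x \<noteq> [] \<and> set x \<subseteq> S} \<subseteq> Sigma UNIV (\<lambda>n. words S (Suc n))"
        by (auto simp: words_def)
    qed (auto simp: words_def)
    from has_sum_reindex_bij_betw[OF this, of f l] have "(f has_sum l) {x. x \<noteq> [] \<and> set x \<subseteq> S}"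
      using hs by (simp add: case_prod_unfold)
    then have hp: "((\<lambda>pk. f (case pk of (p, k) \<Rightarrow> concat (replicate (Suc k) p))) has_sum l) (?P \<times> UNIV)"
      using has_sum_reindex_bij_betw[OF bij_betw_powers[of S], of f l] by blast
    have hP: "((\<lambda>p. - Ln (1 - z p) / of_nat (length p)) has_sum l) ?P"
    proof (rule has_sum_SigmaD[OF hp])
      fix p assume p: "p \<in> ?P"
      then have ne: "p \<noteq> []" by (simp add: primitive_def)
      have e: "f (concat (replicate (Suc k) p)) = (z p ^ Suc k / of_nat (Suc k)) / of_nat (length p)" for k
        unfolding f_def z_def cyc_power[OF ne] length_concat_replicate
        by (simp only: power_mult_distrib power_mult[symmetric] of_nat_mult divide_divide_eq_left mult.commute[of "Suc k" "length p"]
              mult.commute[of "of_nat (length p)" "of_nat (Suc k)"])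
      have n1: "norm (z p) < 1" using z1 p ne by blast
      have "(\<lambda>k. (z p ^ Suc k / of_nat (Suc k)) / of_nat (length p)) sums (- Ln (1 - z p) / of_nat (length p))"
        by (rule sums_divide[OF minus_Ln_sums[OF n1]])
      moreover have "summable (\<lambda>k. norm ((z p ^ Suc k / of_nat (Suc k)) / of_nat (length p)))"
      proof (rule summable_comparison_test'[of "\<lambda>k. norm (z p) ^ Suc k" 0])
        show "summable (\<lambda>k. norm (z p) ^ Suc k)" using n1 by (simp add: summable_mult)
        fix k :: nat
        have "1 \<le> real (Suc k) * real (length p)" using ne
          by (metis One_nat_def Suc_leI length_greater_0_conv mult_le_mono mult_1 of_nat_1 of_nat_le_iff of_nat_mult zero_less_Suc)
        then have "norm (z p) ^ Suc k / (real (Suc k) * real (length p)) \<le> norm (z p) ^ Suc k / 1"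
          by (intro divide_left_mono) simp_all
        then show "norm (norm ((z p ^ Suc k / of_nat (Suc k)) / of_nat (length p))) \<le> norm (z p) ^ Suc k"
          by (simp add: norm_divide norm_power norm_mult del: of_nat_Suc power_Suc)
      qed
      ultimately have "((\<lambda>k. (z p ^ Suc k / of_nat (Suc k)) / of_nat (length p)) has_sum (- Ln (1 - z p) / of_nat (length p))) UNIV"
        by (intro norm_summable_imp_has_sum)
      then show "((\<lambda>k. f (case (p, k) of (p, k) \<Rightarrow> concat (replicate (Suc k) p))) has_sum (- Ln (1 - z p) / of_nat (length p))) UNIV"
        unfolding prod.case e .
    qed
    have "bij_betw snd (Sigma (necklaces S) (\<lambda>N. N)) ?P"
    proof (rule bij_betw_byWitness[where f' = "\<lambda>p. (necklace p, p)"])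
      show "\<forall>a\<in>Sigma (necklaces S) (\<lambda>N. N). (necklace (snd a), snd a) = a"
        by (auto simp: necklaces_def necklace_cong)
      show "snd ` (Sigma (necklaces S) (\<lambda>N. N)) \<subseteq> ?P"
        by (auto simp: necklaces_def necklace_def primitive_rotate)
      show "(\<lambda>p. (necklace p, p)) ` ?P \<subseteq> Sigma (necklaces S) (\<lambda>N. N)"
        by (auto simp: necklaces_def necklace_self)
    qed auto
    from has_sum_reindex_bij_betw[OF this, of "\<lambda>p. - Ln (1 - z p) / of_nat (length p)" l] hP
    have hN: "((\<lambda>Np. - Ln (1 - z (snd Np)) / of_nat (length (snd Np))) has_sum l) (Sigma (necklaces S) (\<lambda>N. N))"
      by simp
    have "((\<lambda>N. - Ln (1 - necklace_weight W u N)) has_sum l) (necklaces S)"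
    proof (rule has_sum_SigmaD[OF hN])
      fix N assume "N \<in> necklaces S"
      then obtain p where p: "primitive p" "set p \<subseteq> S" "N = necklace p" by (auto simp: necklaces_def)
      have w: "necklace_weight W u N = z p"
        using necklace_weight_eq[OF necklace_self, of W u p] p by (simp add: z_def)
      have "(\<Sum>q\<in>N. - Ln (1 - z q) / of_nat (length q)) = (\<Sum>q\<in>N. - Ln (1 - z p) / of_nat (length p))"
        by (rule sum.cong) (auto simp: p(3) z_def necklace_cyc necklace_length)
      also have "\<dots> = - Ln (1 - z p)"
        using card_necklace[OF p(1)] p by (simp add: primitive_def)
      finally have "- Ln (1 - necklace_weight W u N) = (\<Sum>q\<in>N. - Ln (1 - z q) / of_nat (length q))" using w by simp
      then show "((\<lambda>q. - Ln (1 - z (snd (N, q))) / of_nat (length (snd (N, q)))) has_sum - Ln (1 - necklace_weight W u N)) N"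
        using card_necklace(1)[OF p(1)] p(3) by (simp add: has_sum_finiteI)
    qed
    moreover have "norm (necklace_weight W u N) < 1" if "N \<in> necklaces S" for N
    proof -
      obtain p where p: "primitive p" "set p \<subseteq> S" "N = necklace p"
        using \<open>N \<in> necklaces S\<close> by (auto simp: necklaces_def)
      then show ?thesis using necklace_weight_eq[OF necklace_self, of W u p] z1[of p]
        by (simp add: z_def primitive_def)
    qed
    ultimately show ?thesis using expl by blast
  qed
  show ?thesis using rpos main by blast
qed

section \<open>Characters of finite abelian groups\<close>

lemma (in comm_group) character_one: "\<psi> \<in> characters G \<Longrightarrow> \<psi> \<one> = 1"
proof -
  assume "\<psi> \<in> characters G"
  then have "\<psi> \<one> \<noteq> 0" "\<psi> (\<one> \<otimes> \<one>) = \<psi> \<one> * \<psi> \<one>"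
    unfolding characters_def using one_closed by blast+
  then show ?thesis by simp
qed

lemma (in comm_group) character_pow: "\<psi> \<in> characters G \<Longrightarrow> g \<in> carrier G \<Longrightarrow> \<psi> (g [^] (n::nat)) = \<psi> g ^ n"
  by (induction n) (auto simp: character_one characters_def)

lemma (in comm_group) character_mult:
  "\<psi> \<in> characters G \<Longrightarrow> g \<in> carrier G \<Longrightarrow> h \<in> carrier G \<Longrightarrow> \<psi> (g \<otimes> h) = \<psi> g * \<psi> h"
  by (auto simp: characters_def)

lemma (in comm_group) pow_order_one:
  assumes "finite (carrier G)" "g \<in> carrier G"
  shows "g [^] order G = \<one>"
  using power_order_eq_one[OF assms] by (simp add: Coset.order_def)

lemma (in comm_group) character_norm:
  assumes "finite (carrier G)" "\<psi> \<in> characters G" "g \<in> carrier G"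
  shows "norm (\<psi> g) = 1"
proof -
  have "\<psi> g ^ order G = 1"
    using character_pow[OF assms(2,3), of "order G"] pow_order_one[OF assms(1,3)] character_one[OF assms(2)] by simp
  then have "norm (\<psi> g) = 1 \<or> order G = 0" by (rule power_eq_1_iff)
  then show ?thesis using assms(1) order_gt_0_iff_finite by simp
qed

lemma (in comm_group) character_inv:
  assumes "finite (carrier G)" "\<psi> \<in> characters G" "g \<in> carrier G"
  shows "\<psi> (inv g) = cnj (\<psi> g)"
proof -
  have "\<psi> g * \<psi> (inv g) = 1"
    using character_mult[OF assms(2,3) inv_closed[OF assms(3)]] assms(3) character_one[OF assms(2)] by simp
  moreover have "\<psi> g * cnj (\<psi> g) = 1"
    using character_norm[OF assms] by (simp add: complex_norm_square[symmetric])
  ultimately show ?thesis by (metis mult_cancel_left mult_zero_left zero_neq_one)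
qed

lemma (in comm_group) trivial_character_in: "trivial_character G \<in> characters G"
  by (auto simp: characters_def trivial_character_def)

lemma (in comm_group) finite_characters:
  assumes fin: "finite (carrier G)"
  shows "finite (characters G)"
proof (rule finite_subset)
  let ?R = "{z::complex. z ^ order G = 1}"
  have o: "order G > 0" using fin order_gt_0_iff_finite by blast
  have "finite ?R" by (rule finite_roots_unity) (use o in simp)
  then show "finite {f. \<forall>x. (x \<in> carrier G \<longrightarrow> f x \<in> ?R) \<and> (x \<notin> carrier G \<longrightarrow> f x = 0)}"
    using fin by (rule finite_set_of_finite_funs[rotated])
  have "\<psi> x ^ order G = 1" if "\<psi> \<in> characters G" "x \<in> carrier G" for \<psi> x
    using character_pow[OF that, of "order G"] pow_order_one[OF fin that(2)] character_one[OF that(1)] by simp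
  then show "characters G \<subseteq> {f. \<forall>x. (x \<in> carrier G \<longrightarrow> f x \<in> ?R) \<and> (x \<notin> carrier G \<longrightarrow> f x = 0)}"
    by (auto simp: characters_def)
qed

text \<open>The only choice is the value at the new element, a root of the value at its first power that
  lies in the subgroup.\<close>

lemma (in comm_group) character_extend_one:
  fixes \<psi> :: "'a \<Rightarrow> complex"
  assumes fin: "finite (carrier G)" and H: "subgroup H G"
    and \<psi>: "\<And>h. h \<in> H \<Longrightarrow> \<psi> h \<noteq> 0" "\<And>h k. h \<in> H \<Longrightarrow> k \<in> H \<Longrightarrow> \<psi> (h \<otimes> k) = \<psi> h * \<psi> k"
    and x: "x \<in> carrier G"
  shows "\<exists>H' \<phi>. subgroup H' G \<and> H \<subseteq> H' \<and> x \<in> H' \<and> (\<forall>h\<in>H'. \<phi> h \<noteq> (0::complex)) \<and>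
    (\<forall>h\<in>H'. \<forall>k\<in>H'. \<phi> (h \<otimes> k) = \<phi> h * \<phi> k) \<and> (\<forall>h\<in>H. \<phi> h = \<psi> h)"
proof -
  interpret H: subgroup H G by (rule H)
  have \<psi>1: "\<psi> \<one> = 1" using \<psi>(1)[OF H.one_closed] \<psi>(2)[OF H.one_closed H.one_closed] by simp
  define n where "n = (LEAST n::nat. n > 0 \<and> x [^] n \<in> H)"
  have "order G > 0 \<and> x [^] order G \<in> H"
    using fin order_gt_0_iff_finite pow_order_one[OF fin x] by simp
  then have n: "n > 0" "x [^] n \<in> H" unfolding n_def by (metis (mono_tags, lifting) LeastI)+
  have nmin: "\<not> (0 < m \<and> m < n \<and> x [^] m \<in> H)" for m
    unfolding n_def using not_less_Least[of m "\<lambda>n. n > 0 \<and> x [^] n \<in> H"] by blast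
  have ndvd: "n dvd m" if "x [^] m \<in> H" for m :: nat
  proof -
    have "(x [^] n) [^] k \<in> H" for k :: nat
      by (induction k) (use n(2) in auto)
    then have a: "x [^] (n * (m div n)) \<in> H" using x by (simp add: nat_pow_pow)
    have "x [^] m = x [^] (n * (m div n)) \<otimes> x [^] (m mod n)"
      using x by (simp add: nat_pow_mult)
    then have "x [^] (m mod n) = inv (x [^] (n * (m div n))) \<otimes> x [^] m"
      using x by (simp add: inv_solve_left)
    then have "x [^] (m mod n) \<in> H" using a that by simp
    then have "m mod n = 0" using nmin[of "m mod n"] n(1) by auto
    then show ?thesis by blast
  qed
  define c where "c = (if \<psi> (x [^] n) = 0 then 0 else exp (Ln (\<psi> (x [^] n)) / of_nat n))"
  have c: "c \<noteq> 0" "c ^ n = \<psi> (x [^] n)"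
    using \<psi>(1)[OF n(2)] n(1) by (auto simp: c_def exp_of_nat_mult[symmetric])
  have \<psi>pow: "\<psi> (x [^] m) = c ^ m" if "x [^] m \<in> H" for m :: nat
  proof -
    have "n dvd m" by (rule ndvd[OF that])
    then obtain j where j: "m = n * j" by (elim dvdE)
    have "(x [^] n) [^] j \<in> H \<and> \<psi> ((x [^] n) [^] j) = (c ^ n) ^ j"
      by (induction j) (use n(2) \<psi>1 \<psi>(2) c(2) in auto)
    then show ?thesis using x by (simp add: j nat_pow_pow power_mult)
  qed
  define H' where "H' = {h \<otimes> x [^] (m::nat) | h m. h \<in> H}"
  \<comment> \<open>The decomposition of an element as \<open>h\<close> times a power of
    \<open>x\<close> is not unique. Two of them differ by a power of \<open>x\<close> in
    \<open>H\<close>, where \<open>\<psi>pow\<close> already prescribes the value.\<close>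
  have wd0: "\<psi> h * c ^ m = \<psi> k * c ^ l" if "h \<in> H" "k \<in> H" "h \<otimes> x [^] m = k \<otimes> x [^] l" "l \<le> m" for h k and m l :: nat
  proof -
    have hc: "h \<in> carrier G" "k \<in> carrier G" using that by auto
    have "h \<otimes> x [^] (m - l) \<otimes> x [^] l = k \<otimes> x [^] l"
      using that hc x by (simp add: m_assoc nat_pow_mult)
    then have e: "h \<otimes> x [^] (m - l) = k" using hc x by simp
    then have "x [^] (m - l) = inv h \<otimes> k" using hc x by (auto simp: inv_solve_left)
    then have xm: "x [^] (m - l) \<in> H" using that by simp
    have "\<psi> k = \<psi> h * c ^ (m - l)" using \<psi>(2)[OF that(1) xm] \<psi>pow[OF xm] e by simp
    then show ?thesis using that(4) by (simp add: mult.assoc flip: power_add)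
  qed
  have wd: "\<psi> h * c ^ m = \<psi> k * c ^ l" if "h \<in> H" "k \<in> H" "h \<otimes> x [^] m = k \<otimes> x [^] l" for h k and m l :: nat
    using wd0[OF that] wd0[OF that(2,1) that(3)[symmetric]] by (cases "l \<le> m") auto
  define \<phi> where "\<phi> y = (SOME z. \<exists>h m. h \<in> H \<and> y = h \<otimes> x [^] (m::nat) \<and> z = \<psi> h * c ^ m)" for y
  have \<phi>: "\<phi> (h \<otimes> x [^] m) = \<psi> h * c ^ m" if "h \<in> H" for h and m :: nat
  proof -
    have "\<exists>z h' m'. h' \<in> H \<and> h \<otimes> x [^] m = h' \<otimes> x [^] (m'::nat) \<and> z = \<psi> h' * c ^ m'" using that by blast
    from someI_ex[OF this] obtain h' m' where "h' \<in> H" "h \<otimes> x [^] m = h' \<otimes> x [^] (m'::nat)" "\<phi> (h \<otimes> x [^] m) = \<psi> h' * c ^ m'"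
      unfolding \<phi>_def by blast
    then show ?thesis using wd[OF that] by metis
  qed
  have mul: "(h \<otimes> x [^] m) \<otimes> (k \<otimes> x [^] l) = (h \<otimes> k) \<otimes> x [^] (m + l)" if "h \<in> H" "k \<in> H" for h k and m l :: nat
    using that x by (simp add: m_ac nat_pow_mult[symmetric])
  have H'c: "H' \<subseteq> carrier G" using x by (auto simp: H'_def)
  have H'm: "y \<otimes> y' \<in> H'" if y: "y \<in> H'" "y' \<in> H'" for y y'
  proof -
    obtain h m k l where "h \<in> H" "y = h \<otimes> x [^] (m::nat)" "k \<in> H" "y' = k \<otimes> x [^] (l::nat)"
      using y unfolding H'_def by blast
    then show ?thesis unfolding H'_def using mul H.m_closed by blast
  qed
  have in1: "h \<in> H'" if "h \<in> H" for h
  proof -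
    have "h = h \<otimes> x [^] (0::nat)" using that by simp
    then show ?thesis using that unfolding H'_def by blast
  qed
  have sub: "subgroup H' G"
  proof (rule subgroupI[OF H'c])
    show "H' \<noteq> {}" using in1[OF H.one_closed] by blast
    show "inv y \<in> H'" if y: "y \<in> H'" for y
    proof -
      have yc: "y \<in> carrier G" using y H'c by blast
      have pw: "y [^] k \<in> H'" for k :: nat
        by (induction k) (use in1[OF H.one_closed] H'm[OF _ y] in auto)
      have "y \<otimes> y [^] (order G - 1) = \<one>"
      proof -
        have "order G > 0" using fin order_gt_0_iff_finite by blast
        then have "y [^] (Suc 0) \<otimes> y [^] (order G - 1) = y [^] order G"
          unfolding nat_pow_mult[OF yc] by simp
        then show ?thesis using pow_order_one[OF fin yc] yc by simp
      qed
      then have "inv y = y [^] (order G - 1)" using yc by (metis inv_equality inv_inv inv_closed nat_pow_closed)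
      then show ?thesis using pw by simp
    qed
  qed (use H'm in blast)
  have "x = \<one> \<otimes> x [^] (1::nat)" using x by simp
  then have xin: "x \<in> H'" unfolding H'_def using H.one_closed by blast
  have "\<phi> y \<noteq> 0" if y: "y \<in> H'" for y
  proof -
    obtain h m where "h \<in> H" "y = h \<otimes> x [^] (m::nat)" using y unfolding H'_def by blast
    then show ?thesis using \<phi> \<psi>(1) c(1) by simp
  qed
  moreover have "\<phi> (y \<otimes> y') = \<phi> y * \<phi> y'" if y: "y \<in> H'" "y' \<in> H'" for y y'
  proof -
    obtain h m k l where e: "h \<in> H" "y = h \<otimes> x [^] (m::nat)" "k \<in> H" "y' = k \<otimes> x [^] (l::nat)"
      using y unfolding H'_def by blast
    then show ?thesis using mul[OF e(1,3)] by (simp add: \<phi> \<psi>(2) power_add)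
  qed
  moreover have "\<phi> h = \<psi> h" if "h \<in> H" for h
    using \<phi>[OF that, of 0] that by simp
  ultimately show ?thesis using sub in1 xin by (intro exI[of _ H'] exI[of _ \<phi>]) auto
qed

lemma (in comm_group) character_extend:
  fixes \<psi> :: "'a \<Rightarrow> complex"
  assumes fin: "finite (carrier G)" and H: "subgroup H G"
    and \<psi>: "\<And>h. h \<in> H \<Longrightarrow> \<psi> h \<noteq> 0" "\<And>h k. h \<in> H \<Longrightarrow> k \<in> H \<Longrightarrow> \<psi> (h \<otimes> k) = \<psi> h * \<psi> k"
  shows "\<exists>\<phi>\<in>characters G. \<forall>h\<in>H. \<phi> h = \<psi> h"
  using H \<psi>
proof (induction "card (carrier G - H)" arbitrary: H \<psi> rule: less_induct)
  case less
  show ?case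
  proof (cases "H = carrier G")
    case True
    let ?\<phi> = "\<lambda>g. if g \<in> carrier G then \<psi> g else 0"
    have "?\<phi> \<in> characters G"
      using less.prems(2,3) unfolding characters_def True by auto
    then show ?thesis using True by (intro bexI[of _ ?\<phi>]) simp_all
  next
    case False
    have "H \<subseteq> carrier G" using less.prems(1) by (rule subgroup.subset)
    then obtain x where x: "x \<in> carrier G" "x \<notin> H" using False by blast
    have "\<exists>H' \<phi>. subgroup H' G \<and> H \<subseteq> H' \<and> x \<in> H' \<and> (\<forall>h\<in>H'. \<phi> h \<noteq> (0::complex)) \<and>
        (\<forall>h\<in>H'. \<forall>k\<in>H'. \<phi> (h \<otimes> k) = \<phi> h * \<phi> k) \<and> (\<forall>h\<in>H. \<phi> h = \<psi> h)"
      by (rule character_extend_one[OF fin less.prems(1) _ _ x(1)]) (use less.prems(2,3) in blast)+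
    then obtain H' \<phi> where "subgroup H' G \<and> H \<subseteq> H' \<and> x \<in> H' \<and> (\<forall>h\<in>H'. \<phi> h \<noteq> (0::complex)) \<and>
        (\<forall>h\<in>H'. \<forall>k\<in>H'. \<phi> (h \<otimes> k) = \<phi> h * \<phi> k) \<and> (\<forall>h\<in>H. \<phi> h = \<psi> h)" by (elim exE)
    then have H': "subgroup H' G" "H \<subseteq> H'" "x \<in> H'" "\<And>h. h\<in>H' \<Longrightarrow> \<phi> h \<noteq> 0"
      "\<And>h k. h\<in>H' \<Longrightarrow> k\<in>H' \<Longrightarrow> \<phi> (h \<otimes> k) = \<phi> h * \<phi> k" "\<And>h. h \<in> H \<Longrightarrow> \<phi> h = \<psi> h"
      by blast+
    have "card (carrier G - H') < card (carrier G - H)"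
      using fin x H' by (intro psubset_card_mono) auto
    have "\<exists>\<phi>'\<in>characters G. \<forall>h\<in>H'. \<phi>' h = \<phi> h"
      by (rule less.hyps[OF \<open>card (carrier G - H') < _\<close> H'(1)]) (use H'(4,5) in blast)+
    then obtain ch where ch: "ch \<in> characters G" "\<forall>h\<in>H'. ch h = \<phi> h" by blast
    show ?thesis
    proof (rule bexI[OF _ ch(1)], rule ballI)
      fix h assume "h \<in> H"
      then show "ch h = \<psi> h" using ch(2) H'(2,6) by fastforce
    qed
  qed
qed

text \<open>On the cyclic group generated by \<open>g\<close>, of order \<open>n\<close>, send
  \<open>g\<close> to exp(2 \<pi> i / n), which differs from 1 as n > 1; then extend to the whole
  group.\<close>

lemma (in comm_group) characters_separate:
  assumes fin: "finite (carrier G)" and g: "g \<in> carrier G" "g \<noteq> \<one>"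
  shows "\<exists>\<phi>\<in>characters G. \<phi> g \<noteq> 1"
proof -
  define n where "n = (LEAST n::nat. n > 0 \<and> g [^] n = \<one>)"
  have "order G > 0 \<and> g [^] order G = \<one>"
    using fin order_gt_0_iff_finite pow_order_one[OF fin g(1)] by simp
  then have n: "n > 0" "g [^] n = \<one>" unfolding n_def by (metis (mono_tags, lifting) LeastI)+
  have nmin: "\<not> (0 < m \<and> m < n \<and> g [^] m = \<one>)" for m
    unfolding n_def using not_less_Least[of m "\<lambda>n. n > 0 \<and> g [^] n = \<one>"] by blast
  have n1: "n > 1" using n g by (cases "n = 1") auto
  have md: "g [^] m = g [^] (m mod n)" for m :: nat
  proof -
    have "g [^] m = g [^] (n * (m div n)) \<otimes> g [^] (m mod n)" using g by (simp add: nat_pow_mult)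
    also have "g [^] (n * (m div n)) = \<one>" using g n by (simp add: nat_pow_pow[symmetric])
    finally show ?thesis using g by simp
  qed
  have inj: "i mod n = j mod n" if "g [^] i = g [^] j" for i j :: nat
  proof -
    have *: "i = j" if "g [^] i = g [^] j" "i \<le> j" "j < n" for i j :: nat
    proof -
      have "g [^] i \<otimes> g [^] (j - i) = g [^] (i + (j - i))" using g by (simp add: nat_pow_mult)
      also have "\<dots> = g [^] i" using that by simp
      finally have "g [^] i \<otimes> g [^] (j - i) = g [^] i" .
      then have "g [^] (j - i) = \<one>" using g by simp
      then show ?thesis using nmin[of "j - i"] that by auto
    qed
    have "g [^] (i mod n) = g [^] (j mod n)" using that md by metis
    then show ?thesis using *[of "i mod n" "j mod n"] *[of "j mod n" "i mod n"] n(1)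
      by (cases "i mod n \<le> j mod n") auto
  qed
  define \<omega> where "\<omega> = cis (2 * pi / n)"
  have "\<omega> ^ n = cis (2 * pi)" using n(1) unfolding \<omega>_def by (subst Complex.DeMoivre) simp
  then have w: "\<omega> ^ n = 1" "\<omega> \<noteq> 0" by (auto simp: \<omega>_def)
  have w1: "\<omega> \<noteq> 1"
  proof
    assume "\<omega> = 1"
    then have "cos (2 * pi / n) = 1" unfolding \<omega>_def by (metis cis.sel(1) one_complex.sel(1))
    then obtain k :: int where "2 * pi / n = of_int k * (2 * pi)" by (auto simp: cos_one_2pi_int)
    then have "2 * pi * 1 = 2 * pi * (of_int k * real n)" using n(1) by (simp add: field_simps)
    then have "1 = of_int k * real n" using pi_neq_zero by (simp only: mult_cancel_left) auto
    then have "1 = k * int n" by (metis of_int_eq_1_iff of_int_mult of_int_of_nat_eq)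
    then show False using n1 by (metis dvd_triv_right int_dvd_int_iff less_irrefl nat_dvd_1_iff_1 of_nat_1)
  qed
  have wm: "\<omega> ^ m = \<omega> ^ (m mod n)" for m
  proof -
    have "\<omega> ^ m = \<omega> ^ (n * (m div n) + m mod n)" by simp
    also have "\<dots> = \<omega> ^ (m mod n)" unfolding power_add power_mult w(1) by simp
    finally show ?thesis .
  qed
  define H where "H = range (\<lambda>m::nat. g [^] m)"
  define \<psi> where "\<psi> h = \<omega> ^ (SOME m::nat. g [^] m = h)" for h
  have \<psi>: "\<psi> (g [^] m) = \<omega> ^ m" for m :: nat
  proof -
    have "g [^] (SOME m'::nat. g [^] m' = g [^] m) = g [^] m" by (rule someI) simp
    then show ?thesis unfolding \<psi>_def using inj wm by metis
  qed
  have "subgroup H G"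
  proof (rule subgroupI)
    show "H \<subseteq> carrier G" "H \<noteq> {}" using g by (auto simp: H_def)
    show "a \<otimes> b \<in> H" if "a \<in> H" "b \<in> H" for a b
      using that g by (auto simp: H_def nat_pow_mult)
    show "inv a \<in> H" if "a \<in> H" for a
    proof -
      obtain m where a: "a = g [^] (m::nat)" using \<open>a \<in> H\<close> unfolding H_def by blast
      have "m + (n * m - m) = n * m" using n(1) by (cases n) auto
      then have "g [^] m \<otimes> g [^] (n * m - m) = (g [^] n) [^] m"
        using g by (simp add: nat_pow_mult nat_pow_pow)
      then have "g [^] (n * m - m) \<otimes> g [^] m = \<one>" using n g by (simp add: m_comm)
      then have "inv (g [^] m) = g [^] (n * m - m)" using g by (intro inv_equality) auto
      then show ?thesis unfolding a H_def by simp
    qed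
  qed
  moreover have "\<psi> h \<noteq> 0" if "h \<in> H" for h using w(2) by (simp add: \<psi>_def)
  moreover have "\<psi> (h \<otimes> k) = \<psi> h * \<psi> k" if "h \<in> H" "k \<in> H" for h k
  proof -
    obtain i j where "h = g [^] (i::nat)" "k = g [^] (j::nat)" using \<open>h \<in> H\<close> \<open>k \<in> H\<close> by (auto simp: H_def)
    then show ?thesis using g by (simp add: nat_pow_mult \<psi> power_add)
  qed
  ultimately obtain \<phi> where \<phi>: "\<phi> \<in> characters G" "\<forall>h\<in>H. \<phi> h = \<psi> h"
    using character_extend[OF fin] by metis
  have "g [^] (1::nat) \<in> H" unfolding H_def by blast
  then have "\<phi> g = \<omega>" using \<phi>(2) \<psi>[of 1] g by simp
  then show ?thesis using \<phi> w1 by metis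
qed

lemma (in comm_group) character_times:
  "\<psi> \<in> characters G \<Longrightarrow> \<phi> \<in> characters G \<Longrightarrow> (\<lambda>g. \<psi> g * \<phi> g) \<in> characters G"
  by (auto simp: characters_def)

lemma (in comm_group) character_cnj:
  "\<psi> \<in> characters G \<Longrightarrow> (\<lambda>g. cnj (\<psi> g)) \<in> characters G"
  by (auto simp: characters_def)

lemma (in comm_group) sum_character:
  assumes fin: "finite (carrier G)" and \<psi>: "\<psi> \<in> characters G"
  shows "(\<Sum>g\<in>carrier G. \<psi> g) = (if \<psi> = trivial_character G then of_nat (card (carrier G)) else 0)"
proof (cases "\<psi> = trivial_character G")
  case True
  then show ?thesis by (simp add: trivial_character_def)
next
  case False
  then obtain h where h: "h \<in> carrier G" "\<psi> h \<noteq> 1"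
  proof -
    have "\<exists>h\<in>carrier G. \<psi> h \<noteq> 1"
    proof (rule ccontr)
      assume "\<not> ?thesis"
      then have "\<psi> = trivial_character G" using \<psi>
        unfolding trivial_character_def characters_def by (intro ext) auto
      then show False using False by blast
    qed
    then show ?thesis using that by blast
  qed
  have "\<psi> h * (\<Sum>g\<in>carrier G. \<psi> g) = (\<Sum>g\<in>carrier G. \<psi> (h \<otimes> g))"
    using h by (simp add: sum_distrib_left character_mult[OF \<psi>])
  also have "\<dots> = (\<Sum>g\<in>carrier G. \<psi> g)"
    by (rule sum.reindex_bij_witness[of _ "\<lambda>g. inv h \<otimes> g" "\<lambda>g. h \<otimes> g"]) (use h in \<open>auto simp: m_assoc[symmetric]\<close>)
  finally have "(\<psi> h - 1) * (\<Sum>g\<in>carrier G. \<psi> g) = 0" by (simp add: algebra_simps)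
  then show ?thesis using h False by simp
qed

text \<open>Multiplication by a character that separates \<open>g\<close> from the identity permutes
  the characters but scales the sum by a number other than 1.\<close>

lemma (in comm_group) sum_over_characters_aux:
  assumes fin: "finite (carrier G)" and g: "g \<in> carrier G" "g \<noteq> \<one>"
  shows "(\<Sum>\<psi>\<in>characters G. \<psi> g) = 0"
proof -
  obtain \<phi> where \<phi>: "\<phi> \<in> characters G" "\<phi> g \<noteq> 1" using characters_separate[OF fin g] by blast
  have \<phi>c: "\<phi> h * cnj (\<phi> h) = 1" if "h \<in> carrier G" for h
    using character_norm[OF fin \<phi>(1) that] by (simp add: complex_norm_square[symmetric])
  have c1: "(\<lambda>h. \<phi> h * (cnj (\<phi> h) * \<psi> h)) = \<psi>" "(\<lambda>h. cnj (\<phi> h) * (\<phi> h * \<psi> h)) = \<psi>" if "\<psi> \<in> characters G" for \<psi>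
  proof -
    have "\<phi> h * (cnj (\<phi> h) * \<psi> h) = \<psi> h \<and> cnj (\<phi> h) * (\<phi> h * \<psi> h) = \<psi> h" for h
    proof (cases "h \<in> carrier G")
      case True then show ?thesis using \<phi>c[OF True] by (metis mult.assoc mult.commute mult_1)
    next
      case False then show ?thesis using that by (simp add: characters_def)
    qed
    then show "(\<lambda>h. \<phi> h * (cnj (\<phi> h) * \<psi> h)) = \<psi>" "(\<lambda>h. cnj (\<phi> h) * (\<phi> h * \<psi> h)) = \<psi>" by auto
  qed
  have "\<phi> g * (\<Sum>\<psi>\<in>characters G. \<psi> g) = (\<Sum>\<psi>\<in>characters G. \<phi> g * \<psi> g)"
    by (simp add: sum_distrib_left)
  also have "\<dots> = (\<Sum>\<psi>\<in>characters G. \<psi> g)"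
    by (rule sum.reindex_bij_witness[of _ "\<lambda>\<psi> h. cnj (\<phi> h) * \<psi> h" "\<lambda>\<psi> h. \<phi> h * \<psi> h"])
      (use c1 \<phi>(1) in \<open>auto intro!: character_times character_cnj\<close>)
  finally have "(\<phi> g - 1) * (\<Sum>\<psi>\<in>characters G. \<psi> g) = 0" by (simp add: algebra_simps)
  then show ?thesis using \<phi> by simp
qed

text \<open>Sum the values \<psi> g over all pairs in both orders: in one order only the trivial
  character contributes, in the other only the identity.\<close>

lemma (in comm_group) card_characters:
  assumes fin: "finite (carrier G)"
  shows "card (characters G) = card (carrier G)"
proof -
  have "(\<Sum>\<psi>\<in>characters G. \<Sum>g\<in>carrier G. \<psi> g) = of_nat (card (carrier G))"
    using finite_characters[OF fin] trivial_character_in by (simp add: sum_character[OF fin] sum.delta')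
  moreover have "(\<Sum>g\<in>carrier G. \<Sum>\<psi>\<in>characters G. \<psi> g) = (\<Sum>g\<in>carrier G. if g = \<one> then of_nat (card (characters G)) else 0)"
  proof (rule sum.cong[OF refl])
    fix g assume g: "g \<in> carrier G"
    show "(\<Sum>\<psi>\<in>characters G. \<psi> g) = (if g = \<one> then of_nat (card (characters G)) else 0)"
      using sum_over_characters_aux[OF fin g] by (simp add: character_one)
  qed
  ultimately have "(of_nat (card (carrier G)) :: complex) = of_nat (card (characters G))"
    using fin by (subst (asm) sum.swap) (simp add: sum.delta')
  then show ?thesis by (simp only: of_nat_eq_iff)
qed

lemma (in comm_group) sum_over_characters:
  assumes fin: "finite (carrier G)" and g: "g \<in> carrier G"
  shows "(\<Sum>\<psi>\<in>characters G. \<psi> g) = (if g = \<one> then of_nat (card (carrier G)) else 0)"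
  using sum_over_characters_aux[OF fin g] card_characters[OF fin] by (auto simp: character_one)

section \<open>The matrix-tree theorem\<close>

definition adj :: "('v, 'e) multigraph \<Rightarrow> ('v \<times> 'v) set" where
  "adj X = {(initial X a, terminal X a) | a. a \<in> oedges X}"

lemma adjI: "a \<in> oedges X \<Longrightarrow> (initial X a, terminal X a) \<in> adj X"
  unfolding adj_def by blast

lemma orev_orev [simp]: "orev (orev a) = a"
  by (simp add: orev_def)

lemma orev_neq [simp]: "orev a \<noteq> a" "a \<noteq> orev a"
  by (auto simp: orev_def prod_eq_iff)

lemma fst_orev [simp]: "fst (orev a) = fst a"
  by (simp add: orev_def)

lemma initial_orev [simp]: "initial X (orev a) = terminal X a"
  by (simp add: terminal_def)

lemma terminal_orev [simp]: "terminal X (orev a) = initial X a"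
  by (simp add: terminal_def)

lemma orev_in_oedges [simp]: "orev a \<in> oedges X \<longleftrightarrow> a \<in> oedges X"
  by (cases a) (auto simp: oedges_def orev_def)

lemma same_edge_cases: "fst a = fst b \<Longrightarrow> a = b \<or> a = orev b"
  by (cases a; cases b) (auto simp: orev_def)

lemma initial_in: "finite_multigraph X \<Longrightarrow> a \<in> oedges X \<Longrightarrow> initial X a \<in> verts X"
  by (cases a; cases "ends X (fst a)") (auto simp: finite_multigraph_def oedges_def initial_def)

lemma terminal_in: "finite_multigraph X \<Longrightarrow> a \<in> oedges X \<Longrightarrow> terminal X a \<in> verts X"
  unfolding terminal_def by (rule initial_in) auto

lemma finite_oedges: "finite_multigraph X \<Longrightarrow> finite (oedges X)"
  by (simp add: finite_multigraph_def oedges_def)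

lemma edges_update [simp]:
  "initial (X\<lparr>edges := S\<rparr>) = initial X" "terminal (X\<lparr>edges := S\<rparr>) = terminal X"
  "verts (X\<lparr>edges := S\<rparr>) = verts X" "edges (X\<lparr>edges := S\<rparr>) = S"
  by (auto simp: initial_def terminal_def fun_eq_iff)

lemma is_path_Nil [simp]: "is_path X []"
  by (simp add: is_path_def)

lemma is_path_Cons:
  "is_path X (a # p) \<longleftrightarrow> a \<in> oedges X \<and> is_path X p \<and> (p \<noteq> [] \<longrightarrow> terminal X a = initial X (hd p))"
proof -
  have "(\<forall>i. Suc i < length (a # p) \<longrightarrow> terminal X ((a # p) ! i) = initial X ((a # p) ! Suc i)) \<longleftrightarrow>
    (p \<noteq> [] \<longrightarrow> terminal X a = initial X (hd p)) \<and>
    (\<forall>i. Suc i < length p \<longrightarrow> terminal X (p ! i) = initial X (p ! Suc i))" (is "?l \<longleftrightarrow> ?r")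
  proof
    assume l: ?l
    show ?r
    proof (intro conjI impI allI)
      assume "p \<noteq> []" then show "terminal X a = initial X (hd p)"
        using l[rule_format, of 0] by (simp add: hd_conv_nth)
    next
      fix i assume "Suc i < length p" then show "terminal X (p ! i) = initial X (p ! Suc i)"
        using l[rule_format, of "Suc i"] by simp
    qed
  next
    assume r: ?r
    show ?l
    proof (intro allI impI)
      fix i assume "Suc i < length (a # p)"
      then show "terminal X ((a # p) ! i) = initial X ((a # p) ! Suc i)"
        using r by (cases i) (auto simp: hd_conv_nth)
    qed
  qed
  then show ?thesis unfolding is_path_def by auto
qed

lemma is_path_append:
  "is_path X (p @ q) \<longleftrightarrow> is_path X p \<and> is_path X q \<and> (p \<noteq> [] \<longrightarrow> q \<noteq> [] \<longrightarrow> terminal X (last p) = initial X (hd q))"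
  by (induction p) (auto simp: is_path_Cons)

lemma path_imp_rtrancl:
  "is_path X p \<Longrightarrow> p \<noteq> [] \<Longrightarrow> (initial X (hd p), terminal X (last p)) \<in> (adj X)\<^sup>*"
proof (induction p)
  case (Cons a p)
  have e: "(initial X a, terminal X a) \<in> adj X" using Cons.prems unfolding adj_def is_path_Cons by blast
  show ?case
  proof (cases "p = []")
    case True
    then show ?thesis using e by simp
  next
    case False
    then show ?thesis
      using e Cons by (simp add: is_path_Cons converse_rtrancl_into_rtrancl)
  qed
qed simp

lemma rtrancl_imp_path:
  assumes "(v, w) \<in> (adj X)\<^sup>*" "v \<noteq> w"
  shows "\<exists>p. p \<noteq> [] \<and> is_path X p \<and> initial X (hd p) = v \<and> terminal X (last p) = w"
  using assms
proof (induction rule: converse_rtrancl_induct)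
  case (step v u)
  then obtain a where a: "a \<in> oedges X" "v = initial X a" "u = terminal X a" by (auto simp: adj_def)
  show ?case
  proof (cases "u = w")
    case True
    then show ?thesis using a by (intro exI[of _ "[a]"]) (simp add: is_path_Cons)
  next
    case False
    then obtain p where "p \<noteq> []" "is_path X p" "initial X (hd p) = u" "terminal X (last p) = w" using step by blast
    then show ?thesis using a by (intro exI[of _ "a # p"]) (simp add: is_path_Cons)
  qed
qed simp

lemma connected_iff:
  "connected_multigraph X \<longleftrightarrow> verts X \<noteq> {} \<and> (\<forall>v\<in>verts X. \<forall>w\<in>verts X. (v, w) \<in> (adj X)\<^sup>*)"
  unfolding connected_multigraph_def
  using path_imp_rtrancl[of X] rtrancl_imp_path[of _ _ X] rtrancl.rtrancl_refl[of _ "adj X"] by metis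

lemma sym_adj: "sym (adj X)"
proof (rule symI)
  fix v w assume "(v, w) \<in> adj X"
  then obtain a where "a \<in> oedges X" "v = initial X a" "w = terminal X a" by (auto simp: adj_def)
  then show "(w, v) \<in> adj X" unfolding adj_def by (intro CollectI exI[of _ "orev a"]) simp
qed

section \<open>Principal minors of the Laplacian\<close>

definition out :: "('v, 'e) multigraph \<Rightarrow> 'v \<Rightarrow> 'e oedge set" where
  "out X v = {a \<in> oedges X. initial X a = v}"

text \<open>The height \<open>h\<close> forces a walk along the chosen edges to leave \<open>T\<close>. For \<open>T\<close> the complement of
  a vertex \<open>r\<close>, exiting choices of outgoing edges are the spanning trees oriented towards \<open>r\<close>.\<close>

definition exiting :: "('v, 'e) multigraph \<Rightarrow> 'v set \<Rightarrow> ('v \<Rightarrow> 'e oedge) \<Rightarrow> bool" where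
  "exiting X T f \<longleftrightarrow> (\<exists>h::'v \<Rightarrow> nat. \<forall>v\<in>T. terminal X (f v) \<in> T \<longrightarrow> h (terminal X (f v)) < h v)"

text \<open>This is the degree matrix minus the adjacency matrix; both orientations of a loop
  contribute 0. The sum over outgoing edges lets a determinant be expanded over choices of one
  outgoing edge per row.\<close>

definition laplacian :: "('v, 'e) multigraph \<Rightarrow> 'v \<Rightarrow> 'v \<Rightarrow> complex" where
  "laplacian X v w = (\<Sum>a\<in>out X v. (if v = w then 1 else 0) - (if terminal X a = w then 1 else 0))"

lemma fdet_exiting:
  assumes T: "finite T" and f: "exiting X T f"
  shows "fdet T (\<lambda>v w. (if v = w then 1 else 0) - (if terminal X (f v) = w then 1 else 0) :: complex) = 1"
proof -
  obtain h :: "_ \<Rightarrow> nat" where h: "\<And>v. v \<in> T \<Longrightarrow> terminal X (f v) \<in> T \<Longrightarrow> h (terminal X (f v)) < h v"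
    using f by (auto simp: exiting_def)
  let ?m = "\<lambda>v w. (if v = w then 1 else 0) - (if terminal X (f v) = w then 1 else 0) :: complex"
  have nfix: "terminal X (f v) \<noteq> v" if "v \<in> T" for v using h[OF that] that by (metis less_irrefl)
  have "fdet T ?m = (\<Sum>p\<in>{id}. of_int (sign p) * (\<Prod>i\<in>T. ?m i (p i)))"
    unfolding fdet_def
  proof (rule sum.mono_neutral_right)
    show "finite {p. p permutes T}" by (rule finite_permutations[OF T])
    show "{id} \<subseteq> {p. p permutes T}" by (simp add: permutes_id)
    show "\<forall>p\<in>{p. p permutes T} - {id}. of_int (sign p) * (\<Prod>i\<in>T. ?m i (p i)) = 0"
    proof
      fix p assume "p \<in> {p. p permutes T} - {id}"
      then have p: "p permutes T" "p \<noteq> id" by auto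
      have "(\<Prod>i\<in>T. ?m i (p i)) = 0"
      proof (rule ccontr)
        assume "(\<Prod>i\<in>T. ?m i (p i)) \<noteq> 0"
        then have nz: "?m i (p i) \<noteq> 0" if "i \<in> T" for i using that T by (meson prod_zero)
        have le: "h (p i) \<le> h i" if "i \<in> T" for i
        proof (cases "p i = i")
          case False
          then have "terminal X (f i) = p i" using nz[OF that] by (auto split: if_splits)
          then show ?thesis using h[OF that] permutes_in_image[OF p(1), of i] that by simp
        qed simp
        obtain i where i: "p i \<noteq> i" using p(2) by (auto simp: fun_eq_iff)
        then have iT: "i \<in> T" using permutes_not_in[OF p(1)] by blast
        have "terminal X (f i) = p i" using nz[OF iT] i by (auto split: if_splits)
        then have "h (p i) < h i" using h[OF iT] permutes_in_image[OF p(1), of i] iT by simp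
        then have "(\<Sum>i\<in>T. h (p i)) < (\<Sum>i\<in>T. h i)" using le iT T by (intro sum_strict_mono_ex1) auto
        moreover have "(\<Sum>i\<in>T. h (p i)) = (\<Sum>i\<in>T. h i)" using sum.permute[OF p(1), of h] by (simp add: o_def)
        ultimately show False by simp
      qed
      then show "of_int (sign p) * (\<Prod>i\<in>T. ?m i (p i)) = 0" by simp
    qed
  qed
  also have "\<dots> = 1" using nfix by simp
  finally show ?thesis .
qed

text \<open>Let \<open>U\<close> be the set of vertices whose walk never leaves \<open>T\<close>. It
  is nonempty, because otherwise the exit time would serve as a height, and its indicator function
  lies in the kernel.\<close>

lemma fdet_not_exiting:
  assumes T: "finite T" and f: "\<not> exiting X T f"
  shows "fdet T (\<lambda>v w. (if v = w then 1 else 0) - (if terminal X (f v) = w then 1 else 0) :: complex) = 0"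
proof -
  define step where "step v = (if v \<in> T then terminal X (f v) else v)" for v
  define U where "U = {v \<in> T. \<forall>n. (step ^^ n) v \<in> T}"
  have U: "v \<in> U \<longleftrightarrow> terminal X (f v) \<in> U" if "v \<in> T" for v
  proof -
    have s: "step v = terminal X (f v)" using that by (simp add: step_def)
    have "(\<forall>n. (step ^^ n) v \<in> T) \<longleftrightarrow> (\<forall>n. (step ^^ n) (step v) \<in> T)"
    proof
      assume "\<forall>n. (step ^^ n) v \<in> T"
      then have "(step ^^ Suc n) v \<in> T" for n by blast
      then show "\<forall>n. (step ^^ n) (step v) \<in> T" by (simp add: funpow_swap1)
    next
      assume a: "\<forall>n. (step ^^ n) (step v) \<in> T"
      show "\<forall>n. (step ^^ n) v \<in> T"
      proof
        fix n show "(step ^^ n) v \<in> T"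
          using a that by (cases n) (auto simp: funpow_swap1)
      qed
    qed
    moreover have "(\<forall>n. (step ^^ n) (step v) \<in> T) \<Longrightarrow> step v \<in> T" by (metis funpow_0)
    ultimately show ?thesis using that unfolding U_def s by blast
  qed
  have "U \<noteq> {}"
  proof
    assume "U = {}"
    then have ex: "\<exists>n. (step ^^ n) v \<notin> T" if "v \<in> T" for v using that by (auto simp: U_def)
    define h where "h v = (LEAST n. (step ^^ n) v \<notin> T)" for v
    have "h (terminal X (f v)) < h v" if v: "v \<in> T" "terminal X (f v) \<in> T" for v
    proof -
      have l: "(step ^^ h v) v \<notin> T" unfolding h_def using ex[OF v(1)] by (rule LeastI_ex)
      then obtain k where k: "h v = Suc k" using v(1) by (cases "h v") auto
      have "(step ^^ k) (step v) \<notin> T" using l k by (simp add: funpow_swap1)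
      then have "h (step v) \<le> k" unfolding h_def by (rule Least_le)
      then show ?thesis using k v by (simp add: step_def)
    qed
    then show False using f unfolding exiting_def by blast
  qed
  then obtain s where s: "s \<in> U" by blast
  let ?x = "\<lambda>v. if v \<in> U then 1 else 0 :: complex"
  show ?thesis
  proof (rule fdet_kernel[OF T, of s ?x])
    show "s \<in> T" "?x s \<noteq> 0" using s by (auto simp: U_def)
    fix v assume v: "v \<in> T"
    have "(\<Sum>w\<in>T. ((if v = w then 1 else 0) - (if terminal X (f v) = w then 1 else 0)) * ?x w) =
       (\<Sum>w\<in>T. (if v = w then ?x w else 0)) - (\<Sum>w\<in>T. (if terminal X (f v) = w then ?x w else 0))"
      unfolding left_diff_distrib sum_subtractf
      by (intro arg_cong2[of _ _ _ _ "(-)"] sum.cong) simp_all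
    also have "\<dots> = ?x v - (if terminal X (f v) \<in> T then ?x (terminal X (f v)) else 0)"
      using v T by simp
    also have "\<dots> = 0" using U[OF v] by (auto simp: U_def)
    finally show "(\<Sum>w\<in>T. ((if v = w then 1 else 0) - (if terminal X (f v) = w then 1 else 0)) * ?x w) = 0" .
  qed
qed

text \<open>By multilinearity in the rows the determinant is a sum over choices of one outgoing edge
  per row, and each choice contributes 1 or 0 according to whether it is exiting.\<close>

lemma fdet_laplacian:
  assumes X: "finite_multigraph X" and T: "finite T"
  shows "fdet T (laplacian X) = of_nat (card {f \<in> PiE T (out X). exiting X T f})"
proof -
  let ?m = "\<lambda>a v w. (if v = w then 1 else 0) - (if terminal X a = w then 1 else 0) :: complex"
  have fo: "finite (out X v)" for v using finite_oedges[OF X] by (simp add: out_def)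
  have fin: "finite (PiE T (out X))" using T fo by (intro finite_PiE) auto
  have "fdet T (laplacian X) = (\<Sum>p | p permutes T. \<Sum>f\<in>PiE T (out X). of_int (sign p) * (\<Prod>v\<in>T. ?m (f v) v (p v)))"
    unfolding fdet_def laplacian_def using T fo by (simp add: prod_sum_PiE sum_distrib_left)
  also have "\<dots> = (\<Sum>f\<in>PiE T (out X). \<Sum>p | p permutes T. of_int (sign p) * (\<Prod>v\<in>T. ?m (f v) v (p v)))"
    by (rule sum.swap)
  also have "\<dots> = (\<Sum>f\<in>PiE T (out X). fdet T (\<lambda>v w. ?m (f v) v w))" by (simp add: fdet_def)
  also have "\<dots> = (\<Sum>f\<in>PiE T (out X). if exiting X T f then 1 else 0)"
    by (rule sum.cong) (auto simp: fdet_exiting[OF T] fdet_not_exiting[OF T])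
  also have "\<dots> = of_nat (card {f \<in> PiE T (out X). exiting X T f})"
    using fin by (simp add: sum.If_cases Int_def)
  finally show ?thesis .
qed

text \<open>A walk cannot leave the full vertex set: a vertex of minimal height would have a lower
  successor. Hence no choice of outgoing edges is exiting.\<close>

lemma fdet_laplacian_verts:
  assumes X: "finite_multigraph X" and ne: "verts X \<noteq> {}"
  shows "fdet (verts X) (laplacian X) = 0"
proof -
  have fin: "finite (verts X)" using X by (simp add: finite_multigraph_def)
  have "\<not> exiting X (verts X) f" if f: "f \<in> PiE (verts X) (out X)" for f
  proof
    assume "exiting X (verts X) f"
    then obtain h :: "_ \<Rightarrow> nat" where h: "\<And>v. v \<in> verts X \<Longrightarrow> terminal X (f v) \<in> verts X \<Longrightarrow> h (terminal X (f v)) < h v"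
      by (auto simp: exiting_def)
    obtain v where v: "v \<in> verts X" "\<And>w. w \<in> verts X \<Longrightarrow> h v \<le> h w"
      using ex_min_if_finite[of "h ` verts X"] fin ne by (metis (no_types, lifting) arg_min_if_finite(1) arg_min_least)
    have "f v \<in> oedges X" using f v(1) by (auto simp: out_def PiE_def Pi_def)
    then have "terminal X (f v) \<in> verts X" by (rule terminal_in[OF X])
    then show False using h[OF v(1)] v(2) by fastforce
  qed
  then have "{f \<in> PiE (verts X) (out X). exiting X (verts X) f} = {}" by blast
  then show ?thesis unfolding fdet_laplacian[OF X fin] by (simp only: card.empty of_nat_0)
qed

section \<open>Exiting choices as spanning trees\<close>

lemma last_take_nth: "0 < i \<Longrightarrow> i \<le> length q \<Longrightarrow> last (take i q) = q ! (i - 1)"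
  by (subst last_conv_nth) (auto simp: min_absorb2)

lemma PiE_out:
  assumes "f \<in> PiE T (out X)" "v \<in> T"
  shows "f v \<in> oedges X" "initial X (f v) = v"
  using PiE_mem[OF assms] by (simp_all add: out_def)

text \<open>Giving the root height 0 and raising all others by one makes the decrease hold also on
  edges that enter the root.\<close>

lemma exiting_height:
  assumes X: "finite_multigraph X" and r: "r \<in> verts X"
    and f: "f \<in> PiE (verts X - {r}) (out X)" "exiting X (verts X - {r}) f"
  shows "\<exists>h::_ \<Rightarrow> nat. \<forall>v\<in>verts X - {r}. h (terminal X (f v)) < h v"
proof -
  obtain h :: "_ \<Rightarrow> nat"
    where h: "\<forall>v\<in>verts X - {r}. terminal X (f v) \<in> verts X - {r} \<longrightarrow> h (terminal X (f v)) < h v"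
    using f(2) unfolding exiting_def by (elim exE) (rule that)
  let ?h = "\<lambda>v. if v = r then 0 else Suc (h v)"
  have "?h (terminal X (f v)) < ?h v" if v: "v \<in> verts X - {r}" for v
  proof (cases "terminal X (f v) = r")
    case True
    then show ?thesis using v by simp
  next
    case False
    then have "terminal X (f v) \<in> verts X - {r}"
      using terminal_in[OF X PiE_out(1)[OF f(1) v]] by blast
    then have "h (terminal X (f v)) < h v" using h v by blast
    then show ?thesis using False v by simp
  qed
  then show ?thesis by (intro exI[of _ ?h] ballI)
qed

text \<open>Heights decrease along chosen edges, so every vertex reaches \<open>r\<close>. A cycle
  would have to enter and leave a vertex of maximal height along the edge chosen there, and thus use
  one edge in both directions.\<close>

lemma exiting_tree:
  assumes X: "finite_multigraph X" and r: "r \<in> verts X"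
    and f: "f \<in> PiE (verts X - {r}) (out X)" "exiting X (verts X - {r}) f"
  defines "S \<equiv> (\<lambda>v. fst (f v)) ` (verts X - {r})"
  shows "S \<subseteq> edges X" and "is_tree (X\<lparr>edges := S\<rparr>)"
proof -
  let ?T = "verts X - {r}" and ?X = "X\<lparr>edges := S\<rparr>"
  obtain h :: "_ \<Rightarrow> nat" where h0: "\<forall>v\<in>?T. h (terminal X (f v)) < h v"
    using exiting_height[OF X r f] by (rule exE)
  note h = bspec[OF h0]
  have fo: "f v \<in> oedges X" "initial X (f v) = v" if "v \<in> ?T" for v
    using PiE_out[OF f(1) that] by auto
  show S: "S \<subseteq> edges X" using fo by (fastforce simp: S_def oedges_def)
  have fS: "f v \<in> oedges ?X" if "v \<in> ?T" for v
    using that by (cases "f v") (force simp: oedges_def S_def)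
  have root: "(v, r) \<in> (adj ?X)\<^sup>*" if "v \<in> verts X" for v
    using that
  proof (induction "h v" arbitrary: v rule: less_induct)
    case less
    show ?case
    proof (cases "v = r")
      case False
      then have v: "v \<in> ?T" using less.prems by blast
      have "(v, terminal X (f v)) \<in> adj ?X" using adjI[OF fS[OF v]] fo(2)[OF v] by simp
      moreover have "(terminal X (f v), r) \<in> (adj ?X)\<^sup>*"
        using less.hyps[OF h[OF v]] terminal_in[OF X fo(1)[OF v]] by blast
      ultimately show ?thesis by (rule converse_rtrancl_into_rtrancl)
    qed simp
  qed
  have "sym ((adj ?X)\<^sup>*)" using sym_adj by (rule sym_rtrancl)
  then have "connected_multigraph ?X"
    unfolding connected_iff using root r by (auto intro: rtrancl_trans dest: symD)
  moreover have "\<not> is_cycle ?X p" for p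
  proof
    assume c: "is_cycle ?X p"
    let ?n = "length p" and ?i = "\<lambda>j. initial X (p ! j)"
    have p: "p \<noteq> []" "set p \<subseteq> oedges ?X" "\<And>i. Suc i < ?n \<Longrightarrow> terminal X (p ! i) = ?i (Suc i)"
      "?i 0 = terminal X (p ! (?n - 1))" "distinct (map fst p)"
      using c by (auto simp: is_cycle_def closed_path_def is_path_def hd_conv_nth last_conv_nth)
    have n0: "?n > 0" using p(1) by simp
    have nxt: "terminal X (p ! i) = ?i (Suc i mod ?n)" if "i < ?n" for i
    proof (cases "Suc i < ?n")
      case False
      then have "Suc i = ?n" "i = ?n - 1" using that by auto
      then show ?thesis using p(4) by (metis mod_self)
    qed (use p(3) in simp)
    obtain i where i: "i < ?n" "\<And>j. j < ?n \<Longrightarrow> h (?i j) \<le> h (?i i)"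
    proof -
      let ?A = "(\<lambda>j. h (?i j)) ` {..<?n}"
      have "Max ?A \<in> ?A" using n0 by (intro Max_in) auto
      then obtain i where "i < ?n" "Max ?A = h (?i i)" by auto
      then show ?thesis using that[of i] Max_ge[of ?A] by auto
    qed
    have edge: "\<exists>w\<in>?T. p ! j = f w \<or> p ! j = orev (f w)" if "j < ?n" for j
    proof -
      have "fst (p ! j) \<in> S" using p(2) that by (fastforce simp: oedges_def dest: nth_mem)
      then obtain w where "w \<in> ?T" "fst (p ! j) = fst (f w)" by (auto simp: S_def)
      then show ?thesis using same_edge_cases[of "p ! j" "f w"] by blast
    qed
    \<comment> \<open>The cyclic predecessor of \<open>i\<close>; adding \<open>?n\<close> first
      avoids truncated subtraction at \<open>i = 0\<close>.\<close>
    define k where "k = (i + ?n - 1) mod ?n"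
    have k: "k < ?n" "Suc k mod ?n = i" using i(1) n0 by (auto simp: k_def mod_Suc_eq)
    obtain w where w: "w \<in> ?T" "p ! i = f w \<or> p ! i = orev (f w)" using edge[OF i(1)] by blast
    have "p ! i \<noteq> orev (f w)"
    proof
      assume a: "p ! i = orev (f w)"
      have "?i (Suc i mod ?n) = w" using nxt[OF i(1)] a fo(2)[OF w(1)] by simp
      moreover have "?i i = terminal X (f w)" using a by simp
      ultimately show False using h[OF w(1)] i(2)[of "Suc i mod ?n"] n0 by simp
    qed
    then have pi: "p ! i = f w" using w by blast
    obtain w' where w': "w' \<in> ?T" "p ! k = f w' \<or> p ! k = orev (f w')" using edge[OF k(1)] by blast
    have tk: "terminal X (p ! k) = w" using nxt[OF k(1)] k(2) pi fo(2)[OF w(1)] by simp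
    have "p ! k \<noteq> f w'"
    proof
      assume a: "p ! k = f w'"
      then have "?i k = w'" "terminal X (f w') = w" using fo(2)[OF w'(1)] tk by auto
      then show False using h[OF w'(1)] i(2)[OF k(1)] pi fo(2)[OF w(1)] by simp
    qed
    then have pk: "p ! k = orev (f w')" using w' by blast
    then have "w' = w" using tk fo(2)[OF w'(1)] by simp
    then have "fst (p ! k) = fst (p ! i)" using pk pi by simp
    then have "k = i" using p(5) k(1) i(1) by (metis distinct_conv_nth length_map nth_map)
    then show False using pk pi \<open>w' = w\<close> by simp
  qed
  ultimately show "is_tree ?X" unfolding is_tree_def by blast
qed

text \<open>At each vertex choose an edge that shortens the distance to \<open>r\<close> inside
  \<open>S\<close>; this distance is the height.\<close>

lemma exiting_exists:
  assumes X: "finite_multigraph X" and r: "r \<in> verts X" and S: "S \<subseteq> edges X"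
    and conn: "connected_multigraph (X\<lparr>edges := S\<rparr>)"
  shows "\<exists>f\<in>PiE (verts X - {r}) (out X). exiting X (verts X - {r}) f \<and> (\<lambda>v. fst (f v)) ` (verts X - {r}) \<subseteq> S"
proof -
  let ?T = "verts X - {r}" and ?X = "X\<lparr>edges := S\<rparr>"
  have reach: "\<exists>n. (v, r) \<in> adj ?X ^^ n" if "v \<in> verts X" for v
  proof -
    have "(v, r) \<in> (adj ?X)\<^sup>*" using conn that r unfolding connected_iff by simp
    then show ?thesis by (rule rtrancl_imp_relpow)
  qed
  define h where "h v = (LEAST n. (v, r) \<in> adj ?X ^^ n)" for v
  have ex: "\<exists>a. a \<in> oedges ?X \<and> initial X a = v \<and> h (terminal X a) < h v" if v: "v \<in> ?T" for v
  proof -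
    have "\<exists>n. (v, r) \<in> adj ?X ^^ n" using reach v by blast
    then have l: "(v, r) \<in> adj ?X ^^ h v" unfolding h_def by (rule LeastI_ex)
    then obtain k where k: "h v = Suc k" using v by (cases "h v") auto
    then have "(v, r) \<in> adj ?X ^^ Suc k" using l by simp
    then obtain u where u: "(v, u) \<in> adj ?X" "(u, r) \<in> adj ?X ^^ k" by (blast dest: relpow_Suc_D2)
    then have "h u \<le> k" unfolding h_def by (intro Least_le)
    moreover obtain a where "a \<in> oedges ?X" "v = initial X a" "u = terminal X a"
      using u(1) unfolding adj_def edges_update by blast
    ultimately show ?thesis using k by (intro exI[of _ a]) simp
  qed
  then have "\<forall>v\<in>?T. \<exists>a. a \<in> oedges ?X \<and> initial X a = v \<and> h (terminal X a) < h v" by blast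
  then obtain f0 where f0: "\<forall>v\<in>?T. f0 v \<in> oedges ?X \<and> initial X (f0 v) = v \<and> h (terminal X (f0 v)) < h v"
    by (rule bchoice[THEN exE])
  define f where "f = restrict f0 ?T"
  have f: "f v \<in> oedges ?X" "initial X (f v) = v" "h (terminal X (f v)) < h v" if "v \<in> ?T" for v
    using bspec[OF f0 that] that by (simp_all add: f_def)
  have o: "a \<in> oedges X" "fst a \<in> S" if "a \<in> oedges ?X" for a
    using that S by (auto simp: oedges_def)
  have "f \<in> PiE ?T (out X)"
  proof (rule PiE_I)
    fix v assume "v \<in> ?T"
    then show "f v \<in> out X v" using f(1,2) o(1) by (simp add: out_def)
  next
    fix v assume "v \<notin> ?T"
    then show "f v = undefined" unfolding f_def by (rule restrict_apply[THEN trans, OF if_not_P])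
  qed
  moreover have "exiting X ?T f" unfolding exiting_def using f(3) by (intro exI[of _ h] ballI impI)
  moreover have "(\<lambda>v. fst (f v)) ` ?T \<subseteq> S" by (rule image_subsetI, rule o(2), rule f(1))
  ultimately show ?thesis by (intro bexI[of _ f] conjI)
qed

text \<open>Stopping at an early visit to \<open>x\<close>, or cutting out the segment between two
  visits to the same vertex, would give a shorter path.\<close>

lemma shortest_path_distinct:
  assumes q: "q \<noteq> []" "is_path X q" "initial X (hd q) = y" "terminal X (last q) = x" and yx: "y \<noteq> x"
    and min: "\<And>q'. q' \<noteq> [] \<Longrightarrow> is_path X q' \<Longrightarrow> initial X (hd q') = y \<Longrightarrow> terminal X (last q') = x \<Longrightarrow> length q \<le> length q'"
  shows "distinct (map (initial X) q)" "x \<notin> initial X ` set q"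
proof -
  have tk: "is_path X (take i q)" "is_path X (drop i q)" for i
    using q(2) is_path_append[of X "take i q" "drop i q"] by auto
  have step: "terminal X (q ! i) = initial X (q ! Suc i)" if "Suc i < length q" for i
    using q(2) that by (auto simp: is_path_def)
  show "x \<notin> initial X ` set q"
  proof
    assume "x \<in> initial X ` set q"
    then obtain i where i: "i < length q" "initial X (q ! i) = x" by (auto simp: in_set_conv_nth)
    have i0: "i \<noteq> 0"
    proof
      assume "i = 0"
      then have "initial X (hd q) = x" using i(2) q(1) by (simp add: hd_conv_nth)
      then show False using q(3) yx by simp
    qed
    have "terminal X (last (take i q)) = x"
      using i i0 step[of "i - 1"] by (simp add: last_take_nth)
    moreover have "take i q \<noteq> []" "initial X (hd (take i q)) = y" using i i0 q by auto
    ultimately have "length q \<le> length (take i q)" using min tk by blast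
    then show False using i by simp
  qed
  have *: False if ij: "i < j" "j < length q" "initial X (q ! i) = initial X (q ! j)" for i j
  proof -
    let ?q = "take i q @ drop j q"
    have l: "terminal X (last (take i q)) = initial X (hd (drop j q))" if "take i q \<noteq> []"
    proof -
      have "i \<noteq> 0" using that by auto
      then show ?thesis using ij step[of "i - 1"] by (simp add: last_take_nth hd_drop_conv_nth)
    qed
    have "is_path X ?q" using tk l by (auto simp: is_path_append)
    moreover have "?q \<noteq> []" using ij by simp
    moreover have "initial X (hd ?q) = y"
    proof (cases "i = 0")
      case True
      then show ?thesis using ij q by (simp add: hd_drop_conv_nth hd_conv_nth)
    next
      case False
      then show ?thesis using ij q by (simp add: hd_append)
    qed
    moreover have "terminal X (last ?q) = x" using ij q by simp
    ultimately have "length q \<le> length ?q" using min by blast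
    then show False using ij by simp
  qed
  show "distinct (map (initial X) q)"
    unfolding distinct_conv_nth using * by (metis length_map linorder_neqE_nat nth_map)
qed

text \<open>As initial vertices are distinct, a repeated edge is traversed in opposite directions,
  and the second traversal must follow the first at once. The path is then back at an earlier
  vertex, which neither a next edge nor the end of the path allows.\<close>

lemma path_distinct_edges:
  assumes q: "is_path X q" "distinct (map (initial X) q)" "q \<noteq> []" "terminal X (last q) \<notin> initial X ` set q"
  shows "distinct (map fst q)"
proof -
  have step: "terminal X (q ! i) = initial X (q ! Suc i)" if "Suc i < length q" for i
    using q(1) that by (auto simp: is_path_def)
  have di: "i = j" if "i < length q" "j < length q" "initial X (q ! i) = initial X (q ! j)" for i j
    using q(2) that by (metis distinct_conv_nth length_map nth_map)
  have *: False if ij: "i < j" "j < length q" "fst (q ! i) = fst (q ! j)" for i j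
  proof -
    have "q ! i = orev (q ! j)" using same_edge_cases[OF ij(3)] di[of i j] ij by auto
    then have e: "initial X (q ! j) = terminal X (q ! i)" "terminal X (q ! j) = initial X (q ! i)" by auto
    then have "initial X (q ! j) = initial X (q ! Suc i)" using step[of i] ij by simp
    then have j: "j = Suc i" using di[of j "Suc i"] ij by simp
    show False
    proof (cases "Suc j < length q")
      case True
      then have "initial X (q ! Suc j) = initial X (q ! i)" using step[of j] e by simp
      then show False using di[of "Suc j" i] True ij by simp
    next
      case False
      then have "j = length q - 1" using ij by simp
      then have "terminal X (last q) = initial X (q ! i)" using e q(3) by (simp add: last_conv_nth)
      then show False using q(4) ij by simp
    qed
  qed
  then show ?thesis unfolding distinct_conv_nth by (metis length_map linorder_neqE_nat nth_map)
qed

text \<open>A shortest path inside \<open>S'\<close> between the ends of \<open>e\<close> closes up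
  with \<open>e\<close> to a cycle; if \<open>e\<close> is a loop, it is a cycle by itself.\<close>

lemma connected_proper_subset_cycle:
  assumes X: "finite_multigraph X" and S: "S \<subseteq> edges X" and S': "S' \<subseteq> S"
    and conn: "connected_multigraph (X\<lparr>edges := S'\<rparr>)" and e: "e \<in> S" "e \<notin> S'"
  shows "\<exists>p. is_cycle (X\<lparr>edges := S\<rparr>) p"
proof -
  let ?X = "X\<lparr>edges := S\<rparr>" and ?X' = "X\<lparr>edges := S'\<rparr>"
  define a where "a = (e, True)"
  have a: "a \<in> oedges ?X" "a \<in> oedges X" using e S by (auto simp: a_def oedges_def)
  define x y where "x = initial X a" and "y = terminal X a"
  have xy: "x \<in> verts X" "y \<in> verts X" using initial_in[OF X a(2)] terminal_in[OF X a(2)] by (simp_all add: x_def y_def)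
  show ?thesis
  proof (cases "y = x")
    case True
    then have "is_cycle ?X [a]"
      using a by (simp add: is_cycle_def closed_path_def is_path_Cons x_def y_def)
    then show ?thesis by blast
  next
    case False
    let ?P = "\<lambda>q. q \<noteq> [] \<and> is_path ?X' q \<and> initial ?X' (hd q) = y \<and> terminal ?X' (last q) = x"
    have "\<exists>q. ?P q" using conn xy False unfolding connected_multigraph_def by auto
    then obtain q where q: "?P q" and min: "\<And>q'. ?P q' \<Longrightarrow> length q \<le> length q'"
      using ex_has_least_nat[of ?P _ length] by blast
    have d: "distinct (map (initial ?X') q)" "x \<notin> initial ?X' ` set q"
      using shortest_path_distinct[of q ?X' y x] q min False by blast+
    have df: "distinct (map fst q)" using path_distinct_edges[of ?X' q] q d by blast
    have sub: "set q \<subseteq> oedges ?X'" using q by (auto simp: is_path_def)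
    then have "set q \<subseteq> oedges ?X" using S' by (auto simp: oedges_def)
    then have pq: "is_path ?X q" using q by (auto simp: is_path_def)
    have "e \<notin> fst ` set q" using sub e by (auto simp: oedges_def)
    then have "is_cycle ?X (a # q)"
      using a q d df pq unfolding is_cycle_def closed_path_def
      by (simp add: is_path_Cons x_def[symmetric] y_def[symmetric]) (simp add: a_def)
    then show ?thesis by blast
  qed
qed

text \<open>For surjectivity, an exiting choice inside a tree already spans, so a further edge of
  the tree would close a cycle. For injectivity, induct on the height for \<open>g\<close>. If
  \<open>f\<close> chose the edge \<open>g v\<close> at its other end \<open>w\<close>, then
  \<open>w\<close> would be lower than \<open>v\<close>, so \<open>f w = g w\<close> by induction,
  and \<open>g w\<close> would lead back up to \<open>v\<close>.\<close>

theorem num_spanning_trees_exiting: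
  assumes X: "finite_multigraph X" and r: "r \<in> verts X"
  shows "num_spanning_trees X = card {f \<in> PiE (verts X - {r}) (out X). exiting X (verts X - {r}) f}"
proof -
  let ?T = "verts X - {r}"
  let ?F = "{f \<in> PiE ?T (out X). exiting X ?T f}"
  let ?\<Phi> = "\<lambda>f. (\<lambda>v. fst (f v)) ` ?T"
  have fo: "f v \<in> oedges X" "initial X (f v) = v" if "f \<in> PiE ?T (out X)" "v \<in> ?T" for f v
    using PiE_out[OF that] by auto
  have "bij_betw ?\<Phi> ?F {S. S \<subseteq> edges X \<and> is_tree (X\<lparr>edges := S\<rparr>)}"
  proof (rule bij_betw_imageI)
    show "?\<Phi> ` ?F = {S. S \<subseteq> edges X \<and> is_tree (X\<lparr>edges := S\<rparr>)}"
    proof (intro equalityI subsetI)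
      fix S assume "S \<in> ?\<Phi> ` ?F"
      then obtain f where S: "S = ?\<Phi> f" and fF: "f \<in> ?F" by (rule imageE)
      then have f: "f \<in> PiE ?T (out X)" "exiting X ?T f" by simp_all
      show "S \<in> {S. S \<subseteq> edges X \<and> is_tree (X\<lparr>edges := S\<rparr>)}"
        unfolding S using exiting_tree[OF X r f] by (intro CollectI conjI)
    next
      fix S assume "S \<in> {S. S \<subseteq> edges X \<and> is_tree (X\<lparr>edges := S\<rparr>)}"
      then have S: "S \<subseteq> edges X" "connected_multigraph (X\<lparr>edges := S\<rparr>)" "\<nexists>p. is_cycle (X\<lparr>edges := S\<rparr>) p"
        by (auto simp: is_tree_def)
      obtain f where f: "f \<in> PiE ?T (out X)" "exiting X ?T f" "?\<Phi> f \<subseteq> S"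
        using exiting_exists[OF X r S(1,2)] by (elim bexE conjE) (rule that)
      have "connected_multigraph (X\<lparr>edges := ?\<Phi> f\<rparr>)"
        using exiting_tree(2)[OF X r f(1,2)] by (simp add: is_tree_def)
      then have "e \<in> ?\<Phi> f" if "e \<in> S" for e
        using connected_proper_subset_cycle[OF X S(1) f(3), of e] S(3) that by (cases "e \<in> ?\<Phi> f") simp_all
      then have "?\<Phi> f = S" using f(3) by (intro equalityI subsetI) auto
      then show "S \<in> ?\<Phi> ` ?F" using f by (intro image_eqI[of _ _ f]) simp_all
    qed
    show "inj_on ?\<Phi> ?F"
    proof (rule inj_onI)
      fix f g assume f: "f \<in> ?F" and g: "g \<in> ?F" and eq: "?\<Phi> f = ?\<Phi> g"
      have g': "g \<in> PiE ?T (out X)" "exiting X ?T g" using g by simp_all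
      obtain h :: "_ \<Rightarrow> nat" where h0: "\<forall>v\<in>?T. h (terminal X (g v)) < h v"
        using exiting_height[OF X r g'] by (rule exE)
      note h = bspec[OF h0]
      have "f v = g v" if "v \<in> ?T" for v
        using that
      proof (induction "h v" arbitrary: v rule: less_induct)
        case less
        note v = less.prems
        have "fst (g v) \<in> ?\<Phi> f" using eq v by auto
        then obtain w where w: "w \<in> ?T" "fst (g v) = fst (f w)" by auto
        show ?case
        proof (cases "g v = f w")
          case True
          then have "w = v" using fo(2)[of f w] fo(2)[of g v] f g w v by simp
          then show ?thesis using True by simp
        next
          case False
          then have gv: "g v = orev (f w)" using same_edge_cases[OF w(2)] by blast
          have tv: "terminal X (g v) = w" using gv fo(2)[of f w] f w by simp
          then have "h w < h v" using h[OF v] by simp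
          then have "f w = g w" using less.hyps w by blast
          then have "g w = orev (g v)" using gv by simp
          then have "terminal X (g w) = v" using fo(2)[of g v] g v by simp
          then show ?thesis using h[OF w(1)] \<open>h w < h v\<close> by simp
        qed
      qed
      then show "f = g" using f g by (intro PiE_ext[of f ?T "out X" g]) auto
    qed
  qed
  then show ?thesis unfolding num_spanning_trees_def by (rule bij_betw_same_card[symmetric])
qed

theorem matrix_tree:
  assumes X: "finite_multigraph X" and r: "r \<in> verts X"
  shows "fdet (verts X - {r}) (laplacian X) = of_nat (num_spanning_trees X)"
proof -
  have fin: "finite (verts X - {r})" using X by (simp add: finite_multigraph_def)
  show ?thesis unfolding fdet_laplacian[OF X fin] num_spanning_trees_exiting[OF X r] ..
qed

lemma num_spanning_trees_pos:
  assumes X: "finite_multigraph X" and conn: "connected_multigraph X"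
  shows "num_spanning_trees X > 0"
proof -
  obtain r where r: "r \<in> verts X" using conn by (auto simp: connected_multigraph_def)
  let ?T = "verts X - {r}"
  have "finite ?T" using X by (simp add: finite_multigraph_def)
  moreover have "finite (out X v)" for v using finite_oedges[OF X] by (simp add: out_def)
  ultimately have fin: "finite (PiE ?T (out X))" by (intro finite_PiE) auto
  have "X\<lparr>edges := edges X\<rparr> = X" by simp
  then obtain f where "f \<in> PiE ?T (out X)" "exiting X ?T f"
    using exiting_exists[OF X r, of "edges X"] conn by auto
  then have "{f \<in> PiE ?T (out X). exiting X ?T f} \<noteq> {}" by blast
  then show ?thesis unfolding num_spanning_trees_exiting[OF X r] using fin by (simp add: card_gt_0_iff)
qed

section \<open>Indices of lattices\<close>

text \<open>The values off \<open>S\<close> are fixed, so that two vectors agreeing on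
  \<open>S\<close> are equal as functions.\<close>

definition vecs :: "'a set \<Rightarrow> ('a \<Rightarrow> int) set" where
  "vecs S = {x. \<forall>i. i \<notin> S \<longrightarrow> x i = 0}"

definition lincomb :: "'a set \<Rightarrow> ('a \<Rightarrow> 'a \<Rightarrow> int) \<Rightarrow> ('a \<Rightarrow> int) \<Rightarrow> 'a \<Rightarrow> int" where
  "lincomb S A z = (\<lambda>i. if i \<in> S then \<Sum>j\<in>S. A i j * z j else 0)"

definition lat :: "'a set \<Rightarrow> ('a \<Rightarrow> 'a \<Rightarrow> int) \<Rightarrow> ('a \<Rightarrow> int) set" where
  "lat S A = lincomb S A ` vecs S"

definition transversal :: "'a set \<Rightarrow> ('a \<Rightarrow> int) set \<Rightarrow> ('a \<Rightarrow> int) set \<Rightarrow> bool" where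
  "transversal S L R \<longleftrightarrow> R \<subseteq> vecs S \<and> (\<forall>x\<in>vecs S. \<exists>r\<in>R. (\<lambda>i. x i - r i) \<in> L) \<and>
     (\<forall>r\<in>R. \<forall>r'\<in>R. (\<lambda>i. r i - r' i) \<in> L \<longrightarrow> r = r')"

definition colop :: "'a \<Rightarrow> 'a \<Rightarrow> int \<Rightarrow> ('a \<Rightarrow> 'a \<Rightarrow> int) \<Rightarrow> 'a \<Rightarrow> 'a \<Rightarrow> int" where
  "colop j k c A = (\<lambda>i l. A i l + (if l = k then c * A i j else 0))"

text \<open>Replacing \<open>c\<close> by \<open>- c\<close> undoes the operation, so one inclusion,
  proved for all \<open>c\<close> and \<open>A\<close>, gives both.\<close>

lemma lattice_colop:
  assumes S: "finite S" "j \<in> S" "k \<in> S" "j \<noteq> k"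
  shows "lat S (colop j k c A) = lat S A"
proof -
  have sub: "lat S (colop j k c A) \<subseteq> lat S A" for c A
  proof
    fix x assume "x \<in> lat S (colop j k c A)"
    then obtain z where z: "z \<in> vecs S" "x = lincomb S (colop j k c A) z" by (auto simp: lat_def)
    let ?z = "z(j := z j + c * z k)"
    have e: "(\<Sum>l\<in>S. colop j k c A i l * z l) = (\<Sum>l\<in>S. A i l * ?z l)" for i
    proof -
      have "(\<Sum>l\<in>S. colop j k c A i l * z l) = (\<Sum>l\<in>S. A i l * z l + (if l = k then c * A i j * z l else 0))"
        by (rule sum.cong) (auto simp: colop_def algebra_simps)
      also have "\<dots> = (\<Sum>l\<in>S. A i l * z l) + c * A i j * z k" using S by (simp add: sum.distrib)
      also have "\<dots> = (\<Sum>l\<in>S. A i l * z l + (if l = j then c * A i j * z k else 0))" using S by (simp add: sum.distrib)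
      also have "\<dots> = (\<Sum>l\<in>S. A i l * ?z l)" by (rule sum.cong) (auto simp: algebra_simps)
      finally show ?thesis .
    qed
    have "x = lincomb S A ?z" unfolding z(2) lincomb_def e ..
    moreover have "?z \<in> vecs S" using z(1) S by (auto simp: vecs_def)
    ultimately show "x \<in> lat S A" unfolding lat_def by (rule image_eqI)
  qed
  have "colop j k (- c) (colop j k c A) = A" using S(4) by (auto simp: colop_def fun_eq_iff)
  then show ?thesis using sub[of c A] sub[of "- c" "colop j k c A"] by auto
qed

text \<open>The elementary matrix differs from the identity by a matrix of rank one. Sylvester's
  identity turns its determinant into that of a 1 by 1 matrix, whose entry is 1 because
  \<open>j\<close> and \<open>k\<close> differ.\<close>

lemma fdet_colop:
  assumes S: "finite S" "j \<in> S" "k \<in> S" "j \<noteq> k"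
  shows "fdet S (colop j k c A) = fdet S A"
proof -
  let ?E = "\<lambda>i l. (if i = l then 1 else 0) - (\<Sum>u\<in>{()}. (if i = j then - c else 0) * (if l = k then 1 else 0))"
  have "fdet S ?E = fdet {()} (\<lambda>u v. (if u = v then 1 else 0) - (\<Sum>i\<in>S. (if i = k then 1 else 0) * (if i = j then - c else 0)))"
    using fdet_sylvester[OF S(1), of "{()}" "\<lambda>i _. if i = j then - c else 0" "\<lambda>_ l. if l = k then 1 else 0"]
    by (simp add: mult.commute)
  also have "(\<Sum>i\<in>S. (if i = k then 1 else 0) * (if i = j then - c else 0)) = 0"
    using S(4) by (intro sum.neutral) auto
  finally have E: "fdet S ?E = 1" by (simp add: fdet_singleton)
  have "fdet S (colop j k c A) = fdet S (\<lambda>i l. \<Sum>m\<in>S. A i m * ?E m l)"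
  proof (rule fdet_cong[OF refl])
    fix i l assume il: "i \<in> S" "l \<in> S"
    have "(\<Sum>m\<in>S. A i m * ?E m l) = (\<Sum>m\<in>S. (if m = l then A i m else 0) + (if m = j then (if l = k then c * A i m else 0) else 0))"
      by (rule sum.cong) (use S(4) in \<open>auto simp: algebra_simps\<close>)
    also have "\<dots> = colop j k c A i l" using S il by (simp add: sum.distrib colop_def)
    finally show "colop j k c A i l = (\<Sum>m\<in>S. A i m * ?E m l)" by simp
  qed
  also have "\<dots> = fdet S A" using E by (simp add: fdet_mult[OF S(1)])
  finally show ?thesis .
qed

text \<open>Euclid's algorithm by column operations: as long as row \<open>s\<close> has two nonzero
  entries, the larger can be shortened by the smaller, and the sum of absolute values drops.\<close>

lemma reduce_row:
  fixes A :: "'a \<Rightarrow> 'a \<Rightarrow> int"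
  assumes S: "finite S" and s: "s \<in> S"
  shows "\<exists>B. lat S B = lat S A \<and> fdet S B = fdet S A \<and> (\<forall>j\<in>S. j \<noteq> s \<longrightarrow> B s j = 0)"
proof (induction "nat (\<Sum>j\<in>S. \<bar>A s j\<bar>)" arbitrary: A rule: less_induct)
  case less
  have step: ?case if jk: "j \<in> S" "k \<in> S" "j \<noteq> k" "A s j \<noteq> 0" "A s k \<noteq> 0" "\<bar>A s j\<bar> \<le> \<bar>A s k\<bar>" for j k
  proof -
    \<comment> \<open>The sign makes \<open>c * A s j\<close> opposite to \<open>A s k\<close>, so
      adding it decreases the absolute value.\<close>
    define c where "c = - (sgn (A s j) * sgn (A s k))"
    let ?B = "colop j k c A"
    have "\<bar>A s k + c * A s j\<bar> < \<bar>A s k\<bar>"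
      using jk(4-6) by (cases "A s j > 0"; cases "A s k > 0") (simp_all add: c_def)
    then have "\<bar>?B s k\<bar> < \<bar>A s k\<bar>" by (simp add: colop_def)
    moreover have "\<bar>?B s l\<bar> \<le> \<bar>A s l\<bar>" for l
      using \<open>\<bar>?B s k\<bar> < \<bar>A s k\<bar>\<close> by (cases "l = k") (simp_all add: colop_def)
    ultimately have "(\<Sum>l\<in>S. \<bar>?B s l\<bar>) < (\<Sum>l\<in>S. \<bar>A s l\<bar>)"
      using jk(2) by (intro sum_strict_mono_ex1[OF S] ballI bexI[of _ k])
    moreover have "0 \<le> (\<Sum>l\<in>S. \<bar>?B s l\<bar>)" by (rule sum_nonneg) simp
    ultimately have "nat (\<Sum>l\<in>S. \<bar>?B s l\<bar>) < nat (\<Sum>l\<in>S. \<bar>A s l\<bar>)"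
      by (simp only: nat_less_eq_zless)
    from less.hyps[of ?B, OF this] show ?thesis
      unfolding lattice_colop[OF S jk(1-3)] fdet_colop[OF S jk(1-3)] .
  qed
  show ?case
  proof (cases "\<exists>j\<in>S. \<exists>k\<in>S. j \<noteq> k \<and> A s j \<noteq> 0 \<and> A s k \<noteq> 0")
    case True
    then obtain j k where jk: "j \<in> S" "k \<in> S" "j \<noteq> k" "A s j \<noteq> 0" "A s k \<noteq> 0" by blast
    show ?thesis
    proof (cases "\<bar>A s j\<bar> \<le> \<bar>A s k\<bar>")
      case True
      show ?thesis by (rule step[OF jk True])
    next
      case False
      then have "\<bar>A s k\<bar> \<le> \<bar>A s j\<bar>" by simp
      then show ?thesis by (rule step[OF jk(2,1) jk(3)[symmetric] jk(5,4)])
    qed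
  next
    case False
    show ?thesis
    proof (cases "\<exists>j\<in>S. j \<noteq> s \<and> A s j \<noteq> 0")
      case True
      then obtain j where j: "j \<in> S" "j \<noteq> s" "A s j \<noteq> 0" by blast
      then have z: "A s l = 0" if "l \<in> S" "l \<noteq> j" for l using False that by blast
      \<comment> \<open>The only nonzero entry of the row is copied from column \<open>j\<close> to
        column \<open>s\<close> and then cleared in column \<open>j\<close>. This replaces a swap of
        columns, which would change the sign of the determinant.\<close>
      let ?B = "colop s j (- 1) (colop j s 1 A)"
      have "lat S ?B = lat S A" "fdet S ?B = fdet S A"
        using S s j by (simp_all add: lattice_colop fdet_colop)
      moreover have "?B s l = 0" if "l \<in> S" "l \<noteq> s" for l
        using z[of s] z[of l] that s j(2) by (cases "l = j") (simp_all add: colop_def)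
      ultimately show ?thesis by (intro exI[of _ ?B] conjI ballI impI)
    next
      case False
      then have z: "\<forall>j\<in>S. j \<noteq> s \<longrightarrow> A s j = 0" by blast
      show ?thesis by (rule exI[of _ A]) (intro conjI refl z)
    qed
  qed
qed

lemma lattice_add:
  assumes "x \<in> lat S A" "y \<in> lat S A"
  shows "(\<lambda>i. x i + y i) \<in> lat S A"
proof -
  obtain z w where "z \<in> vecs S" "x = lincomb S A z" "w \<in> vecs S" "y = lincomb S A w"
    using assms by (auto simp: lat_def)
  then have "(\<lambda>i. x i + y i) = lincomb S A (\<lambda>i. z i + w i)" "(\<lambda>i. z i + w i) \<in> vecs S"
    by (auto simp: lincomb_def vecs_def fun_eq_iff sum.distrib algebra_simps)
  then show ?thesis unfolding lat_def by (rule image_eqI)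
qed

lemma lattice_zero: "(\<lambda>_. 0) \<in> lat S A"
  unfolding lat_def by (rule image_eqI[of _ _ "\<lambda>_. 0"]) (auto simp: lincomb_def vecs_def fun_eq_iff)

lemma lattice_diff:
  assumes "x \<in> lat S A" "y \<in> lat S A"
  shows "(\<lambda>i. x i - y i) \<in> lat S A"
proof -
  from assms(1) obtain z where z: "x = lincomb S A z" "z \<in> vecs S" unfolding lat_def by (rule imageE)
  from assms(2) obtain w where w: "y = lincomb S A w" "w \<in> vecs S" unfolding lat_def by (rule imageE)
  have "(\<lambda>i. x i - y i) = lincomb S A (\<lambda>i. z i - w i)"
    unfolding z(1) w(1) lincomb_def by (auto simp: fun_eq_iff sum_subtractf right_diff_distrib)
  moreover have "(\<lambda>i. z i - w i) \<in> vecs S" using z(2) w(2) by (simp add: vecs_def)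
  ultimately show ?thesis unfolding lat_def by (rule image_eqI)
qed

text \<open>Once row \<open>s\<close> is cleared off the diagonal, coordinate \<open>s\<close> is
  determined modulo g = \<open>A s s\<close>, and columns from \<open>S\<close> act on the other
  coordinates alone. Representatives are pairs of one for \<open>S\<close> and a residue in [0,
  |g|), matching the factorisation of the determinant.\<close>

theorem lattice_transversal:
  assumes "finite S" "fdet S A \<noteq> (0::int)"
  shows "\<exists>R. finite R \<and> transversal S (lat S A) R \<and> int (card R) = \<bar>fdet S A\<bar>"
  using assms
proof (induction S arbitrary: A rule: finite_induct)
  case empty
  have "lat {} A = {\<lambda>_. 0}" "vecs {} = {\<lambda>_::'a. 0}" by (auto simp: lat_def lincomb_def vecs_def)
  then have "transversal {} (lat {} A) {\<lambda>_. 0}" by (auto simp: transversal_def)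
  then show ?case by (intro exI[of _ "{\<lambda>_. 0}"]) simp
next
  case (insert s S A0)
  let ?S = "insert s S"
  have finS: "finite ?S" using insert.hyps by simp
  obtain A where A: "lat ?S A = lat ?S A0" "fdet ?S A = fdet ?S A0" "\<And>j. j \<in> S \<Longrightarrow> A s j = 0"
  proof -
    obtain B where B: "lat ?S B = lat ?S A0" "fdet ?S B = fdet ?S A0" "\<forall>j\<in>?S. j \<noteq> s \<longrightarrow> B s j = 0"
      using reduce_row[OF finS insertI1, of A0] by (elim exE conjE) (rule that)
    show ?thesis by (rule that[OF B(1,2)]) (use B(3) insert.hyps(2) in auto)
  qed
  define g where "g = A s s"
  have "fdet ({s} \<union> S) A = fdet {s} A * fdet S A"
    by (rule fdet_block) (use insert.hyps A(3) in auto)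
  then have D: "fdet ?S A = g * fdet S A" by (simp add: fdet_singleton g_def)
  have g: "g \<noteq> 0" "fdet S A \<noteq> 0" using D A(2) insert.prems by auto
  obtain R where R: "finite R" "transversal S (lat S A) R" "int (card R) = \<bar>fdet S A\<bar>"
    using insert.IH[OF g(2)] by blast
  have Rv: "\<And>r. r \<in> R \<Longrightarrow> r \<in> vecs S"
    and Re: "\<And>x. x \<in> vecs S \<Longrightarrow> \<exists>r\<in>R. (\<lambda>i. x i - r i) \<in> lat S A"
    and Ru: "\<And>r r'. r \<in> R \<Longrightarrow> r' \<in> R \<Longrightarrow> (\<lambda>i. r i - r' i) \<in> lat S A \<Longrightarrow> r = r'"
    using R(2) by (auto simp: transversal_def)
  have vz: "r s = 0" if "r \<in> vecs S" for r using that insert.hyps(2) by (simp add: vecs_def)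
  have lc: "lincomb ?S A z = lincomb S A z" if "z s = 0" for z
    using that insert.hyps A(3) by (auto simp: lincomb_def fun_eq_iff)
  have sub: "x \<in> lat ?S A" if "x \<in> lat S A" for x
  proof -
    from that obtain z where "x = lincomb S A z" "z \<in> vecs S" unfolding lat_def by (rule imageE)
    note z = this(2,1)
    then have "x = lincomb ?S A z" "z \<in> vecs ?S" using lc[of z] vz[of z] by (auto simp: vecs_def)
    then show ?thesis unfolding lat_def by (rule image_eqI)
  qed
  let ?f = "\<lambda>(r, m). r(s := m)"
  let ?R = "?f ` (R \<times> {0..<\<bar>g\<bar>})"
  have inj: "inj_on ?f (R \<times> {0..<\<bar>g\<bar>})"
  proof (rule inj_onI, clarify)
    fix r m r' m' assume h: "r \<in> R" "r' \<in> R" "r(s := m) = r'(s := m')"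
    have "r i = r' i" for i
      using fun_cong[OF h(3), of i] vz[OF Rv[OF h(1)]] vz[OF Rv[OF h(2)]] by (cases "i = s") auto
    then show "r = r' \<and> m = m'" using fun_cong[OF h(3), of s] by auto
  qed
  have "int (card ?R) = \<bar>fdet ?S A0\<bar>"
    unfolding card_image[OF inj] using R(1,3) D A(2) by (simp add: card_cartesian_product abs_mult)
  moreover have "transversal ?S (lat ?S A) ?R"
    unfolding transversal_def
  proof (intro conjI ballI impI)
    show "?R \<subseteq> vecs ?S" using Rv by (auto simp: vecs_def)
  next
    fix x assume x: "x \<in> vecs ?S"
    \<comment> \<open>Division is by |g| to obtain the residue in the chosen range; the factor
      \<open>sgn g\<close> turns the result into a quotient by \<open>g\<close>.\<close>
    define q m where "q = sgn g * (x s div \<bar>g\<bar>)" and "m = x s mod \<bar>g\<bar>"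
    have qm: "x s = g * q + m" "m \<in> {0..<\<bar>g\<bar>}"
      using g(1) by (auto simp: q_def m_def abs_sgn[symmetric] mult.assoc[symmetric])
    define e where "e = lincomb ?S A (\<lambda>i. if i = s then q else 0)"
    have es: "e s = g * q" using insert.hyps by (simp add: e_def lincomb_def g_def mult_delta_right)
    have eL: "e \<in> lat ?S A" unfolding e_def lat_def by (rule imageI) (simp add: vecs_def)
    define y where "y i = (if i \<in> S then x i - e i else 0)" for i
    have "y \<in> vecs S" by (simp add: y_def vecs_def)
    then obtain r where r: "r \<in> R" "(\<lambda>i. y i - r i) \<in> lat S A" using Re by blast
    have "(\<lambda>i. x i - (r(s := m)) i) = (\<lambda>i. e i + (y i - r i))"
    proof
      fix i
      show "x i - (r(s := m)) i = e i + (y i - r i)"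
      proof (cases "i = s")
        case True
        then show ?thesis using qm es insert.hyps(2) vz[OF Rv[OF r(1)]] by (simp add: y_def)
      next
        case False
        then show ?thesis using x Rv[OF r(1)] by (auto simp: y_def vecs_def e_def lincomb_def)
      qed
    qed
    then have "(\<lambda>i. x i - (r(s := m)) i) \<in> lat ?S A"
      using lattice_add[OF eL sub[OF r(2)]] by simp
    then show "\<exists>r\<in>?R. (\<lambda>i. x i - r i) \<in> lat ?S A"
      using r(1) qm(2) by (intro bexI[of _ "r(s := m)"]) (auto intro!: image_eqI[of _ _ "(r, m)"])
  next
    fix t t' assume t: "t \<in> ?R" "t' \<in> ?R" and d: "(\<lambda>i. t i - t' i) \<in> lat ?S A"
    obtain r m where r: "r \<in> R" "m \<in> {0..<\<bar>g\<bar>}" "t = r(s := m)" using t(1) by auto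
    obtain r' m' where r': "r' \<in> R" "m' \<in> {0..<\<bar>g\<bar>}" "t' = r'(s := m')" using t(2) by auto
    obtain z where z: "z \<in> vecs ?S" "(\<lambda>i. t i - t' i) = lincomb ?S A z" using d by (auto simp: lat_def)
    have "m - m' = g * z s"
      using fun_cong[OF z(2), of s] r r' insert.hyps A(3) by (simp add: lincomb_def g_def)
    moreover have "\<bar>m - m'\<bar> < \<bar>g\<bar>" using r(2) r'(2) by auto
    ultimately have zs: "z s = 0" "m = m'"
      using g(1) by (auto simp: abs_mult mult_less_cancel_left1)
    have "(\<lambda>i. r i - r' i) = lincomb S A z"
    proof
      fix i show "r i - r' i = lincomb S A z i"
        using fun_cong[OF z(2)[unfolded lc[of z, OF zs(1)]], of i] r(3) r'(3) zs(2)
          vz[OF Rv[OF r(1)]] vz[OF Rv[OF r'(1)]] by (cases "i = s") simp_all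
    qed
    moreover have "z \<in> vecs S" using z(1) zs by (auto simp: vecs_def)
    ultimately have "r = r'" using Ru[OF r(1) r'(1)] by (simp add: lat_def)
    then show "t = t'" using r r' zs by simp
  qed
  ultimately show ?case using R(1) A(1) by (intro exI[of _ ?R]) auto
qed

section \<open>Covers and deck transformations\<close>

lemma cell_orev: "cell X (orev a) t = cell X a (1 - t)"
  by (auto simp: cell_def orev_def terminal_def initial_def)

lemma cell_inner: "0 < t \<Longrightarrow> t < 1 \<Longrightarrow> cell X a t = Inner (fst a) (if snd a then t else 1 - t)"
  by (simp add: cell_def)

lemma cell_0 [simp]: "cell X a 0 = Vertex (initial X a)"
  by (simp add: cell_def)

lemma cell_eq_cell:
  assumes "0 < t" "t < 1" "0 < s" "s < 1"
  shows "cell X a t = cell X b s \<longleftrightarrow> (b = a \<and> s = t) \<or> (b = orev a \<and> s = 1 - t)"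
  using assms by (cases a; cases b) (auto simp: cell_inner orev_def)

lemma cell_in_points:
  assumes X: "finite_multigraph X" and a: "a \<in> oedges X" and t: "0 \<le> t" "t \<le> 1"
  shows "cell X a t \<in> points X"
  using initial_in[OF X a] terminal_in[OF X a] a t
  by (auto simp: cell_def points_def oedges_def)

lemma openin_unit_interval_0:
  assumes U: "openin (top_of_set {0..1}) U" and 0: "(0::real) \<in> U"
  shows "\<exists>\<epsilon>>0. \<epsilon> \<le> 1/2 \<and> (\<forall>t. 0 \<le> t \<longrightarrow> t < \<epsilon> \<longrightarrow> t \<in> U)"
proof -
  obtain T where T: "open T" "U = {0..1} \<inter> T" using U by (auto simp: openin_open)
  then obtain e where e: "e > 0" "ball 0 e \<subseteq> T" using 0 openE[of T 0] by auto
  have "t \<in> U" if "0 \<le> t" "t < min e (1/2)" for t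
    using that e(2) T(2) by (auto simp: subset_iff dist_real_def)
  then show ?thesis using e(1) by (intro exI[of _ "min e (1/2)"]) auto
qed

text \<open>Cutting each edge at its midpoint makes the star of a vertex record which end of an edge
  is near, also for loops. This is how images of end points are recognised later.\<close>

definition star :: "('v, 'e) multigraph \<Rightarrow> 'v \<Rightarrow> ('v, 'e) point set" where
  "star X v = insert (Vertex v) {cell X a t | a t. a \<in> oedges X \<and> initial X a = v \<and> 0 < t \<and> t < 1/2}"

lemma star_I: "a \<in> oedges X \<Longrightarrow> 0 < t \<Longrightarrow> t < 1/2 \<Longrightarrow> cell X a t \<in> star X (initial X a)"
  unfolding star_def by blast

lemma star_cases:
  assumes "y \<in> star X v"
  obtains "y = Vertex v" | a t where "a \<in> oedges X" "initial X a = v" "0 < t" "t < 1/2" "y = cell X a t"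
  using assms unfolding star_def by blast

lemma cell_in_star:
  assumes a: "a \<in> oedges X" and t: "0 < t" "t < 1"
  shows "cell X a t \<in> star X v \<longleftrightarrow> (initial X a = v \<and> t < 1/2) \<or> (terminal X a = v \<and> 1/2 < t)"
proof
  assume "cell X a t \<in> star X v"
  then obtain b s where b: "b \<in> oedges X" "initial X b = v" "0 < s" "s < 1/2" "cell X a t = cell X b s"
    using t by (auto simp: star_def cell_inner)
  then have "(b = a \<and> s = t) \<or> (b = orev a \<and> s = 1 - t)"
    using cell_eq_cell[OF t, of s X a b] by simp
  then show "(initial X a = v \<and> t < 1/2) \<or> (terminal X a = v \<and> 1/2 < t)" using b by auto
next
  assume "(initial X a = v \<and> t < 1/2) \<or> (terminal X a = v \<and> 1/2 < t)"
  then show "cell X a t \<in> star X v"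
  proof
    assume "initial X a = v \<and> t < 1/2"
    then show ?thesis using star_I[OF a t(1)] by blast
  next
    assume h: "terminal X a = v \<and> 1/2 < t"
    have "cell X a t = cell X (orev a) (1 - t)" by (simp add: cell_orev)
    moreover have "orev a \<in> oedges X" "initial X (orev a) = v" using a h by auto
    ultimately show ?thesis unfolding star_def using h t by (intro insertI2 CollectI exI[of _ "orev a"] exI[of _ "1 - t"]) simp
  qed
qed

lemma cw_open_star:
  assumes X: "finite_multigraph X" and v: "v \<in> verts X"
  shows "cw_open X (star X v)"
  unfolding cw_open_def
proof (intro conjI ballI)
  show "star X v \<subseteq> points X"
  proof
    fix y assume "y \<in> star X v"
    then show "y \<in> points X"
    proof (cases rule: star_cases)
      case 1
      then show ?thesis using v by (simp add: points_def)
    next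
      case (2 a t)
      then show ?thesis using cell_in_points[OF X] by simp
    qed
  qed
  fix a assume a: "a \<in> oedges X"
  let ?A = "if initial X a = v then {..<1/2} else {}" and ?B = "if terminal X a = v then {1/2<..} else {}"
  have "{t \<in> {0..1}. cell X a t \<in> star X v} = {0..1} \<inter> (?A \<union> ?B :: real set)"
  proof (intro equalityI subsetI)
    fix t :: real
    assume t: "t \<in> {t \<in> {0..1}. cell X a t \<in> star X v}"
    consider "t = 0" | "t = 1" | "0 < t" "t < 1" using t by fastforce
    then show "t \<in> {0..1} \<inter> (?A \<union> ?B)"
    proof cases
      case 1 then show ?thesis using t by (auto simp: star_def cell_inner)
    next
      case 2 then show ?thesis using t by (auto simp: star_def cell_inner cell_def)
    next
      case 3 then show ?thesis using t cell_in_star[OF a 3] by auto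
    qed
  next
    fix t :: real
    assume t: "t \<in> {0..1} \<inter> (?A \<union> ?B)"
    consider "t = 0" | "t = 1" | "0 < t" "t < 1" using t by fastforce
    then show "t \<in> {t \<in> {0..1}. cell X a t \<in> star X v}"
    proof cases
      case 1 then show ?thesis using t by (auto simp: star_def split: if_splits)
    next
      case 2 then show ?thesis using t by (auto simp: star_def cell_def split: if_splits)
    next
      case 3 then show ?thesis using t cell_in_star[OF a 3] by (auto split: if_splits)
    qed
  qed
  moreover have "open (?A \<union> ?B :: real set)" by auto
  ultimately show "openin (top_of_set {0..1}) {t \<in> {0..1}. cell X a t \<in> star X v}"
    using openin_open_Int[of "?A \<union> ?B" "{0..1}"] by (simp only:)
qed

definition open_edge :: "('v, 'e) multigraph \<Rightarrow> 'e oedge \<Rightarrow> ('v, 'e) point set" where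
  "open_edge X a = {cell X a t | t. 0 < t \<and> t < 1}"

lemma cw_open_open_edge:
  assumes X: "finite_multigraph X" and a: "a \<in> oedges X"
  shows "cw_open X (open_edge X a)"
  unfolding cw_open_def
proof (intro conjI ballI)
  show "open_edge X a \<subseteq> points X" using cell_in_points[OF X a] by (auto simp: open_edge_def)
  fix b assume b: "b \<in> oedges X"
  have "{t \<in> {0..1}. cell X b t \<in> open_edge X a} = {0..1} \<inter> (if fst b = fst a then {0<..<1} else {} :: real set)"
  proof (intro equalityI subsetI)
    fix t :: real
    assume t: "t \<in> {t \<in> {0..1}. cell X b t \<in> open_edge X a}"
    then obtain s where s: "0 < s" "s < 1" "cell X b t = cell X a s" by (auto simp: open_edge_def)
    then have "t \<noteq> 0" "t \<noteq> 1" by (auto simp: cell_def)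
    then have t': "0 < t" "t < 1" using t by auto
    then have "fst b = fst a" using s by (simp add: cell_inner)
    then show "t \<in> {0..1} \<inter> (if fst b = fst a then {0<..<1} else {})" using t' by simp
  next
    fix t :: real
    assume "t \<in> {0..1} \<inter> (if fst b = fst a then {0<..<1} else {})"
    then have t: "fst b = fst a" "0 < t" "t < 1" by (auto split: if_splits)
    then have "b = a \<or> b = orev a" using same_edge_cases by blast
    then have "cell X b t = cell X a t \<or> cell X b t = cell X a (1 - t)" by (auto simp: cell_orev)
    then show "t \<in> {t \<in> {0..1}. cell X b t \<in> open_edge X a}"
    proof
      assume "cell X b t = cell X a t"
      then show ?thesis using t unfolding open_edge_def by auto
    next
      assume "cell X b t = cell X a (1 - t)"
      then have "cell X b t \<in> open_edge X a"
        unfolding open_edge_def using t by (intro CollectI exI[of _ "1 - t"]) simp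
      then show ?thesis using t by simp
    qed
  qed
  then show "openin (top_of_set {0..1}) {t \<in> {0..1}. cell X b t \<in> open_edge X a}"
    by (simp add: openin_open_Int)
qed

section \<open>Lifting oriented edges through the cover\<close>

locale graph_cover =
  fixes X :: "('v, 'e) multigraph" and Y :: "('w, 'f) multigraph"
    and \<pi> :: "('w, 'f, 'v, 'e) multigraph_map"
  assumes finX: "finite_multigraph X" and finY: "finite_multigraph Y" and cov: "cover Y X \<pi>"
begin

lemma emap_in: "b \<in> oedges Y \<Longrightarrow> emap \<pi> b \<in> oedges X"
  and emap_orev: "b \<in> oedges Y \<Longrightarrow> emap \<pi> (orev b) = orev (emap \<pi> b)"
  and initial_emap: "b \<in> oedges Y \<Longrightarrow> initial X (emap \<pi> b) = vmap \<pi> (initial Y b)"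
  and terminal_emap: "b \<in> oedges Y \<Longrightarrow> terminal X (emap \<pi> b) = vmap \<pi> (terminal Y b)"
  and vmap_in: "w \<in> verts Y \<Longrightarrow> vmap \<pi> w \<in> verts X"
  using cov unfolding cover_def multigraph_hom_def by blast+

abbreviation proj where "proj \<equiv> realization_map X \<pi>"

lemma p_Vertex [simp]: "proj (Vertex w) = Vertex (vmap \<pi> w)"
  by (simp add: realization_map_def)

lemma p_cell:
  assumes b: "b \<in> oedges Y" and t: "0 \<le> t" "t \<le> 1"
  shows "proj (cell Y b t) = cell X (emap \<pi> b) t"
proof -
  consider "t = 0" | "t = 1" | "0 < t" "t < 1" using t by fastforce
  then show ?thesis
  proof cases
    case 1 then show ?thesis using b by (simp add: initial_emap)
  next
    case 2 then show ?thesis using b by (simp add: cell_def terminal_emap)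
  next
    case 3
    show ?thesis
    proof (cases "snd b")
      case True
      then have "(fst b, True) = b" by (simp add: prod_eq_iff)
      then show ?thesis using 3 True by (simp add: cell_inner[of t Y] realization_map_def)
    next
      case False
      then have e: "(fst b, True) = orev b" by (simp add: prod_eq_iff orev_def)
      have "proj (cell Y b t) = cell X (emap \<pi> (orev b)) (1 - t)"
        using 3 False by (simp add: cell_inner[of t Y] realization_map_def e)
      then show ?thesis by (simp add: emap_orev[OF b] cell_orev)
    qed
  qed
qed

lemma p_Inner_not_Vertex: "0 < t \<Longrightarrow> t < 1 \<Longrightarrow> proj (Inner f t) \<noteq> Vertex v"
  by (simp add: realization_map_def cell_inner)

lemma topY: "topspace (realization Y) = points Y"
  by (rule topspace_realization[OF finY])

lemma topX: "topspace (realization X) = points X"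
  by (rule topspace_realization[OF finX])

lemma p_image: "proj ` points Y = points X"
  using cov unfolding cover_def covering_map_def topX topY by blast

lemma point_over_Vertex:
  assumes "y \<in> points Y" "proj y = Vertex v"
  shows "\<exists>w\<in>verts Y. y = Vertex w \<and> vmap \<pi> w = v"
  using assms p_Inner_not_Vertex by (auto simp: points_def)

lemma vmap_surj: "v \<in> verts X \<Longrightarrow> \<exists>w\<in>verts Y. vmap \<pi> w = v"
proof -
  assume "v \<in> verts X"
  then have "Vertex v \<in> proj ` points Y" unfolding p_image by (simp add: points_def)
  then obtain y where "y \<in> points Y" "proj y = Vertex v" by auto
  then show ?thesis using point_over_Vertex by blast
qed

text \<open>These are the two local properties taken from an evenly covered neighbourhood:
  injectivity on a sheet makes lifts of edges unique, and openness of images makes them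
  exist.\<close>

lemma sheet:
  assumes w: "w \<in> verts Y"
  shows "\<exists>u. Vertex w \<in> u \<and> cw_open Y u \<and> inj_on proj u \<and> (\<forall>N. cw_open Y N \<longrightarrow> N \<subseteq> u \<longrightarrow> cw_open X (proj ` N))"
proof -
  have x: "Vertex (vmap \<pi> w) \<in> topspace (realization X)"
    unfolding topX using vmap_in[OF w] by (simp add: points_def)
  obtain T vs where T: "Vertex (vmap \<pi> w) \<in> T" "openin (realization X) T"
    and vs: "\<Union>vs = topspace (realization Y) \<inter> proj -` T" "\<forall>u\<in>vs. openin (realization Y) u"
      "\<forall>u\<in>vs. homeomorphic_map (subtopology (realization Y) u) (subtopology (realization X) T) proj"
    using cov x unfolding cover_def covering_map_def by blast
  have "Vertex w \<in> \<Union>vs" unfolding vs(1) topY using w T(1) by (simp add: points_def)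
  then obtain u where u: "u \<in> vs" "Vertex w \<in> u" by blast
  have ou: "openin (realization Y) u" using vs(2) u by blast
  have h: "homeomorphic_map (subtopology (realization Y) u) (subtopology (realization X) T) proj" using vs(3) u by blast
  have tu: "topspace (subtopology (realization Y) u) = u"
    using openin_subset[OF ou] by (simp add: topspace_subtopology Int_absorb1)
  have "inj_on proj u" using homeomorphic_imp_injective_map[OF h] tu by simp
  moreover have "cw_open X (proj ` N)" if N: "cw_open Y N" "N \<subseteq> u" for N
  proof -
    have "openin (subtopology (realization Y) u) N"
      using N ou by (simp add: openin_open_subtopology openin_realization)
    then have "openin (subtopology (realization X) T) (proj ` N)"
      using homeomorphic_imp_open_map[OF h] by (simp add: open_map_def)
    then show ?thesis using T(2) by (simp add: openin_open_subtopology openin_realization)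
  qed
  ultimately show ?thesis using u(2) ou by (auto simp: openin_realization)
qed

text \<open>The image of the part of the star of \<open>w\<close> inside a sheet is open, so it
  contains an initial piece of \<open>a\<close>. A point of that piece comes from an edge
  \<open>b\<close> at \<open>w\<close>, and both parameters being below 1/2 excludes that
  \<open>b\<close> lies over the reverse of \<open>a\<close>.\<close>

lemma lift_exists:
  assumes w: "w \<in> verts Y" and a: "a \<in> oedges X" "initial X a = vmap \<pi> w"
  shows "\<exists>b\<in>oedges Y. initial Y b = w \<and> emap \<pi> b = a"
proof -
  obtain u where u: "Vertex w \<in> u" "cw_open Y u" "\<And>N. cw_open Y N \<Longrightarrow> N \<subseteq> u \<Longrightarrow> cw_open X (proj ` N)"
    using sheet[OF w] by blast
  let ?N = "star Y w \<inter> u"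
  have "cw_open Y ?N"
    using cw_open_star[OF finY w] u(2) istopology_cw_open[of Y] unfolding istopology_def by blast
  then have o: "cw_open X (proj ` ?N)" using u(3) by blast
  have N0: "Vertex w \<in> ?N" using u(1) by (simp add: star_def)
  have "openin (top_of_set {0..1}) {t \<in> {0..1}. cell X a t \<in> proj ` ?N}"
    using o a(1) unfolding cw_open_def by blast
  moreover have "cell X a 0 \<in> proj ` ?N" using N0 a(2) by (intro image_eqI[of _ _ "Vertex w"]) simp_all
  ultimately obtain e where e: "e > 0" "e \<le> 1/2" "\<And>t. 0 \<le> t \<Longrightarrow> t < e \<Longrightarrow> t \<in> {t \<in> {0..1}. cell X a t \<in> proj ` ?N}"
    using openin_unit_interval_0[of "{t \<in> {0..1}. cell X a t \<in> proj ` ?N}"] by auto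
  define t where "t = e / 2"
  have t: "0 < t" "t < 1/2" using e by (auto simp: t_def)
  have "cell X a t \<in> proj ` ?N" using e(3)[of t] e(1) by (simp add: t_def)
  then obtain y where y: "y \<in> star Y w" "cell X a t = proj y" by blast
  have "y \<noteq> Vertex w" using y(2) t by (auto simp: cell_inner)
  then obtain b s where b: "b \<in> oedges Y" "initial Y b = w" "0 < s" "s < 1/2" "y = cell Y b s"
    using y(1) by (auto simp: star_def)
  then have "cell X a t = cell X (emap \<pi> b) s" using y(2) p_cell[OF b(1), of s] by simp
  then have "emap \<pi> b = a" using cell_eq_cell[of t s X a "emap \<pi> b"] t b(3,4) by auto
  then show ?thesis using b by blast
qed

text \<open>Near their common initial vertex both lifts run inside one sheet, where the projection
  is injective.\<close>

lemma lift_unique: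
  assumes b: "b \<in> oedges Y" "b' \<in> oedges Y" "initial Y b = initial Y b'" "emap \<pi> b = emap \<pi> b'"
  shows "b = b'"
proof -
  let ?w = "initial Y b"
  have w: "?w \<in> verts Y" by (rule initial_in[OF finY b(1)])
  obtain u where u: "Vertex ?w \<in> u" "cw_open Y u" "inj_on proj u" using sheet[OF w] by blast
  have near: "\<exists>e>0. e \<le> 1/2 \<and> (\<forall>t. 0 \<le> t \<longrightarrow> t < e \<longrightarrow> t \<in> {t \<in> {0..1}. cell Y c t \<in> u})"
    if "c \<in> oedges Y" "initial Y c = ?w" for c
  proof (rule openin_unit_interval_0)
    show "openin (top_of_set {0..1}) {t \<in> {0..1}. cell Y c t \<in> u}" using u(2) that(1) unfolding cw_open_def by blast
    show "0 \<in> {t \<in> {0..1}. cell Y c t \<in> u}" using that(2) u(1) by simp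
  qed
  obtain e where e: "e > 0" "e \<le> 1/2" "\<forall>t. 0 \<le> t \<longrightarrow> t < e \<longrightarrow> t \<in> {t \<in> {0..1}. cell Y b t \<in> u}" using near[OF b(1)] by blast
  obtain e' where e': "e' > 0" "e' \<le> 1/2" "\<forall>t. 0 \<le> t \<longrightarrow> t < e' \<longrightarrow> t \<in> {t \<in> {0..1}. cell Y b' t \<in> u}" using near[OF b(2)] b(3) by auto
  define t where "t = min e e' / 2"
  have t: "0 < t" "t < 1/2" "t < e" "t < e'" using e(1,2) e'(1,2) by (auto simp: t_def min_def)
  have "cell Y b t \<in> u" "cell Y b' t \<in> u" using e(3) e'(3) t by auto
  moreover have "proj (cell Y b t) = proj (cell Y b' t)" using p_cell[OF b(1), of t] p_cell[OF b(2), of t] b(4) t by simp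
  ultimately have "cell Y b t = cell Y b' t" using u(3) by (simp add: inj_on_def)
  then show ?thesis using cell_eq_cell[of t t Y b b'] t by auto
qed

section \<open>Deck transformations on vertices and edges\<close>

definition deck :: "(('w, 'f) point \<Rightarrow> ('w, 'f) point) \<Rightarrow> bool" where
  "deck h \<longleftrightarrow> h \<in> carrier (deck_group Y X \<pi>)"

lemma deck_iff:
  "deck h \<longleftrightarrow> h \<in> extensional (points Y) \<and> homeomorphic_map (realization Y) (realization Y) h \<and>
     (\<forall>y\<in>points Y. proj (h y) = proj y)"
  unfolding deck_def deck_group_def topY by simp

lemma deck_points: "deck h \<Longrightarrow> y \<in> points Y \<Longrightarrow> h y \<in> points Y"
  using homeomorphic_imp_surjective_map[of "realization Y" "realization Y" h] by (auto simp: deck_iff topY)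

definition act :: "(('w, 'f) point \<Rightarrow> ('w, 'f) point) \<Rightarrow> 'w \<Rightarrow> 'w" where
  "act h w = (case h (Vertex w) of Vertex w' \<Rightarrow> w' | _ \<Rightarrow> w)"

text \<open>Inner points of edges project to inner points, so only vertices lie over vertices. On
  vertices of \<open>Y\<close> the default value in \<open>act\<close> is therefore never
  taken.\<close>

lemma deck_Vertex:
  assumes h: "deck h" and w: "w \<in> verts Y"
  shows "h (Vertex w) = Vertex (act h w)" "act h w \<in> verts Y" "vmap \<pi> (act h w) = vmap \<pi> w"
proof -
  have y: "Vertex w \<in> points Y" using w by (simp add: points_def)
  have "proj (h (Vertex w)) = Vertex (vmap \<pi> w)" using h y unfolding deck_iff by (metis p_Vertex)
  then obtain w' where "w' \<in> verts Y" "h (Vertex w) = Vertex w'" "vmap \<pi> w' = vmap \<pi> w"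
    using point_over_Vertex[OF deck_points[OF h y]] by blast
  then show "h (Vertex w) = Vertex (act h w)" "act h w \<in> verts Y" "vmap \<pi> (act h w) = vmap \<pi> w"
    by (simp_all add: act_def)
qed

lemma deck_preimage_open:
  assumes h: "deck h" and b: "b \<in> oedges Y" and U: "cw_open Y U"
  shows "openin (top_of_set {0..1}) {t \<in> {0..1}. h (cell Y b t) \<in> U}"
proof -
  have "continuous_map (realization Y) (realization Y) h"
    using h by (auto simp: deck_iff homeomorphic_imp_continuous_map)
  then have "openin (realization Y) {y \<in> topspace (realization Y). h y \<in> U}"
    using U by (intro openin_continuous_map_preimage) (auto simp: openin_realization)
  then have "cw_open Y {y \<in> points Y. h y \<in> U}" by (simp add: openin_realization topY)
  then have "openin (top_of_set {0..1}) {t \<in> {0..1}. cell Y b t \<in> {y \<in> points Y. h y \<in> U}}"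
    using b unfolding cw_open_def by blast
  moreover have "{t \<in> {0..1}. cell Y b t \<in> {y \<in> points Y. h y \<in> U}} = {t \<in> {0..1}. h (cell Y b t) \<in> U}"
    using cell_in_points[OF finY b] by auto
  ultimately show ?thesis by simp
qed

text \<open>Compatibility with the projection fixes the edge of \<open>X\<close> and the parameter,
  up to simultaneous reversal. The edge \<open>c\<close> of \<open>Y\<close> may at this stage still
  depend on \<open>t\<close>.\<close>

lemma deck_cell_pointwise:
  assumes h: "deck h" and b: "b \<in> oedges Y" and t: "0 < t" "t < 1"
  shows "\<exists>c\<in>oedges Y. emap \<pi> c = emap \<pi> b \<and> h (cell Y b t) = cell Y c t"
proof -
  let ?y = "h (cell Y b t)"
  have pt: "cell Y b t \<in> points Y" using cell_in_points[OF finY b] t by simp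
  have py: "proj ?y = cell X (emap \<pi> b) t" using h pt p_cell[OF b, of t] t by (auto simp: deck_iff)
  have "?y \<in> points Y" by (rule deck_points[OF h pt])
  then consider w where "w \<in> verts Y" "?y = Vertex w" | f s where "f \<in> edges Y" "0 < s" "s < 1" "?y = Inner f s"
    by (auto simp: points_def)
  then show ?thesis
  proof cases
    case 1
    then show ?thesis using py t by (simp add: cell_inner)
  next
    case 2
    let ?c = "(f, True)"
    have c: "?c \<in> oedges Y" using 2 by (simp add: oedges_def)
    have yc: "?y = cell Y ?c s" using 2 by (simp add: cell_inner)
    then have "cell X (emap \<pi> b) t = cell X (emap \<pi> ?c) s" using py p_cell[OF c, of s] 2 by simp
    then consider "emap \<pi> ?c = emap \<pi> b" "s = t" | "emap \<pi> ?c = orev (emap \<pi> b)" "s = 1 - t"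
      using cell_eq_cell[OF t 2(2,3), of X "emap \<pi> b" "emap \<pi> ?c"] by blast
    then show ?thesis
    proof cases
      case 1
      then show ?thesis using c yc by blast
    next
      case 2
      then have "emap \<pi> (orev ?c) = emap \<pi> b" "?y = cell Y (orev ?c) t"
        using emap_orev[OF c] yc by (simp_all add: cell_orev)
      then show ?thesis using c by (intro bexI[of _ "orev ?c"]) simp_all
    qed
  qed
qed

text \<open>The parameters mapped into the open edge of \<open>c0\<close>, and those mapped into the
  other open edges over the same edge of \<open>X\<close>, form two disjoint relatively open sets
  covering (0, 1). By connectedness the edge met at the midpoint is the only one.\<close>

lemma deck_cell_edge:
  assumes h: "deck h" and b: "b \<in> oedges Y"
  shows "\<exists>c\<in>oedges Y. emap \<pi> c = emap \<pi> b \<and> (\<forall>t. 0 < t \<longrightarrow> t < 1 \<longrightarrow> h (cell Y b t) = cell Y c t)"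
proof -
  obtain c0 where c0: "c0 \<in> oedges Y" "emap \<pi> c0 = emap \<pi> b" "h (cell Y b (1/2)) = cell Y c0 (1/2)"
    using deck_cell_pointwise[OF h b, of "1/2"] by auto
  let ?C = "{c \<in> oedges Y. emap \<pi> c = emap \<pi> b \<and> c \<noteq> c0}"
  \<comment> \<open>An oriented edge differs from its reverse, so two edges of \<open>Y\<close> with
    the same oriented image cannot be reverses of each other.\<close>
  have nrev: "c' \<noteq> orev c" if "c \<in> oedges Y" "emap \<pi> c = emap \<pi> b" "emap \<pi> c' = emap \<pi> b" for c c'
    using emap_orev[OF that(1)] that by (metis orev_neq(1))
  have mem: "h (cell Y b t) \<in> open_edge Y c' \<longleftrightarrow> c' = c"
    if t: "0 < t" "t < 1" and c: "c \<in> oedges Y" "emap \<pi> c = emap \<pi> b" "h (cell Y b t) = cell Y c t"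
      and c': "emap \<pi> c' = emap \<pi> b" for t c c'
  proof
    assume "h (cell Y b t) \<in> open_edge Y c'"
    then obtain s where s: "0 < s" "s < 1" "cell Y c t = cell Y c' s"
      unfolding c(3) open_edge_def by blast
    then show "c' = c" using cell_eq_cell[OF t s(1,2), of Y c c'] nrev[OF c(1,2) c'] by blast
  next
    assume "c' = c"
    then show "h (cell Y b t) \<in> open_edge Y c'" using t unfolding c(3) open_edge_def by blast
  qed
  obtain T1 where T1: "open T1" "{t \<in> {0..1}. h (cell Y b t) \<in> open_edge Y c0} = {0..1} \<inter> T1"
    using deck_preimage_open[OF h b cw_open_open_edge[OF finY c0(1)]] by (auto simp: openin_open)
  have "openin (realization Y) (\<Union>c\<in>?C. open_edge Y c)"
  proof (rule openin_Union)
    fix S assume "S \<in> open_edge Y ` ?C"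
    then obtain c where "c \<in> ?C" "S = open_edge Y c" by blast
    then show "openin (realization Y) S" using cw_open_open_edge[OF finY, of c] by (simp add: openin_realization)
  qed
  then have "cw_open Y (\<Union>c\<in>?C. open_edge Y c)" by (simp only: openin_realization)
  from deck_preimage_open[OF h b this]
  obtain T2 where T2: "open T2" "{t \<in> {0..1}. h (cell Y b t) \<in> (\<Union>c\<in>?C. open_edge Y c)} = {0..1} \<inter> T2"
    unfolding openin_open by blast
  have in1: "t \<in> T1 \<longleftrightarrow> h (cell Y b t) \<in> open_edge Y c0"
    and in2: "t \<in> T2 \<longleftrightarrow> (\<exists>c\<in>?C. h (cell Y b t) \<in> open_edge Y c)" if "0 < t" "t < 1" for t
  proof -
    have t: "t \<in> {0..1}" using that by simp
    show "t \<in> T1 \<longleftrightarrow> h (cell Y b t) \<in> open_edge Y c0"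
      using t T1(2) by blast
    show "t \<in> T2 \<longleftrightarrow> (\<exists>c\<in>?C. h (cell Y b t) \<in> open_edge Y c)"
      using t T2(2) by blast
  qed
  have "T1 \<inter> {0<..<1} = {} \<or> T2 \<inter> {0<..<1} = {}"
  proof (rule connectedD)
    show "connected {0<..<1::real}" by simp
    show "T1 \<inter> T2 \<inter> {0<..<1} = {}"
    proof (rule equals0I)
      fix t assume t: "t \<in> T1 \<inter> T2 \<inter> {0<..<1}"
      obtain c where c: "c \<in> oedges Y" "emap \<pi> c = emap \<pi> b" "h (cell Y b t) = cell Y c t"
        using deck_cell_pointwise[OF h b, of t] t by auto
      have "c0 = c" using mem[OF _ _ c c0(2)] in1[of t] t by auto
      moreover obtain c' where "c' \<in> ?C" "h (cell Y b t) \<in> open_edge Y c'" using in2[of t] t by auto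
      ultimately show False using mem[OF _ _ c, of c'] t by auto
    qed
    show "{0<..<1} \<subseteq> T1 \<union> T2"
    proof
      fix t :: real assume t: "t \<in> {0<..<1}"
      obtain c where c: "c \<in> oedges Y" "emap \<pi> c = emap \<pi> b" "h (cell Y b t) = cell Y c t"
        using deck_cell_pointwise[OF h b, of t] t by auto
      have m: "h (cell Y b t) \<in> open_edge Y c" using mem[OF _ _ c c(2)] t by auto
      show "t \<in> T1 \<union> T2"
      proof (cases "c = c0")
        case True
        then show ?thesis using in1[of t] m t by simp
      next
        case False
        then have "\<exists>c\<in>?C. h (cell Y b t) \<in> open_edge Y c" using c m by blast
        then show ?thesis using in2[of t] t by simp
      qed
    qed
  qed (use T1 T2 in auto)
  moreover have "1/2 \<in> T1 \<inter> {0<..<1}"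
    using in1[of "1/2"] mem[OF _ _ c0 c0(2)] by simp
  ultimately have T20: "T2 \<inter> {0<..<1} = {}" by blast
  have "h (cell Y b t) = cell Y c0 t" if t: "0 < t" "t < 1" for t
  proof -
    obtain c where c: "c \<in> oedges Y" "emap \<pi> c = emap \<pi> b" "h (cell Y b t) = cell Y c t"
      using deck_cell_pointwise[OF h b t] by auto
    have "c = c0"
    proof (rule ccontr)
      assume "c \<noteq> c0"
      then have "\<exists>c\<in>?C. h (cell Y b t) \<in> open_edge Y c" using c mem[OF t c c(2)] by blast
      then have "t \<in> T2" using in2[OF t] by blast
      then show False using T20 t by auto
    qed
    then show ?thesis using c by simp
  qed
  then show ?thesis using c0 by blast
qed

text \<open>By continuity at parameter 0, a point of \<open>c\<close> with small parameter lies in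
  the star of the image vertex. As the parameter is below 1/2, that vertex is the initial
  one.\<close>

lemma deck_edge_initial:
  assumes h: "deck h" and b: "b \<in> oedges Y" and c: "c \<in> oedges Y"
    and bc: "\<And>t. 0 < t \<Longrightarrow> t < 1 \<Longrightarrow> h (cell Y b t) = cell Y c t"
  shows "initial Y c = act h (initial Y b)"
proof -
  let ?w = "initial Y b"
  have w: "?w \<in> verts Y" by (rule initial_in[OF finY b])
  have "cw_open Y (star Y (act h ?w))" by (rule cw_open_star[OF finY deck_Vertex(2)[OF h w]])
  from openin_unit_interval_0[OF deck_preimage_open[OF h b this]]
  obtain e where e: "e > 0" "e \<le> 1/2" "\<forall>t. 0 \<le> t \<longrightarrow> t < e \<longrightarrow> t \<in> {t \<in> {0..1}. h (cell Y b t) \<in> star Y (act h ?w)}"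
    using deck_Vertex(1)[OF h w] by (auto simp: star_def)
  have t: "0 < e/2" "e/2 < 1/2" "e/2 < 1" using e by auto
  have "h (cell Y b (e/2)) \<in> star Y (act h ?w)" using e by auto
  then have "cell Y c (e/2) \<in> star Y (act h ?w)" using bc t by simp
  then show ?thesis using cell_in_star[OF c t(1,3)] t by auto
qed

theorem deck_edge:
  assumes h: "deck h" and b: "b \<in> oedges Y"
  shows "\<exists>c\<in>oedges Y. emap \<pi> c = emap \<pi> b \<and> initial Y c = act h (initial Y b) \<and>
    terminal Y c = act h (terminal Y b) \<and> (\<forall>t. 0 < t \<longrightarrow> t < 1 \<longrightarrow> h (cell Y b t) = cell Y c t)"
proof -
  obtain c where c: "c \<in> oedges Y" "emap \<pi> c = emap \<pi> b" "\<And>t. 0 < t \<Longrightarrow> t < 1 \<Longrightarrow> h (cell Y b t) = cell Y c t"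
    using deck_cell_edge[OF h b] by blast
  have "initial Y c = act h (initial Y b)" by (rule deck_edge_initial[OF h b c(1,3)])
  moreover have "initial Y (orev c) = act h (initial Y (orev b))"
    by (rule deck_edge_initial[OF h]) (use b c in \<open>auto simp: cell_orev\<close>)
  ultimately show ?thesis using c by auto
qed

text \<open>By uniqueness of lifts, a fixed vertex forces each outgoing edge and its far end to be
  fixed; connectedness spreads this over \<open>Y\<close>.\<close>

lemma deck_fixed_vertex_one:
  assumes h: "deck h" and conn: "connected_multigraph Y" and w: "w \<in> verts Y" "act h w = w"
  shows "h = (\<lambda>y\<in>points Y. y)"
proof -
  have edge: "act h (terminal Y b) = terminal Y b \<and> (\<forall>t. 0 < t \<longrightarrow> t < 1 \<longrightarrow> h (cell Y b t) = cell Y b t)"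
    if b: "b \<in> oedges Y" and fx: "act h (initial Y b) = initial Y b" for b
  proof -
    obtain c where c: "c \<in> oedges Y" "emap \<pi> c = emap \<pi> b" "initial Y c = act h (initial Y b)"
      "terminal Y c = act h (terminal Y b)" "\<forall>t. 0 < t \<longrightarrow> t < 1 \<longrightarrow> h (cell Y b t) = cell Y c t"
      using deck_edge[OF h b] by blast
    have "c = b" using lift_unique[OF c(1) b] c(2,3) fx by simp
    then show ?thesis using c by simp
  qed
  have fixv: "act h v = v" if "v \<in> verts Y" for v
  proof -
    have "(w, v) \<in> (adj Y)\<^sup>*" using conn that w(1) by (auto simp: connected_iff)
    then show ?thesis
    proof (induction rule: rtrancl_induct)
      case (step y z)
      then obtain b where "b \<in> oedges Y" "y = initial Y b" "z = terminal Y b" by (auto simp: adj_def)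
      then show ?case using edge step by blast
    qed (use w in simp)
  qed
  show ?thesis
  proof (rule extensionalityI)
    show "h \<in> extensional (points Y)" using h by (simp add: deck_iff)
    show "(\<lambda>y\<in>points Y. y) \<in> extensional (points Y)" by simp
    fix y assume y: "y \<in> points Y"
    then consider v where "v \<in> verts Y" "y = Vertex v" | f t where "f \<in> edges Y" "0 < t" "t < 1" "y = Inner f t"
      by (auto simp: points_def)
    then have "h y = y"
    proof cases
      case 1
      then show ?thesis using deck_Vertex(1)[OF h] fixv by simp
    next
      case 2
      have b: "(f, True) \<in> oedges Y" using 2 by (simp add: oedges_def)
      have "y = cell Y (f, True) t" using 2 by (simp add: cell_inner)
      then show ?thesis using edge[OF b] fixv[OF initial_in[OF finY b]] 2 by simp
    qed
    then show "h y = (\<lambda>y\<in>points Y. y) y" using y by simp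
  qed
qed

lemma deck_mult:
  assumes "deck g" "deck h" "w \<in> verts Y"
  shows "act (g \<otimes>\<^bsub>deck_group Y X \<pi>\<^esub> h) w = act g (act h w)"
proof -
  have B: "k \<in> Bij (points Y)" if "deck k" for k
  proof -
    have k: "k \<in> extensional (points Y)" "homeomorphic_map (realization Y) (realization Y) k"
      using that by (simp_all add: deck_iff)
    have "inj_on k (points Y)" using homeomorphic_imp_injective_map[OF k(2)] by (simp add: topY)
    moreover have "k ` points Y = points Y" using homeomorphic_imp_surjective_map[OF k(2)] by (simp add: topY)
    ultimately show ?thesis using k(1) by (simp add: Bij_def bij_betw_def)
  qed
  have "g \<otimes>\<^bsub>deck_group Y X \<pi>\<^esub> h = compose (points Y) g h"
    using B[OF assms(1)] B[OF assms(2)] by (simp add: deck_group_def BijGroup_def topY)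
  moreover have "Vertex w \<in> points Y" using assms(3) by (simp add: points_def)
  ultimately have "(g \<otimes>\<^bsub>deck_group Y X \<pi>\<^esub> h) (Vertex w) = Vertex (act g (act h w))"
    using deck_Vertex[OF assms(2,3)] deck_Vertex(1)[OF assms(1)] by (simp add: compose_def)
  then show ?thesis by (simp add: act_def)
qed

lemma deck_one: "\<one>\<^bsub>deck_group Y X \<pi>\<^esub> = (\<lambda>y\<in>points Y. y)"
  by (simp add: deck_group_def BijGroup_def topY)

lemma act_one: "w \<in> verts Y \<Longrightarrow> act \<one>\<^bsub>deck_group Y X \<pi>\<^esub> w = w"
  unfolding deck_one act_def by (simp add: points_def)

lemma galois_transitive:
  assumes "galois_cover Y X \<pi>" "w \<in> verts Y" "w' \<in> verts Y" "vmap \<pi> w = vmap \<pi> w'"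
  shows "\<exists>g. deck g \<and> act g w = w'"
proof -
  have "Vertex w \<in> points Y" "Vertex w' \<in> points Y" using assms by (auto simp: points_def)
  then obtain g where "g \<in> carrier (deck_group Y X \<pi>)" "g (Vertex w) = Vertex w'"
    using assms unfolding galois_cover_def topY by (metis p_Vertex)
  then show ?thesis by (intro exI[of _ g]) (simp add: deck_def act_def)
qed

lemma fibre_card:
  assumes d: "has_cover_degree Y X \<pi> d" and v: "v \<in> verts X"
  shows "finite {w \<in> verts Y. vmap \<pi> w = v}" "card {w \<in> verts Y. vmap \<pi> w = v} = d"
proof -
  have "Vertex v \<in> topspace (realization X)" unfolding topX using v by (simp add: points_def)
  then have f: "finite {y \<in> points Y. proj y = Vertex v}" "card {y \<in> points Y. proj y = Vertex v} = d"
    using d unfolding has_cover_degree_def topY by blast+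
  have e: "{y \<in> points Y. proj y = Vertex v} = (Vertex ` {w \<in> verts Y. vmap \<pi> w = v} :: ('w, 'f) point set)"
  proof (intro equalityI subsetI)
    fix y :: "('w, 'f) point" assume "y \<in> {y \<in> points Y. proj y = Vertex v}"
    then show "y \<in> Vertex ` {w \<in> verts Y. vmap \<pi> w = v}" using point_over_Vertex[of y v] by blast
  next
    fix y :: "('w, 'f) point" assume "y \<in> Vertex ` {w \<in> verts Y. vmap \<pi> w = v}"
    then obtain w where "w \<in> verts Y" "vmap \<pi> w = v" "y = Vertex w" by blast
    then show "y \<in> {y \<in> points Y. proj y = Vertex v}" by (simp add: points_def)
  qed
  have i: "inj_on (Vertex :: 'w \<Rightarrow> ('w, 'f) point) {w \<in> verts Y. vmap \<pi> w = v}" by (simp add: inj_on_def)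
  show "finite {w \<in> verts Y. vmap \<pi> w = v}" "card {w \<in> verts Y. vmap \<pi> w = v} = d"
    using f finite_imageD[OF _ i] card_image[OF i] unfolding e by auto
qed

end

section \<open>The three-term determinant formula\<close>

text \<open>The weight depends on the row only, so a closed walk collects each of its edges exactly
  once.\<close>

definition edge_matrix :: "('v, 'e) multigraph \<Rightarrow> ('e oedge \<Rightarrow> complex) \<Rightarrow> 'e oedge \<Rightarrow> 'e oedge \<Rightarrow> complex" where
  "edge_matrix X c a b = (if terminal X a = initial X b \<and> b \<noteq> orev a then c a else 0)"

definition twisted_laplacian :: "('v, 'e) multigraph \<Rightarrow> ('e oedge \<Rightarrow> complex) \<Rightarrow> 'v \<Rightarrow> 'v \<Rightarrow> complex" where
  "twisted_laplacian X c v w = (\<Sum>a\<in>out X v. (if v = w then 1 else 0) - (if terminal X a = w then c a else 0))"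

text \<open>The matrix splits into 2 by 2 blocks, one for each edge with its two orientations, each
  of determinant 1 - u^2.\<close>

lemma fdet_reversal:
  fixes c :: "'e oedge \<Rightarrow> complex"
  assumes "finite F" "\<And>e. e \<in> F \<Longrightarrow> c (e, True) * c (e, False) = 1"
  shows "fdet (F \<times> UNIV) (\<lambda>a b. (if a = b then 1 else 0) + u * (if b = orev a then c a else 0)) = (1 - u\<^sup>2) ^ card F"
  using assms
proof (induction F rule: finite_induct)
  case (insert e F)
  let ?M = "\<lambda>a b. (if a = b then 1 else 0) + u * (if b = orev a then c a else 0)"
  have S: "insert e F \<times> UNIV = {(e, True), (e, False)} \<union> F \<times> UNIV" by (auto simp: UNIV_bool)
  have "fdet ({(e, True), (e, False)} \<union> F \<times> UNIV) ?M = fdet {(e, True), (e, False)} ?M * fdet (F \<times> UNIV) ?M"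
    by (rule fdet_block) (use insert.hyps in \<open>auto simp: orev_def\<close>)
  also have "fdet {(e, True), (e, False)} ?M = 1 - u\<^sup>2 * (c (e, True) * c (e, False))"
    by (subst fdet_2) (auto simp: orev_def power2_eq_square algebra_simps)
  finally show ?case using insert by (simp add: S)
qed simp

text \<open>The edge matrix is a product of twisted terminal incidence with initial incidence
  \<open>s\<close>, minus the twisted reversal J. With M = 1 + u J, the matrix 1 - u W factors as M
  (1 - B s). Sylvester's identity moves the second factor to the vertices, where multiplying by 1 -
  u^2 clears the denominator of \<open>B\<close>.\<close>

theorem ihara_bass:
  assumes X: "finite_multigraph X" and c: "\<And>a. a \<in> oedges X \<Longrightarrow> c a * c (orev a) = (1::complex)"
    and u: "1 - u\<^sup>2 \<noteq> (0::complex)"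
  shows "fdet (oedges X) (\<lambda>a b. (if a = b then 1 else 0) - u * edge_matrix X c a b) * (1 - u\<^sup>2) ^ card (verts X) =
    (1 - u\<^sup>2) ^ card (edges X) * fdet (verts X) (\<lambda>v w. (if v = w then 1 - u\<^sup>2 else 0) +
      (\<Sum>a\<in>out X v. (if v = w then u\<^sup>2 else 0) - u * (if terminal X a = w then c a else 0)))"
proof -
  let ?S = "oedges X" and ?V = "verts X"
  have S: "finite ?S" by (rule finite_oedges[OF X])
  have V: "finite ?V" and E: "finite (edges X)" using X by (auto simp: finite_multigraph_def)
  let ?d = "\<lambda>i j. if i = j then 1 else 0 :: complex"
  define M where "M a b = ?d a b + u * (if b = orev a then c a else 0)" for a b
  \<comment> \<open>\<open>B\<close> is u times the inverse of \<open>M\<close> applied to twisted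
    terminal incidence. The twisted reversal J squares to one, so that inverse is (1 - u J) / (1 -
    u^2), and J carries terminal to initial incidence.\<close>
  define B where "B a w = u * ((if terminal X a = w then c a else 0) - u * (if initial X a = w then 1 else 0)) / (1 - u\<^sup>2)" for a w
  define s where "s v a = (if initial X a = v then 1 else 0 :: complex)" for v a
  have Bs: "(\<Sum>v\<in>?V. B k v * s v b) = B k (initial X b)" if "b \<in> ?S" for k b
    using initial_in[OF X that] V by (simp add: s_def mult_delta_right)
  have prod: "(\<Sum>k\<in>?S. M a k * (?d k b - (\<Sum>v\<in>?V. B k v * s v b))) = ?d a b - u * edge_matrix X c a b"
    if a: "a \<in> ?S" and b: "b \<in> ?S" for a b
  proof -
    have p1: "(\<Sum>k\<in>?S. M a k * (?d k b - (\<Sum>v\<in>?V. B k v * s v b))) =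
      (\<Sum>k\<in>?S. (if a = k then ?d k b - B k (initial X b) else 0) + (if k = orev a then u * c a * (?d k b - B k (initial X b)) else 0))"
      by (rule sum.cong) (auto simp: M_def Bs[OF b] algebra_simps)
    have p2: "\<dots> = (?d a b - B a (initial X b)) + u * c a * (?d (orev a) b - B (orev a) (initial X b))"
      using a S by (simp add: sum.distrib)
    have "B a (initial X b) + u * c a * B (orev a) (initial X b) = u * (if terminal X a = initial X b then c a else 0)"
    proof -
      have "B a w + u * c a * B (orev a) w = u * (if terminal X a = w then c a else 0)" for w
      proof -
        let ?t = "if terminal X a = w then 1 else 0 :: complex" and ?i = "if initial X a = w then 1 else 0 :: complex"
        have B1: "B a w = u * (c a * ?t - u * ?i) / (1 - u\<^sup>2)" by (simp add: B_def)
        have B2: "B (orev a) w = u * (c (orev a) * ?i - u * ?t) / (1 - u\<^sup>2)" by (simp add: B_def)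
        have "B a w + u * c a * B (orev a) w = (u * (c a * ?t - u * ?i) + u * c a * (u * (c (orev a) * ?i - u * ?t))) / (1 - u\<^sup>2)"
          unfolding B1 B2 by (simp add: add_divide_distrib)
        also have "u * (c a * ?t - u * ?i) + u * c a * (u * (c (orev a) * ?i - u * ?t)) =
            u * (c a * ?t) * (1 - u\<^sup>2) + u * u * ?i * (c a * c (orev a) - 1)"
          by (simp add: algebra_simps power2_eq_square)
        also have "\<dots> / (1 - u\<^sup>2) = u * (c a * ?t)" using c[OF a] u by simp
        finally show ?thesis by simp
      qed
      then show ?thesis .
    qed
    then have p3: "(?d a b - B a (initial X b)) + u * c a * (?d (orev a) b - B (orev a) (initial X b)) =
       ?d a b + u * c a * ?d (orev a) b - u * (if terminal X a = initial X b then c a else 0)"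
      by (simp add: algebra_simps)
    have p4: "\<dots> = ?d a b - u * edge_matrix X c a b"
      by (auto simp: edge_matrix_def)
    show ?thesis unfolding p1 p2 p3 p4 ..
  qed
  have "fdet ?S (\<lambda>a b. ?d a b - u * edge_matrix X c a b) = fdet ?S (\<lambda>a b. \<Sum>k\<in>?S. M a k * (?d k b - (\<Sum>v\<in>?V. B k v * s v b)))"
    by (rule fdet_cong) (simp_all add: prod)
  also have "\<dots> = fdet ?S M * fdet ?S (\<lambda>k b. ?d k b - (\<Sum>v\<in>?V. B k v * s v b))"
    by (rule fdet_mult[OF S])
  also have "fdet ?S M = (1 - u\<^sup>2) ^ card (edges X)"
  proof -
    have "c (e, True) * c (e, False) = 1" if "e \<in> edges X" for e
      using c[of "(e, True)"] that by (simp add: oedges_def orev_def)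
    from fdet_reversal[OF E this, of u] show ?thesis
      unfolding M_def oedges_def by simp
  qed
  also have "fdet ?S (\<lambda>k b. ?d k b - (\<Sum>v\<in>?V. B k v * s v b)) = fdet ?V (\<lambda>v w. ?d v w - (\<Sum>a\<in>?S. s v a * B a w))"
    by (rule fdet_sylvester[OF S V])
  finally have 1: "fdet ?S (\<lambda>a b. ?d a b - u * edge_matrix X c a b) =
    (1 - u\<^sup>2) ^ card (edges X) * fdet ?V (\<lambda>v w. ?d v w - (\<Sum>a\<in>?S. s v a * B a w))" .
  have "fdet ?V (\<lambda>v w. ?d v w - (\<Sum>a\<in>?S. s v a * B a w)) * (1 - u\<^sup>2) ^ card ?V =
     fdet ?V (\<lambda>v w. (1 - u\<^sup>2) * (?d v w - (\<Sum>a\<in>?S. s v a * B a w)))"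
    by (simp add: fdet_scale[OF V] mult.commute)
  also have "\<dots> = fdet ?V (\<lambda>v w. (if v = w then 1 - u\<^sup>2 else 0) +
      (\<Sum>a\<in>out X v. (if v = w then u\<^sup>2 else 0) - u * (if terminal X a = w then c a else 0)))"
  proof (rule fdet_cong[OF refl])
    fix v w
    have "(\<Sum>a\<in>?S. s v a * B a w) = (\<Sum>a\<in>out X v. B a w)"
      unfolding out_def s_def sum.inter_filter[OF S] by (rule sum.cong) simp_all
    then have "(1 - u\<^sup>2) * (?d v w - (\<Sum>a\<in>?S. s v a * B a w)) = (if v = w then 1 - u\<^sup>2 else 0) + (\<Sum>a\<in>out X v. - ((1 - u\<^sup>2) * B a w))"
      by (simp add: right_diff_distrib sum_distrib_left sum_negf)
    also have "(\<Sum>a\<in>out X v. - ((1 - u\<^sup>2) * B a w)) = (\<Sum>a\<in>out X v. (if v = w then u\<^sup>2 else 0) - u * (if terminal X a = w then c a else 0))"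
    proof (rule sum.cong[OF refl])
      fix a assume "a \<in> out X v"
      then have av: "initial X a = v" by (simp add: out_def)
      have e: "(1 - u\<^sup>2) * B a w = u * ((if terminal X a = w then c a else 0) - u * (if initial X a = w then 1 else 0))"
        using u unfolding B_def by simp
      show "- ((1 - u\<^sup>2) * B a w) = (if v = w then u\<^sup>2 else 0) - u * (if terminal X a = w then c a else 0)"
        unfolding e av by (simp add: power2_eq_square algebra_simps)
    qed
    finally show "(1 - u\<^sup>2) * (?d v w - (\<Sum>a\<in>?S. s v a * B a w)) = (if v = w then 1 - u\<^sup>2 else 0) +
      (\<Sum>a\<in>out X v. (if v = w then u\<^sup>2 else 0) - u * (if terminal X a = w then c a else 0))" .
  qed
  finally show ?thesis unfolding 1 by (simp add: mult_ac)
qed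

text \<open>Taking the determinant over polynomials allows Bass's identity, available only where u^2
  differs from 1, to be extended to u = 1.\<close>

definition edge_poly :: "('v, 'e) multigraph \<Rightarrow> ('e oedge \<Rightarrow> complex) \<Rightarrow> complex poly" where
  "edge_poly X c = fdet (oedges X) (\<lambda>a b. (if a = b then 1 else 0) - [:0, edge_matrix X c a b:])"

lemma poly_edge_poly:
  "poly (edge_poly X c) u = fdet (oedges X) (\<lambda>a b. (if a = b then 1 else 0) - u * edge_matrix X c a b)"
  unfolding edge_poly_def poly_fdet by (rule fdet_cong) auto

lemma least_coeff_monom_mult:
  assumes "coeff H 0 \<noteq> (0::complex)"
  shows "coeff (monom 1 m * H) (LEAST k. coeff (monom 1 m * H) k \<noteq> 0) = coeff H 0"
proof -
  have c: "coeff (monom 1 m * H) k = (if k < m then 0 else coeff H (k - m))" for k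
    by (simp add: coeff_monom_mult)
  have "(LEAST k. coeff (monom 1 m * H) k \<noteq> 0) = m"
  proof (rule Least_equality)
    show "coeff (monom 1 m * H) m \<noteq> 0" unfolding c using assms by simp
    fix k assume "coeff (monom 1 m * H) k \<noteq> 0"
    then show "m \<le> k" unfolding c by (cases "k < m") auto
  qed
  then show ?thesis unfolding c by simp
qed

text \<open>Bass's identity holds off the roots of \<open>q\<close>, hence as an identity of
  polynomials in which powers of \<open>q\<close> can be cancelled. If |V| exceeded |E|, then
  \<open>q\<close> would divide \<open>R\<close>, contradicting its nonzero value at 1.\<close>

theorem leading_coeff_edge_poly:
  assumes X: "finite_multigraph X" and c: "\<And>a. a \<in> oedges X \<Longrightarrow> c a * c (orev a) = (1::complex)"
    and nz: "fdet (verts X) (twisted_laplacian X c) \<noteq> 0"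
  shows "card (verts X) \<le> card (edges X)"
    and "let Q = pcompose (edge_poly X c) [:1, 1:] in coeff Q (LEAST k. coeff Q k \<noteq> 0) =
      (-2) ^ (card (edges X) - card (verts X)) * fdet (verts X) (twisted_laplacian X c)"
proof -
  let ?nV = "card (verts X)" and ?nE = "card (edges X)"
  define q :: "complex poly" where "q = [:1, 0, -1:]"
  have q: "poly q u = 1 - u\<^sup>2" for u by (simp add: q_def power2_eq_square)
  have q0: "q \<noteq> 0" by (simp add: q_def)
  define R :: "complex poly" where "R = fdet (verts X) (\<lambda>v w. (if v = w then q else 0) +
      (\<Sum>a\<in>out X v. (if v = w then [:0, 0, 1:] else 0) - [:0, if terminal X a = w then c a else 0:]))"
  have R: "poly R u = fdet (verts X) (\<lambda>v w. (if v = w then 1 - u\<^sup>2 else 0) +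
      (\<Sum>a\<in>out X v. (if v = w then u\<^sup>2 else 0) - u * (if terminal X a = w then c a else 0)))" for u
    unfolding R_def poly_fdet
    by (intro fdet_cong refl arg_cong2[of _ _ _ _ "(+)"]) (auto simp: q poly_sum power2_eq_square intro!: sum.cong)
  have R1: "poly R 1 = fdet (verts X) (twisted_laplacian X c)"
    unfolding R by (rule fdet_cong) (auto simp: twisted_laplacian_def)
  have eq: "edge_poly X c * q ^ ?nV = q ^ ?nE * R"
  proof -
    let ?P = "edge_poly X c * q ^ ?nV - q ^ ?nE * R"
    have "{u. poly ?P u \<noteq> 0} \<subseteq> {u. poly q u = 0}"
    proof (rule subsetI, rule ccontr)
      fix u assume h: "u \<in> {u. poly ?P u \<noteq> 0}" "u \<notin> {u. poly q u = 0}"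
      then have "1 - u\<^sup>2 \<noteq> 0" by (simp add: q)
      from ihara_bass[where c = c, OF X c this] have "poly ?P u = 0"
        by (simp add: poly_edge_poly q R poly_power)
      then show False using h(1) by simp
    qed
    then have "- {u. poly ?P u = 0} \<subseteq> {u. poly q u = 0}" by auto
    moreover have "finite {u. poly q u = 0}" using q0 by (rule poly_roots_finite)
    ultimately have "finite (- {u. poly ?P u = 0})" using finite_subset by blast
    then have "infinite {u. poly ?P u = 0}"
      by (metis Compl_partition2 finite_UnI infinite_UNIV_char_0)
    then have "?P = 0" using poly_roots_finite by blast
    then show ?thesis by simp
  qed
  show le: "?nV \<le> ?nE"
  proof (rule ccontr)
    assume "\<not> ?nV \<le> ?nE"
    then have "?nV = ?nE + Suc (?nV - ?nE - 1)" by simp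
    then have "q ^ ?nV = q ^ ?nE * q ^ Suc (?nV - ?nE - 1)" by (metis power_add)
    then have "q ^ ?nE * (edge_poly X c * q ^ Suc (?nV - ?nE - 1)) = q ^ ?nE * R" using eq by (simp add: mult_ac)
    then have "edge_poly X c * q ^ Suc (?nV - ?nE - 1) = R" using q0 by simp
    then have "poly R 1 = 0" by (auto simp: q poly_power)
    then show False using R1 nz by simp
  qed
  let ?m = "?nE - ?nV"
  have "q ^ ?nE = q ^ ?nV * q ^ ?m" using le by (simp flip: power_add)
  then have "q ^ ?nV * edge_poly X c = q ^ ?nV * (q ^ ?m * R)" using eq by (simp add: mult_ac)
  then have Q: "edge_poly X c = q ^ ?m * R" using q0 by simp
  define H where "H = [:-2, -1:] ^ ?m * pcompose R [:1, 1:]"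
  \<comment> \<open>Each factor \<open>q\<close> vanishes to order exactly one at u = 1, with
    leading coefficient -2.\<close>
  have "pcompose q [:1, 1:] = [:0, 1:] * [:-2, -1:]" by (simp add: q_def pcompose_pCons)
  then have "pcompose (edge_poly X c) [:1, 1:] = monom 1 ?m * H"
    unfolding Q H_def by (simp add: pcompose_mult pcompose_hom.hom_power power_mult_distrib monom_altdef mult.assoc del: mult_pCons_left mult_pCons_right)
  moreover have "coeff H 0 = (-2) ^ ?m * fdet (verts X) (twisted_laplacian X c)"
    using R1 by (simp add: H_def poly_0_coeff_0[symmetric] poly_power poly_pcompose)
  moreover have "coeff H 0 \<noteq> 0" using calculation(2) nz by simp
  ultimately show "let Q = pcompose (edge_poly X c) [:1, 1:] in coeff Q (LEAST k. coeff Q k \<noteq> 0) =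
      (-2) ^ ?m * fdet (verts X) (twisted_laplacian X c)"
    using least_coeff_monom_mult[of H ?m] by (simp add: Let_def)
qed

section \<open>Group determinants and twisted Laplacians\<close>

text \<open>The matrix of characters \<open>F\<close> satisfies M F = F D with \<open>D\<close>
  block diagonal, and character orthogonality makes \<open>F\<close> invertible. The bijection
  \<open>\<beta>\<close> labels characters by group elements, so that \<open>F\<close> is square
  over a single index set.\<close>

theorem (in comm_group) group_determinant:
  fixes f :: "'a \<Rightarrow> 'v \<Rightarrow> 'v \<Rightarrow> complex"
  assumes fin: "finite (carrier G)" and V: "finite V"
  shows "fdet (carrier G \<times> V) (\<lambda>p q. f (inv (fst p) \<otimes> fst q) (snd p) (snd q)) =
    (\<Prod>\<psi>\<in>characters G. fdet V (\<lambda>v w. \<Sum>k\<in>carrier G. f k v w * \<psi> k))"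
proof -
  let ?n = "of_nat (card (carrier G)) :: complex"
  obtain \<beta> where \<beta>: "bij_betw \<beta> (carrier G) (characters G)"
    using finite_same_card_bij[OF fin finite_characters[OF fin]] card_characters[OF fin] by metis
  have \<beta>c: "\<beta> k \<in> characters G" if "k \<in> carrier G" for k using \<beta> that by (auto simp: bij_betw_def)
  let ?S = "carrier G \<times> V"
  have S: "finite ?S" using fin V by simp
  have n0: "?n \<noteq> 0" using fin one_closed by auto
  define L where "L k v w = (\<Sum>g\<in>carrier G. f g v w * \<beta> k g)" for k v w
  define M where "M p q = f (inv (fst p) \<otimes> fst q) (snd p) (snd q)" for p q
  define F where "F p q = (if snd p = snd q then \<beta> (fst q) (fst p) else 0)" for p q :: "'a \<times> 'v"
  define F' where "F' p q = (if snd p = snd q then cnj (\<beta> (fst p) (fst q)) else 0)" for p q :: "'a \<times> 'v"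
  define D where "D p q = (if fst p = fst q then L (fst p) (snd p) (snd q) else 0)" for p q
  have sumS: "(\<Sum>p\<in>?S. h p) = (\<Sum>g\<in>carrier G. \<Sum>v\<in>V. h (g, v))" for h :: "_ \<Rightarrow> complex"
    by (simp add: sum.cartesian_product case_prod_unfold)
  have FF: "(\<Sum>r\<in>?S. F p r * F' r q) = (if p = q then ?n else 0)" if pq: "p \<in> ?S" "q \<in> ?S" for p q
  proof -
    obtain g v h w where e: "p = (g, v)" "q = (h, w)" and m: "g \<in> carrier G" "v \<in> V" "h \<in> carrier G" "w \<in> V"
      using pq by auto
    have "(\<Sum>r\<in>?S. F p r * F' r q) = (\<Sum>k\<in>carrier G. \<Sum>v'\<in>V. if v = v' then (if v = w then \<beta> k g * cnj (\<beta> k h) else 0) else 0)"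
      unfolding sumS e F_def F'_def by (intro sum.cong refl) simp
    also have "\<dots> = (\<Sum>k\<in>carrier G. if v = w then \<beta> k g * cnj (\<beta> k h) else 0)"
      using V m by simp
    also have "\<dots> = (\<Sum>k\<in>carrier G. if v = w then \<beta> k (g \<otimes> inv h) else 0)"
      using m by (intro sum.cong refl) (simp add: character_mult[OF \<beta>c] character_inv[OF fin \<beta>c])
    also have "\<dots> = (if v = w then (\<Sum>k\<in>carrier G. \<beta> k (g \<otimes> inv h)) else 0)" by simp
    also have "(\<Sum>k\<in>carrier G. \<beta> k (g \<otimes> inv h)) = (\<Sum>\<psi>\<in>characters G. \<psi> (g \<otimes> inv h))"
      by (rule sum.reindex_bij_betw[OF \<beta>, of "\<lambda>\<psi>. \<psi> (g \<otimes> inv h)"])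
    also have "\<dots> = (if g = h then ?n else 0)"
    proof -
      have "g \<otimes> inv h = \<one> \<longleftrightarrow> g = h" using m by (metis inv_closed inv_equality inv_inv r_inv)
      then show ?thesis using sum_over_characters[OF fin, of "g \<otimes> inv h"] m by simp
    qed
    finally show ?thesis by (simp add: e)
  qed
  have "fdet ?S F * fdet ?S F' = fdet ?S (\<lambda>p q. if p = q then ?n else 0)"
    unfolding fdet_mult[OF S, symmetric] by (rule fdet_cong[OF refl]) (rule FF)
  also have "\<dots> = ?n ^ card ?S" by (subst fdet_diag[OF S]) auto
  finally have F0: "fdet ?S F \<noteq> 0" using n0 by auto
  have MF: "(\<Sum>r\<in>?S. M p r * F r q) = (\<Sum>r\<in>?S. F p r * D r q)" if pq: "p \<in> ?S" "q \<in> ?S" for p q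
  proof -
    obtain g v k w where e: "p = (g, v)" "q = (k, w)" and m: "g \<in> carrier G" "v \<in> V" "k \<in> carrier G" "w \<in> V"
      using pq by auto
    have "(\<Sum>r\<in>?S. M p r * F r q) = (\<Sum>h\<in>carrier G. \<Sum>v'\<in>V. if v' = w then f (inv g \<otimes> h) v w * \<beta> k h else 0)"
      unfolding sumS e M_def F_def by (intro sum.cong refl) simp
    also have "\<dots> = (\<Sum>h\<in>carrier G. f (inv g \<otimes> h) v w * \<beta> k h)" using V m by simp
    also have "\<dots> = (\<Sum>h\<in>carrier G. f h v w * \<beta> k (g \<otimes> h))"
      by (rule sum.reindex_bij_witness[of _ "\<lambda>h. g \<otimes> h" "\<lambda>h. inv g \<otimes> h"]) (use m in \<open>auto simp: m_assoc[symmetric]\<close>)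
    also have "\<dots> = \<beta> k g * L k v w"
      unfolding L_def sum_distrib_left
      by (rule sum.cong) (use m in \<open>auto simp: character_mult[OF \<beta>c]\<close>)
    finally have 1: "(\<Sum>r\<in>?S. M p r * F r q) = \<beta> k g * L k v w" .
    have "(\<Sum>r\<in>?S. F p r * D r q) = (\<Sum>k'\<in>carrier G. \<Sum>v'\<in>V. if v = v' then (if k' = k then \<beta> k g * L k v w else 0) else 0)"
      unfolding sumS e D_def F_def by (intro sum.cong refl) simp
    also have "\<dots> = \<beta> k g * L k v w" using V fin m by simp
    finally show ?thesis using 1 by simp
  qed
  have "fdet ?S M * fdet ?S F = fdet ?S F * fdet ?S D"
    unfolding fdet_mult[OF S, symmetric] by (rule fdet_cong[OF refl]) (rule MF)
  then have "fdet ?S M = fdet ?S D" using F0 by simp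
  also have "\<dots> = (\<Prod>k\<in>carrier G. fdet V (L k))"
    unfolding D_def by (rule fdet_block_diagonal[OF fin V])
  also have "\<dots> = (\<Prod>\<psi>\<in>characters G. fdet V (\<lambda>v w. \<Sum>g\<in>carrier G. f g v w * \<psi> g))"
    unfolding L_def by (rule prod.reindex_bij_betw[OF \<beta>])
  finally show ?thesis unfolding M_def .
qed

text \<open>Only existence is recorded, because in \<open>DERIV_prod_zero_factor\<close> this
  derivative is multiplied by the vanishing factor.\<close>

lemma DERIV_prod_exists:
  fixes f :: "'i \<Rightarrow> complex \<Rightarrow> complex"
  assumes "finite I" "\<And>i. i \<in> I \<Longrightarrow> \<exists>D. (f i has_field_derivative D) (at x)"
  shows "\<exists>D. ((\<lambda>t. \<Prod>i\<in>I. f i t) has_field_derivative D) (at x)"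
  using assms
proof (induction I rule: finite_induct)
  case (insert i I)
  obtain D where D: "((\<lambda>t. \<Prod>i\<in>I. f i t) has_field_derivative D) (at x)" using insert by blast
  obtain E where E: "(f i has_field_derivative E) (at x)" using insert.prems by blast
  from DERIV_mult[OF E D] show ?case using insert.hyps by auto
next
  case empty
  have "((\<lambda>t. \<Prod>i\<in>{}. f i t) has_field_derivative 0) (at x)" by simp
  then show ?case by (rule exI)
qed

lemma DERIV_prod_zero_factor:
  fixes f :: "'i \<Rightarrow> complex \<Rightarrow> complex"
  assumes I: "finite I" "i \<in> I" and D: "\<And>j. j \<in> I \<Longrightarrow> (f j has_field_derivative D j) (at x)" and z: "f i x = 0"
  shows "((\<lambda>t. \<Prod>j\<in>I. f j t) has_field_derivative (D i * (\<Prod>j\<in>I - {i}. f j x))) (at x)"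
proof -
  obtain E where E: "((\<lambda>t. \<Prod>j\<in>I - {i}. f j t) has_field_derivative E) (at x)"
    using DERIV_prod_exists[of "I - {i}" f x] I(1) D by blast
  have "((\<lambda>t. f i t * (\<Prod>j\<in>I - {i}. f j t)) has_field_derivative (D i * (\<Prod>j\<in>I - {i}. f j x) + E * f i x)) (at x)"
    by (rule DERIV_mult[OF D[OF I(2)] E])
  moreover have "(\<lambda>t. f i t * (\<Prod>j\<in>I - {i}. f j t)) = (\<lambda>t. \<Prod>j\<in>I. f j t)"
    using prod.remove[OF I] by metis
  ultimately show ?thesis using z by simp
qed

lemma laplacian_eq_twisted: "laplacian X = twisted_laplacian X (\<lambda>_. 1)"
  by (simp add: fun_eq_iff laplacian_def twisted_laplacian_def)

lemma twisted_laplacian_cong: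
  "(\<And>a. a \<in> oedges X \<Longrightarrow> c a = c' a) \<Longrightarrow> twisted_laplacian X c = twisted_laplacian X c'"
  by (auto simp: fun_eq_iff twisted_laplacian_def out_def intro!: sum.cong)

lemma sum_principal_minors:
  assumes X: "finite_multigraph X"
  shows "(\<Sum>s\<in>verts X. fdet (verts X - {s}) (laplacian X)) = of_nat (card (verts X) * num_spanning_trees X)"
  using matrix_tree[OF X] by simp

section \<open>Voltages and the Laplacian of the cover\<close>

locale abelian_graph_cover = graph_cover X Y \<pi>
  for X :: "('v, 'e) multigraph" and Y :: "('w, 'f) multigraph" and \<pi> :: "('w, 'f, 'v, 'e) multigraph_map" +
  fixes d :: nat
  assumes connX: "connected_multigraph X" and connY: "connected_multigraph Y"
    and ab: "abelian_cover Y X \<pi>" and deg: "has_cover_degree Y X \<pi> d"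
begin

abbreviation (input) G where "G \<equiv> deck_group Y X \<pi>"

sublocale G: comm_group "deck_group Y X \<pi>"
  using ab by (simp add: abelian_cover_def)

lemma act_in: "g \<in> carrier G \<Longrightarrow> w \<in> verts Y \<Longrightarrow> act g w \<in> verts Y"
  and vmap_act: "g \<in> carrier G \<Longrightarrow> w \<in> verts Y \<Longrightarrow> vmap \<pi> (act g w) = vmap \<pi> w"
  using deck_Vertex by (auto simp: deck_def)

lemma act_mult: "g \<in> carrier G \<Longrightarrow> h \<in> carrier G \<Longrightarrow> w \<in> verts Y \<Longrightarrow> act (g \<otimes>\<^bsub>G\<^esub> h) w = act g (act h w)"
  using deck_mult by (simp add: deck_def)

lemma act_free:
  assumes "g \<in> carrier G" "h \<in> carrier G" "w \<in> verts Y" "act g w = act h w"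
  shows "g = h"
proof -
  let ?k = "inv\<^bsub>G\<^esub> h \<otimes>\<^bsub>G\<^esub> g"
  have "act ?k w = act (inv\<^bsub>G\<^esub> h) (act h w)" using assms by (simp add: act_mult)
  also have "\<dots> = act (inv\<^bsub>G\<^esub> h \<otimes>\<^bsub>G\<^esub> h) w"
    by (rule act_mult[OF G.inv_closed[OF assms(2)] assms(2,3), symmetric])
  also have "\<dots> = w" using assms by (simp add: act_one)
  finally have "?k = \<one>\<^bsub>G\<^esub>"
    using deck_fixed_vertex_one[of ?k, OF _ connY assms(3)] assms(1,2) by (simp add: deck_def deck_one)
  then show ?thesis using assms(1,2) by (metis G.inv_closed G.inv_equality G.inv_inv)
qed

lemma act_transitive:
  assumes "w \<in> verts Y" "w' \<in> verts Y" "vmap \<pi> w = vmap \<pi> w'"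
  shows "\<exists>g\<in>carrier G. act g w = w'"
  using galois_transitive[OF _ assms] ab by (auto simp: abelian_cover_def deck_def)

lemma orbit_bij:
  assumes "w \<in> verts Y"
  shows "bij_betw (\<lambda>g. act g w) (carrier G) {w' \<in> verts Y. vmap \<pi> w' = vmap \<pi> w}"
proof (rule bij_betw_imageI)
  show "inj_on (\<lambda>g. act g w) (carrier G)" using act_free assms by (auto simp: inj_on_def)
  show "(\<lambda>g. act g w) ` carrier G = {w' \<in> verts Y. vmap \<pi> w' = vmap \<pi> w}"
  proof (intro equalityI subsetI)
    fix w' assume "w' \<in> (\<lambda>g. act g w) ` carrier G"
    then show "w' \<in> {w' \<in> verts Y. vmap \<pi> w' = vmap \<pi> w}" using act_in vmap_act assms by auto
  next
    fix w' assume "w' \<in> {w' \<in> verts Y. vmap \<pi> w' = vmap \<pi> w}"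
    then show "w' \<in> (\<lambda>g. act g w) ` carrier G" using act_transitive[OF assms, of w'] by auto
  qed
qed

lemma nonempty: "verts X \<noteq> {}" "verts Y \<noteq> {}"
  using connX connY by (auto simp: connected_multigraph_def)

lemma finite_verts: "finite (verts X)" "finite (verts Y)"
  using finX finY by (auto simp: finite_multigraph_def)

lemma finite_G: "finite (carrier G)" and card_G: "card (carrier G) = d"
proof -
  obtain w where w: "w \<in> verts Y" using nonempty by blast
  have f: "finite {w' \<in> verts Y. vmap \<pi> w' = vmap \<pi> w}" "card {w' \<in> verts Y. vmap \<pi> w' = vmap \<pi> w} = d"
    using fibre_card[OF deg vmap_in[OF w]] by auto
  show "finite (carrier G)" using bij_betw_finite[OF orbit_bij[OF w]] f(1) by simp
  show "card (carrier G) = d" using bij_betw_same_card[OF orbit_bij[OF w]] f(2) by simp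
qed

definition sec :: "'v \<Rightarrow> 'w" where
  "sec v = (SOME w. w \<in> verts Y \<and> vmap \<pi> w = v)"

lemma sec: "v \<in> verts X \<Longrightarrow> sec v \<in> verts Y" "v \<in> verts X \<Longrightarrow> vmap \<pi> (sec v) = v"
  using someI_ex[of "\<lambda>w. w \<in> verts Y \<and> vmap \<pi> w = v"] vmap_surj[of v] unfolding sec_def by blast+

lemma coord_exists:
  assumes "w \<in> verts Y"
  shows "\<exists>g\<in>carrier G. w = act g (sec (vmap \<pi> w))"
  using act_transitive[of "sec (vmap \<pi> w)" w] sec[OF vmap_in[OF assms]] assms by metis

lemma coord_unique:
  assumes "g \<in> carrier G" "h \<in> carrier G" "v \<in> verts X" "v' \<in> verts X"
  shows "act g (sec v) = act h (sec v') \<longleftrightarrow> g = h \<and> v = v'"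
proof
  assume e: "act g (sec v) = act h (sec v')"
  then have "v = v'" using vmap_act[of g "sec v"] vmap_act[of h "sec v'"] assms sec by metis
  then show "g = h \<and> v = v'" using act_free[of g h "sec v"] e assms sec by simp
qed simp

lemma coord_bij: "bij_betw (\<lambda>(g, v). act g (sec v)) (carrier G \<times> verts X) (verts Y)"
proof (rule bij_betw_imageI)
  show "inj_on (\<lambda>(g, v). act g (sec v)) (carrier G \<times> verts X)"
    using coord_unique by (auto simp: inj_on_def)
  show "(\<lambda>(g, v). act g (sec v)) ` (carrier G \<times> verts X) = verts Y"
  proof (intro equalityI subsetI)
    fix w assume "w \<in> (\<lambda>(g, v). act g (sec v)) ` (carrier G \<times> verts X)"
    then show "w \<in> verts Y" using act_in sec by auto
  next
    fix w assume w: "w \<in> verts Y"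
    then obtain g where "g \<in> carrier G" "w = act g (sec (vmap \<pi> w))" using coord_exists by blast
    then show "w \<in> (\<lambda>(g, v). act g (sec v)) ` (carrier G \<times> verts X)"
      using vmap_in[OF w] by (intro image_eqI[of _ _ "(g, vmap \<pi> w)"]) auto
  qed
qed

lemma card_verts_Y: "card (verts Y) = d * card (verts X)"
  using bij_betw_same_card[OF coord_bij] card_G by (simp add: card_cartesian_product)

text \<open>The lift of \<open>a\<close> that starts on the section ends on the translate of the section by \<open>volt a\<close>:
  these voltages on \<open>X\<close> encode the cover \<open>Y\<close> and its Frobenius automorphisms.\<close>

definition volt :: "'e oedge \<Rightarrow> (('w, 'f) point \<Rightarrow> ('w, 'f) point)" where
  "volt a = (SOME g. g \<in> carrier G \<and> (\<exists>b\<in>oedges Y. emap \<pi> b = a \<and> initial Y b = sec (initial X a) \<and>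
     terminal Y b = act g (sec (terminal X a))))"

lemma volt_aux:
  assumes a: "a \<in> oedges X"
  shows "volt a \<in> carrier G \<and> (\<exists>b\<in>oedges Y. emap \<pi> b = a \<and> initial Y b = sec (initial X a) \<and>
     terminal Y b = act (volt a) (sec (terminal X a)))"
proof -
  have v: "initial X a \<in> verts X" by (rule initial_in[OF finX a])
  obtain b where b: "b \<in> oedges Y" "initial Y b = sec (initial X a)" "emap \<pi> b = a"
    using lift_exists[OF sec(1)[OF v] a] sec(2)[OF v] by auto
  obtain g where "g \<in> carrier G" "terminal Y b = act g (sec (terminal X a))"
    using coord_exists[OF terminal_in[OF finY b(1)]] terminal_emap[OF b(1)] b(3) by auto
  then have "\<exists>g. g \<in> carrier G \<and> (\<exists>b\<in>oedges Y. emap \<pi> b = a \<and> initial Y b = sec (initial X a) \<and>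
     terminal Y b = act g (sec (terminal X a)))" using b by blast
  then show ?thesis unfolding volt_def by (rule someI_ex)
qed

lemma volt_in: "a \<in> oedges X \<Longrightarrow> volt a \<in> carrier G"
  using volt_aux by blast

text \<open>The translate by \<open>g\<close> of the lift that starts on the section has the same
  initial vertex and image as \<open>b\<close>, so it is \<open>b\<close>.\<close>

lemma terminal_volt:
  assumes b: "b \<in> oedges Y" and g: "g \<in> carrier G" and i: "initial Y b = act g (sec (initial X (emap \<pi> b)))"
  shows "terminal Y b = act (g \<otimes>\<^bsub>G\<^esub> volt (emap \<pi> b)) (sec (terminal X (emap \<pi> b)))"
proof -
  let ?a = "emap \<pi> b"
  have a: "?a \<in> oedges X" by (rule emap_in[OF b])
  obtain b0 where b0: "b0 \<in> oedges Y" "emap \<pi> b0 = ?a" "initial Y b0 = sec (initial X ?a)"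
     "terminal Y b0 = act (volt ?a) (sec (terminal X ?a))" using volt_aux[OF a] by blast
  have "deck g" using g by (simp add: deck_def)
  from deck_edge[OF this b0(1)] obtain c where c: "c \<in> oedges Y" "emap \<pi> c = emap \<pi> b0"
    "initial Y c = act g (initial Y b0)" "terminal Y c = act g (terminal Y b0)" by blast
  have "c = b" using lift_unique[OF c(1) b] c b0 i by simp
  then show ?thesis
    using c(4) b0(4) act_mult[OF g volt_in[OF a] sec(1)[OF terminal_in[OF finX a]]] by simp
qed

lemma volt_orev:
  assumes a: "a \<in> oedges X"
  shows "volt a \<otimes>\<^bsub>G\<^esub> volt (orev a) = \<one>\<^bsub>G\<^esub>"
proof -
  obtain b where b: "b \<in> oedges Y" "emap \<pi> b = a" "initial Y b = sec (initial X a)"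
     "terminal Y b = act (volt a) (sec (terminal X a))" using volt_aux[OF a] by blast
  have v: "initial X a \<in> verts X" by (rule initial_in[OF finX a])
  have "terminal Y (orev b) = act (volt a \<otimes>\<^bsub>G\<^esub> volt (orev a)) (sec (initial X a))"
    using terminal_volt[of "orev b" "volt a"] b volt_in[OF a] emap_orev[OF b(1)] by simp
  then have "act (volt a \<otimes>\<^bsub>G\<^esub> volt (orev a)) (sec (initial X a)) = act \<one>\<^bsub>G\<^esub> (sec (initial X a))"
    using b act_one[OF sec(1)[OF v]] by simp
  then show ?thesis using act_free[OF _ _ sec(1)[OF v]] volt_in[OF a] volt_in[of "orev a"] a by simp
qed

lemma out_bij:
  assumes w: "w \<in> verts Y"
  shows "bij_betw (emap \<pi>) (out Y w) (out X (vmap \<pi> w))"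
proof (rule bij_betw_imageI)
  show "inj_on (emap \<pi>) (out Y w)" using lift_unique by (auto simp: inj_on_def out_def)
  show "emap \<pi> ` out Y w = out X (vmap \<pi> w)"
  proof (intro equalityI subsetI)
    fix a assume "a \<in> emap \<pi> ` out Y w"
    then obtain b where "b \<in> oedges Y" "initial Y b = w" "a = emap \<pi> b" unfolding out_def by blast
    then show "a \<in> out X (vmap \<pi> w)" using emap_in initial_emap unfolding out_def by simp
  next
    fix a assume "a \<in> out X (vmap \<pi> w)"
    then have "a \<in> oedges X" "initial X a = vmap \<pi> w" unfolding out_def by auto
    then obtain b where "b \<in> oedges Y" "initial Y b = w" "emap \<pi> b = a" using lift_exists[OF w] by blast
    then show "a \<in> emap \<pi> ` out Y w" unfolding out_def by blast
  qed
qed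

text \<open>Deck transformations multiply coordinates on the left and voltages on the right. Hence
  the entry depends on \<open>g\<close> and \<open>h\<close> only through the quotient of
  \<open>h\<close> by \<open>g\<close>.\<close>

lemma laplacian_Y:
  assumes g: "g \<in> carrier G" and h: "h \<in> carrier G" and v: "v \<in> verts X" and v': "v' \<in> verts X"
  shows "laplacian Y (act g (sec v)) (act h (sec v')) =
    (\<Sum>a\<in>out X v. (if g = h \<and> v = v' then 1 else 0) - (if g \<otimes>\<^bsub>G\<^esub> volt a = h \<and> terminal X a = v' then 1 else 0))"
proof -
  let ?w = "act g (sec v)"
  have w: "?w \<in> verts Y" "vmap \<pi> ?w = v" using act_in vmap_act sec g v by auto
  have "laplacian Y ?w (act h (sec v')) = (\<Sum>b\<in>out Y ?w. (if g = h \<and> v = v' then 1 else 0) -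
      (if g \<otimes>\<^bsub>G\<^esub> volt (emap \<pi> b) = h \<and> terminal X (emap \<pi> b) = v' then 1 else 0))"
    unfolding laplacian_def
  proof (rule sum.cong[OF refl])
    fix b assume "b \<in> out Y ?w"
    then have b: "b \<in> oedges Y" "initial Y b = ?w" by (auto simp: out_def)
    let ?a = "emap \<pi> b"
    have a: "?a \<in> oedges X" by (rule emap_in[OF b(1)])
    have iv: "initial X ?a = v" using initial_emap[OF b(1)] b(2) w(2) by simp
    have "terminal Y b = act (g \<otimes>\<^bsub>G\<^esub> volt ?a) (sec (terminal X ?a))"
      using terminal_volt[OF b(1) g] b(2) iv by simp
    then have "terminal Y b = act h (sec v') \<longleftrightarrow> g \<otimes>\<^bsub>G\<^esub> volt ?a = h \<and> terminal X ?a = v'"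
      using coord_unique[OF G.m_closed[OF g volt_in[OF a]] h terminal_in[OF finX a] v'] by simp
    moreover have "?w = act h (sec v') \<longleftrightarrow> g = h \<and> v = v'" by (rule coord_unique[OF g h v v'])
    ultimately show "(if ?w = act h (sec v') then 1 else 0) - (if terminal Y b = act h (sec v') then 1 else 0) =
      (if g = h \<and> v = v' then 1 else 0) - (if g \<otimes>\<^bsub>G\<^esub> volt ?a = h \<and> terminal X ?a = v' then 1 else (0::complex))" by simp
  qed
  also have "\<dots> = (\<Sum>a\<in>out X v. (if g = h \<and> v = v' then 1 else 0) - (if g \<otimes>\<^bsub>G\<^esub> volt a = h \<and> terminal X a = v' then 1 else 0))"
    using sum.reindex_bij_betw[OF out_bij[OF w(1)], of "\<lambda>a. (if g = h \<and> v = v' then 1 else 0) -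
      (if g \<otimes>\<^bsub>G\<^esub> volt a = h \<and> terminal X a = v' then 1 else (0::complex))"] w(2) by simp
  finally show ?thesis .
qed

abbreviation (input) L :: "((('w, 'f) point \<Rightarrow> ('w, 'f) point) \<Rightarrow> complex) \<Rightarrow> 'v \<Rightarrow> 'v \<Rightarrow> complex" where
  "L \<psi> \<equiv> twisted_laplacian X (\<lambda>a. \<psi> (volt a))"

text \<open>In the coordinates of \<open>coord_bij\<close> this is a block group matrix. Summing its
  symbol \<open>f\<close> against \<psi> collapses at the identity and at the voltages, which gives
  the twisted Laplacian plus t on the diagonal.\<close>

theorem laplacian_Y_factor:
  "fdet (verts Y) (\<lambda>w w'. laplacian Y w w' + (if w = w' then t else 0)) =
    (\<Prod>\<psi>\<in>characters G. fdet (verts X) (\<lambda>v v'. L \<psi> v v' + (if v = v' then t else 0)))"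
proof -
  define f where "f k v v' = (\<Sum>a\<in>out X v. (if k = \<one>\<^bsub>G\<^esub> \<and> v = v' then 1 else 0) - (if k = volt a \<and> terminal X a = v' then 1 else 0)) +
    (if k = \<one>\<^bsub>G\<^esub> \<and> v = v' then t else 0)" for k v v'
  have "fdet (verts Y) (\<lambda>w w'. laplacian Y w w' + (if w = w' then t else 0)) =
    fdet (carrier G \<times> verts X) (\<lambda>p q. f (inv\<^bsub>G\<^esub> (fst p) \<otimes>\<^bsub>G\<^esub> fst q) (snd p) (snd q))"
    unfolding fdet_reindex[OF coord_bij finite_cartesian_product[OF finite_G finite_verts(1)]]
  proof (rule fdet_cong[OF refl])
    fix p q assume "p \<in> carrier G \<times> verts X" "q \<in> carrier G \<times> verts X"
    then obtain g v h v' where pq: "p = (g, v)" "q = (h, v')"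
      and m: "g \<in> carrier G" "v \<in> verts X" "h \<in> carrier G" "v' \<in> verts X" by auto
    have e1: "inv\<^bsub>G\<^esub> g \<otimes>\<^bsub>G\<^esub> h = \<one>\<^bsub>G\<^esub> \<longleftrightarrow> g = h" using m
      by (metis G.inv_closed G.inv_equality G.inv_inv G.l_inv)
    have e2: "inv\<^bsub>G\<^esub> g \<otimes>\<^bsub>G\<^esub> h = volt a \<longleftrightarrow> g \<otimes>\<^bsub>G\<^esub> volt a = h" if "a \<in> out X v" for a
    proof -
      have "volt a \<in> carrier G" using that volt_in by (simp add: out_def)
      then show ?thesis using m G.inv_solve_left[of "volt a" g h] by auto
    qed
    have "laplacian Y (act g (sec v)) (act h (sec v')) = (\<Sum>a\<in>out X v. (if inv\<^bsub>G\<^esub> g \<otimes>\<^bsub>G\<^esub> h = \<one>\<^bsub>G\<^esub> \<and> v = v' then 1 else 0) -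
        (if inv\<^bsub>G\<^esub> g \<otimes>\<^bsub>G\<^esub> h = volt a \<and> terminal X a = v' then 1 else 0))"
      unfolding laplacian_Y[OF m(1,3,2,4)] by (rule sum.cong) (simp_all add: e1 e2)
    then show "laplacian Y (case p of (g, v) \<Rightarrow> act g (sec v)) (case q of (g, v) \<Rightarrow> act g (sec v)) +
       (if (case p of (g, v) \<Rightarrow> act g (sec v)) = (case q of (g, v) \<Rightarrow> act g (sec v)) then t else 0) =
       f (inv\<^bsub>G\<^esub> (fst p) \<otimes>\<^bsub>G\<^esub> fst q) (snd p) (snd q)"
      using coord_unique[OF m(1,3,2,4)] unfolding pq f_def by (simp add: e1)
  qed
  also have "\<dots> = (\<Prod>\<psi>\<in>characters G. fdet (verts X) (\<lambda>v v'. \<Sum>k\<in>carrier G. f k v v' * \<psi> k))"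
    by (rule G.group_determinant[OF finite_G finite_verts(1)])
  also have "\<dots> = (\<Prod>\<psi>\<in>characters G. fdet (verts X) (\<lambda>v v'. L \<psi> v v' + (if v = v' then t else 0)))"
  proof (intro prod.cong refl fdet_cong)
    fix \<psi> v v' assume \<psi>: "\<psi> \<in> characters G" and v: "v \<in> verts X" "v' \<in> verts X"
    have \<psi>1: "\<psi> \<one>\<^bsub>G\<^esub> = 1" by (rule G.character_one[OF \<psi>])
    have "(\<Sum>k\<in>carrier G. f k v v' * \<psi> k) =
      (\<Sum>k\<in>carrier G. \<Sum>a\<in>out X v. (if k = \<one>\<^bsub>G\<^esub> then (if v = v' then \<psi> k else 0) else 0) - (if k = volt a then (if terminal X a = v' then \<psi> k else 0) else 0))
      + (\<Sum>k\<in>carrier G. if k = \<one>\<^bsub>G\<^esub> then (if v = v' then t * \<psi> k else 0) else 0)"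
      unfolding f_def distrib_right sum.distrib sum_distrib_right left_diff_distrib
      by (intro arg_cong2[of _ _ _ _ "(+)"] sum.cong refl arg_cong2[of _ _ _ _ "(-)"]) simp_all
    also have "(\<Sum>k\<in>carrier G. if k = \<one>\<^bsub>G\<^esub> then (if v = v' then t * \<psi> k else 0) else 0) = (if v = v' then t else 0)"
      using finite_G \<psi>1 by simp
    also have "(\<Sum>k\<in>carrier G. \<Sum>a\<in>out X v. (if k = \<one>\<^bsub>G\<^esub> then (if v = v' then \<psi> k else 0) else 0) - (if k = volt a then (if terminal X a = v' then \<psi> k else 0) else 0))
      = (\<Sum>a\<in>out X v. \<Sum>k\<in>carrier G. (if k = \<one>\<^bsub>G\<^esub> then (if v = v' then \<psi> k else 0) else 0) - (if k = volt a then (if terminal X a = v' then \<psi> k else 0) else 0))"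
      by (rule sum.swap)
    also have "\<dots> = L \<psi> v v'"
      unfolding twisted_laplacian_def
    proof (rule sum.cong[OF refl])
      fix a assume "a \<in> out X v"
      then have "volt a \<in> carrier G" using volt_in by (simp add: out_def)
      then show "(\<Sum>k\<in>carrier G. (if k = \<one>\<^bsub>G\<^esub> then (if v = v' then \<psi> k else 0) else 0) - (if k = volt a then (if terminal X a = v' then \<psi> k else 0) else 0))
        = (if v = v' then 1 else 0) - (if terminal X a = v' then \<psi> (volt a) else 0)"
        using finite_G \<psi>1 by (simp add: sum_subtractf)
    qed
    finally show "(\<Sum>k\<in>carrier G. f k v v' * \<psi> k) = L \<psi> v v' + (if v = v' then t else 0)" .
  qed
  finally show ?thesis .
qed

lemma L_trivial: "L (trivial_character G) = laplacian X"
  unfolding laplacian_eq_twisted by (rule twisted_laplacian_cong) (simp add: trivial_character_def volt_in)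

text \<open>Differentiate \<open>laplacian_Y_factor\<close> at t = 0. On the right only the trivial
  factor, which vanishes there, is differentiated; the factor \<open>d\<close> is the ratio of the
  numbers of vertices.\<close>

theorem spanning_trees_ratio:
  "of_nat (d * num_spanning_trees Y) =
    of_nat (num_spanning_trees X) * (\<Prod>\<psi>\<in>characters G - {trivial_character G}. fdet (verts X) (L \<psi>))"
proof -
  let ?\<chi> = "trivial_character G"
  let ?P = "\<lambda>t. \<Prod>\<psi>\<in>characters G. fdet (verts X) (\<lambda>v v'. L \<psi> v v' + (if v = v' then t else 0))"
  have "(?P has_field_derivative ((\<Sum>s\<in>verts X. fdet (verts X - {s}) (L ?\<chi>)) *
      (\<Prod>\<psi>\<in>characters G - {?\<chi>}. fdet (verts X) (\<lambda>v v'. L \<psi> v v' + (if v = v' then 0 else 0))))) (at 0)"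
  proof (rule DERIV_prod_zero_factor[where D = "\<lambda>\<psi>. \<Sum>s\<in>verts X. fdet (verts X - {s}) (L \<psi>)" and
        f = "\<lambda>\<psi> t. fdet (verts X) (\<lambda>v v'. L \<psi> v v' + (if v = v' then t else 0))"])
    show "finite (characters G)" by (rule G.finite_characters[OF finite_G])
    show "?\<chi> \<in> characters G" by (rule G.trivial_character_in)
    show "((\<lambda>t. fdet (verts X) (\<lambda>v v'. L \<psi> v v' + (if v = v' then t else 0))) has_field_derivative
      (\<Sum>s\<in>verts X. fdet (verts X - {s}) (L \<psi>))) (at 0)" for \<psi>
      by (rule DERIV_fdet_add_scalar[OF finite_verts(1)])
    show "fdet (verts X) (\<lambda>v v'. L ?\<chi> v v' + (if v = v' then 0 else 0)) = 0"
      using fdet_laplacian_verts[OF finX nonempty(1)] by (simp add: L_trivial)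
  qed
  moreover have "(?P has_field_derivative (\<Sum>s\<in>verts Y. fdet (verts Y - {s}) (laplacian Y))) (at 0)"
    unfolding laplacian_Y_factor[symmetric] by (rule DERIV_fdet_add_scalar[OF finite_verts(2)])
  ultimately have "(\<Sum>s\<in>verts Y. fdet (verts Y - {s}) (laplacian Y)) = (\<Sum>s\<in>verts X. fdet (verts X - {s}) (L ?\<chi>)) *
      (\<Prod>\<psi>\<in>characters G - {?\<chi>}. fdet (verts X) (\<lambda>v v'. L \<psi> v v' + (if v = v' then 0 else 0)))"
    by (rule DERIV_unique[rotated])
  then have "of_nat (card (verts Y) * num_spanning_trees Y) = of_nat (card (verts X) * num_spanning_trees X) *
      (\<Prod>\<psi>\<in>characters G - {?\<chi>}. fdet (verts X) (L \<psi>))"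
    unfolding L_trivial sum_principal_minors[OF finX] sum_principal_minors[OF finY] by simp
  then have "of_nat (card (verts X)) * of_nat (d * num_spanning_trees Y) = of_nat (card (verts X)) * (of_nat (num_spanning_trees X) *
      (\<Prod>\<psi>\<in>characters G - {?\<chi>}. fdet (verts X) (L \<psi>)))"
    unfolding card_verts_Y by (simp add: mult_ac)
  moreover have "card (verts X) \<noteq> 0" using nonempty finite_verts by simp
  ultimately show ?thesis by (simp only: mult_cancel_left of_nat_eq_0_iff) simp
qed

text \<open>A zero factor would make the right side of \<open>spanning_trees_ratio\<close> vanish,
  although the connected graph \<open>Y\<close> has a spanning tree.\<close>

lemma fdet_L_nonzero:
  assumes "\<psi> \<in> characters G" "\<psi> \<noteq> trivial_character G"
  shows "fdet (verts X) (L \<psi>) \<noteq> 0"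
proof
  assume "fdet (verts X) (L \<psi>) = 0"
  then have "(\<Prod>\<psi>\<in>characters G - {trivial_character G}. fdet (verts X) (L \<psi>)) = 0"
    using assms G.finite_characters[OF finite_G] by (intro prod_zero) auto
  then have "of_nat (d * num_spanning_trees Y) = (0::complex)" using spanning_trees_ratio by simp
  then have "d * num_spanning_trees Y = 0" by (simp only: of_nat_eq_0_iff)
  moreover have "d > 0" using card_G finite_G G.one_closed by (metis card_gt_0_iff empty_iff)
  ultimately show False using num_spanning_trees_pos[OF finY connY] by simp
qed

lemma fdet_L_trivial: "fdet (verts X) (L (trivial_character G)) = 0"
  unfolding L_trivial by (rule fdet_laplacian_verts[OF finX nonempty(1)])

end

section \<open>L-functions\<close>

fun linked :: "('v, 'e) multigraph \<Rightarrow> 'e oedge \<Rightarrow> 'e oedge list \<Rightarrow> 'e oedge \<Rightarrow> bool" where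
  "linked X a [] b \<longleftrightarrow> terminal X a = initial X b \<and> b \<noteq> orev a"
| "linked X a (x # xs) b \<longleftrightarrow> terminal X a = initial X x \<and> x \<noteq> orev a \<and> linked X x xs b"

lemma chain_edge_matrix:
  "chain (edge_matrix X c) a xs b = (if linked X a xs b then c a * prod_list (map c xs) else 0)"
  by (induction xs arbitrary: a) (auto simp: edge_matrix_def)

definition reduced :: "'e oedge list \<Rightarrow> bool" where
  "reduced p \<longleftrightarrow> (\<forall>i. Suc i < length p \<longrightarrow> p ! Suc i \<noteq> orev (p ! i))"

lemma reduced_Cons: "reduced (a # p) \<longleftrightarrow> reduced p \<and> (p \<noteq> [] \<longrightarrow> hd p \<noteq> orev a)"
proof
  assume r: "reduced (a # p)"
  have "reduced p" unfolding reduced_def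
  proof (intro allI impI)
    fix i assume "Suc i < length p"
    then show "p ! Suc i \<noteq> orev (p ! i)" using r[unfolded reduced_def, rule_format, of "Suc i"] by simp
  qed
  moreover have "hd p \<noteq> orev a" if "p \<noteq> []"
    using r[unfolded reduced_def, rule_format, of 0] that by (simp add: hd_conv_nth)
  ultimately show "reduced p \<and> (p \<noteq> [] \<longrightarrow> hd p \<noteq> orev a)" by blast
next
  assume r: "reduced p \<and> (p \<noteq> [] \<longrightarrow> hd p \<noteq> orev a)"
  show "reduced (a # p)" unfolding reduced_def
  proof (intro allI impI)
    fix i assume i: "Suc i < length (a # p)"
    show "(a # p) ! Suc i \<noteq> orev ((a # p) ! i)"
    proof (cases i)
      case 0
      then show ?thesis using r i by (simp add: hd_conv_nth)
    next
      case (Suc j)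
      then show ?thesis using r i unfolding reduced_def by simp
    qed
  qed
qed

lemma linked_iff:
  assumes "a \<in> oedges X" "set xs \<subseteq> oedges X"
  shows "linked X a xs b \<longleftrightarrow> is_path X (a # xs) \<and> reduced (a # xs) \<and>
    terminal X (last (a # xs)) = initial X b \<and> b \<noteq> orev (last (a # xs))"
  using assms
proof (induction xs arbitrary: a)
  case Nil
  then show ?case by (auto simp: is_path_Cons reduced_Cons) (simp add: reduced_def)
next
  case (Cons x xs)
  have "x \<in> oedges X" "set xs \<subseteq> oedges X" using Cons.prems by auto
  from Cons.IH[OF this] show ?case
    using Cons.prems(1) by (auto simp: is_path_Cons[of X a] reduced_Cons[of a])
qed

definition reduced_cycle :: "('v, 'e) multigraph \<Rightarrow> 'e oedge list \<Rightarrow> bool" where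
  "reduced_cycle X p \<longleftrightarrow> closed_path X p \<and> reduced p \<and> hd p \<noteq> orev (last p)"

text \<open>The inner entries of the cyclic product express the path condition and the absence of
  backtracks; the entry closing the cycle expresses closedness and the absence of a tail.\<close>

lemma cyc_edge_matrix:
  assumes "p \<noteq> []" "set p \<subseteq> oedges X"
  shows "cyc (edge_matrix X c) p = (if reduced_cycle X p then prod_list (map c p) else 0)"
proof -
  obtain a xs where p: "p = a # xs" using assms(1) by (cases p) auto
  have "linked X a xs a \<longleftrightarrow> reduced_cycle X p"
    unfolding linked_iff[of a X xs a, OF assms(2)[unfolded p, simplified, THEN conjunct1] assms(2)[unfolded p, simplified, THEN conjunct2]]
      reduced_cycle_def closed_path_def p by auto
  then show ?thesis by (simp add: p cyc_def chain_edge_matrix)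
qed

lemma closed_path_subset: "closed_path X p \<Longrightarrow> p \<noteq> [] \<and> set p \<subseteq> oedges X"
  by (simp add: closed_path_def is_path_def)

text \<open>Two consecutive copies of \<open>c\<close> inside the path show that \<open>c\<close>
  ends where it starts.\<close>

lemma closed_path_root:
  assumes p: "closed_path X p" "p = concat (replicate a c)" "a \<ge> 2"
  shows "closed_path X c"
proof -
  obtain k where k: "a = Suc (Suc k)" using p(3) by (metis Suc_le_D numeral_2_eq_2 Suc_le_mono)
  have pc: "p = c @ (c @ concat (replicate k c))" using p(2) k by simp
  have c0: "c \<noteq> []" using closed_path_subset[OF p(1)] pc by auto
  have "is_path X p" using p(1) by (simp add: closed_path_def)
  then have "is_path X c" "terminal X (last c) = initial X (hd (c @ concat (replicate k c)))"
    unfolding pc is_path_append[of X c] using c0 by auto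
  then show ?thesis using c0 by (simp add: closed_path_def)
qed

text \<open>By \<open>closed_path_root\<close> the root of a proper power is automatically closed,
  so primitivity becomes a property of the word alone.\<close>

lemma prime_path_iff: "prime_path X p \<longleftrightarrow> reduced_cycle X p \<and> primitive p"
proof
  assume p: "prime_path X p"
  then have c: "closed_path X p" by (simp add: prime_path_def)
  have "p \<noteq> []" using closed_path_subset[OF c] by simp
  moreover have "\<not> (\<exists>c a. a \<ge> 2 \<and> p = concat (replicate a c))"
  proof
    assume "\<exists>c a. a \<ge> 2 \<and> p = concat (replicate a c)"
    then obtain c' a where "a \<ge> 2" "p = concat (replicate a c')" by blast
    moreover from this have "closed_path X c'" using closed_path_root[OF c] by blast
    ultimately show False using p unfolding prime_path_def by blast
  qed
  ultimately show "reduced_cycle X p \<and> primitive p"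
    using p unfolding prime_path_def reduced_cycle_def reduced_def primitive_def by blast
next
  assume "reduced_cycle X p \<and> primitive p"
  then show "prime_path X p"
    unfolding prime_path_def reduced_cycle_def reduced_def primitive_def by blast
qed

text \<open>With all weights equal to 1, \<open>cyc\<close> of the edge matrix is the indicator of
  reduced cycles, and \<open>cyc\<close> is invariant under rotation.\<close>

lemma reduced_cycle_rotate:
  assumes "reduced_cycle X p"
  shows "reduced_cycle X (rotate n p)"
proof -
  have p: "p \<noteq> []" "set p \<subseteq> oedges X" using assms closed_path_subset by (auto simp: reduced_cycle_def)
  have "cyc (edge_matrix X (\<lambda>_. 1)) (rotate n p) = cyc (edge_matrix X (\<lambda>_. 1)) p" by (rule cyc_rotate)
  also have "\<dots> = 1" using cyc_edge_matrix[OF p, of "\<lambda>_. 1"] assms by (simp add: map_replicate_const)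
  finally show ?thesis using cyc_edge_matrix[of "rotate n p" X "\<lambda>_. 1"] p by (simp split: if_splits)
qed

lemma graph_primes_eq: "graph_primes X = necklace ` {p. prime_path X p}"
proof -
  have "{(p, q). closed_path X p \<and> closed_path X q \<and> (\<exists>n. q = rotate n p)} `` {p} = necklace p" if "prime_path X p" for p
  proof -
    have r: "reduced_cycle X p" using that by (simp add: prime_path_iff)
    then have "closed_path X (rotate n p)" for n using reduced_cycle_rotate by (auto simp: reduced_cycle_def)
    moreover have "closed_path X p" using r by (simp add: reduced_cycle_def)
    ultimately show ?thesis by (auto simp: necklace_def)
  qed
  then show ?thesis unfolding graph_primes_def quotient_def by auto
qed

lemma graph_primes_subset: "graph_primes X \<subseteq> necklaces (oedges X)"
  unfolding graph_primes_eq necklaces_def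
proof (rule image_mono, rule subsetI)
  fix p assume "p \<in> {p. prime_path X p}"
  then have "primitive p" "closed_path X p" by (auto simp: prime_path_iff reduced_cycle_def)
  then show "p \<in> {p. primitive p \<and> set p \<subseteq> oedges X}" using closed_path_subset by blast
qed

text \<open>This lets the Euler product over all necklaces of words be restricted to primes.\<close>

lemma necklace_weight_not_prime:
  assumes "N \<in> necklaces (oedges X)" "N \<notin> graph_primes X"
  shows "necklace_weight (edge_matrix X c) u N = 0"
proof -
  obtain p where p: "primitive p" "set p \<subseteq> oedges X" "N = necklace p" using assms(1) by (auto simp: necklaces_def)
  have "\<not> reduced_cycle X p" using assms(2) p by (auto simp: graph_primes_eq prime_path_iff)
  moreover have "p \<noteq> []" using p(1) by (simp add: primitive_def)
  ultimately have "cyc (edge_matrix X c) p = 0" using cyc_edge_matrix[OF _ p(2)] by simp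
  then show ?thesis using necklace_weight_eq[OF necklace_self, of "edge_matrix X c" u p] p(3) by simp
qed

section \<open>Frobenius automorphisms and the Euler product\<close>

context abelian_graph_cover
begin

fun pvolt :: "'e oedge list \<Rightarrow> (('w, 'f) point \<Rightarrow> ('w, 'f) point)" where
  "pvolt [] = \<one>\<^bsub>G\<^esub>"
| "pvolt (a # p) = volt a \<otimes>\<^bsub>G\<^esub> pvolt p"

lemma pvolt_in: "set p \<subseteq> oedges X \<Longrightarrow> pvolt p \<in> carrier G"
  by (induction p) (auto simp: volt_in)

lemma pvolt_append: "set p \<subseteq> oedges X \<Longrightarrow> set q \<subseteq> oedges X \<Longrightarrow> pvolt (p @ q) = pvolt p \<otimes>\<^bsub>G\<^esub> pvolt q"
  by (induction p) (auto simp: volt_in pvolt_in G.m_assoc)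

text \<open>Commutativity of the group makes the voltage of a closed path independent of its
  starting point.\<close>

lemma pvolt_rotate: "set p \<subseteq> oedges X \<Longrightarrow> pvolt (rotate n p) = pvolt p"
proof (induction n)
  case (Suc n)
  have "pvolt (rotate1 q) = pvolt q" if "set q \<subseteq> oedges X" for q
    using that by (cases q) (auto simp: pvolt_append volt_in pvolt_in G.m_comm)
  then show ?case using Suc by simp
qed simp

lemma character_pvolt:
  assumes \<psi>: "\<psi> \<in> characters G"
  shows "set p \<subseteq> oedges X \<Longrightarrow> \<psi> (pvolt p) = prod_list (map (\<lambda>a. \<psi> (volt a)) p)"
  by (induction p) (auto simp: G.character_one[OF \<psi>] G.character_mult[OF \<psi>] volt_in pvolt_in)

lemma path_lift_terminal:
  assumes "is_path Y q" "q \<noteq> []" "g \<in> carrier G" "initial Y (hd q) = act g (sec (initial X (emap \<pi> (hd q))))"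
  shows "terminal Y (last q) = act (g \<otimes>\<^bsub>G\<^esub> pvolt (map (emap \<pi>) q)) (sec (terminal X (emap \<pi> (last q))))"
  using assms
proof (induction q arbitrary: g)
  case (Cons b q)
  have b: "b \<in> oedges Y" using Cons.prems by (simp add: is_path_Cons)
  have va: "volt (emap \<pi> b) \<in> carrier G" by (rule volt_in[OF emap_in[OF b]])
  have t: "terminal Y b = act (g \<otimes>\<^bsub>G\<^esub> volt (emap \<pi> b)) (sec (terminal X (emap \<pi> b)))"
    by (rule terminal_volt[OF b Cons.prems(3)]) (use Cons.prems in simp)
  show ?case
  proof (cases "q = []")
    case True
    then show ?thesis using t va Cons.prems(3) by simp
  next
    case False
    have q: "is_path Y q" "terminal Y b = initial Y (hd q)" using Cons.prems False by (auto simp: is_path_Cons)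
    have hq: "hd q \<in> oedges Y" using q(1) False by (cases q) (auto simp: is_path_Cons)
    have "terminal X (emap \<pi> b) = initial X (emap \<pi> (hd q))"
      using terminal_emap[OF b] initial_emap[OF hq] q(2) by simp
    then have "initial Y (hd q) = act (g \<otimes>\<^bsub>G\<^esub> volt (emap \<pi> b)) (sec (initial X (emap \<pi> (hd q))))" using t q(2) by simp
    from Cons.IH[OF q(1) False _ this] have "terminal Y (last q) =
      act (g \<otimes>\<^bsub>G\<^esub> volt (emap \<pi> b) \<otimes>\<^bsub>G\<^esub> pvolt (map (emap \<pi>) q)) (sec (terminal X (emap \<pi> (last q))))"
      using va Cons.prems(3) by simp
    moreover have "pvolt (map (emap \<pi>) q) \<in> carrier G"
      using q(1) emap_in by (intro pvolt_in) (auto simp: is_path_def)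
    ultimately show ?thesis using False va Cons.prems(3) by (simp add: G.m_assoc)
  qed
qed simp

lemma path_lift_exists:
  assumes "is_path X p" "p \<noteq> []" "w \<in> verts Y" "vmap \<pi> w = initial X (hd p)"
  shows "\<exists>q. is_path Y q \<and> map (emap \<pi>) q = p \<and> initial Y (hd q) = w"
  using assms
proof (induction p arbitrary: w)
  case (Cons a p)
  have a: "a \<in> oedges X" using Cons.prems by (simp add: is_path_Cons)
  obtain b where b: "b \<in> oedges Y" "initial Y b = w" "emap \<pi> b = a"
    using lift_exists[OF Cons.prems(3) a] Cons.prems(4) by auto
  show ?case
  proof (cases "p = []")
    case True
    then show ?thesis using b by (intro exI[of _ "[b]"]) (simp add: is_path_Cons)
  next
    case False
    have "vmap \<pi> (terminal Y b) = initial X (hd p)"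
      using terminal_emap[OF b(1)] b(3) Cons.prems(1) False by (simp add: is_path_Cons)
    then obtain q where q: "is_path Y q" "map (emap \<pi>) q = p" "initial Y (hd q) = terminal Y b"
      using Cons.IH[of "terminal Y b"] Cons.prems(1) False terminal_in[OF finY b(1)] by (auto simp: is_path_Cons)
    then have "is_path Y (b # q)" using b by (simp add: is_path_Cons)
    then show ?thesis using q(2) b by (intro exI[of _ "b # q"]) simp
  qed
qed simp

text \<open>A lift that starts in the \<open>h\<close> translate of the section ends in the
  translate by \<open>h\<close> times the total voltage. As the group is abelian, the voltage itself
  moves the start to the end, and freeness leaves no other candidate. The lift starting on the
  section shows existence.\<close>

lemma frobenius_eq:
  assumes P: "P = necklace p0" and p0: "prime_path X p0"
  shows "frobenius Y X \<pi> P = pvolt p0"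
proof -
  have rc: "reduced_cycle X p" if "p \<in> P" for p
    using that p0 reduced_cycle_rotate unfolding P necklace_def by (auto simp: prime_path_iff)
  have set0: "set p0 \<subseteq> oedges X" using p0 closed_path_subset[of X p0] by (simp add: prime_path_iff reduced_cycle_def)
  have key: "g = pvolt p0"
    if p: "p \<in> P" and q: "is_path Y q" "map (emap \<pi>) q = p" and g: "g \<in> carrier G"
      and gv: "g (Vertex (initial Y (hd q))) = Vertex (terminal Y (last q))" for g p q
  proof -
    have cp: "closed_path X p" using rc[OF p] by (simp add: reduced_cycle_def)
    have q0: "q \<noteq> []" using closed_path_subset[OF cp] q(2) by auto
    have "set q \<subseteq> oedges Y" using q(1) by (simp add: is_path_def)
    then have hq: "hd q \<in> oedges Y" "last q \<in> oedges Y" using hd_in_set[OF q0] last_in_set[OF q0] by blast+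
    let ?w = "initial Y (hd q)"
    have w: "?w \<in> verts Y" by (rule initial_in[OF finY hq(1)])
    have vw: "vmap \<pi> ?w = initial X (emap \<pi> (hd q))" using initial_emap[OF hq(1)] by simp
    obtain h where h: "h \<in> carrier G" "?w = act h (sec (initial X (emap \<pi> (hd q))))"
      using coord_exists[OF w] vw by auto
    have pv: "pvolt p = pvolt p0" using p pvolt_rotate[OF set0] unfolding P necklace_def by auto
    have pin: "pvolt p0 \<in> carrier G" by (rule pvolt_in[OF set0])
    have "initial X (emap \<pi> (hd q)) = terminal X (emap \<pi> (last q))"
      using cp q(2) q0 by (auto simp: closed_path_def hd_map last_map)
    then have "terminal Y (last q) = act (h \<otimes>\<^bsub>G\<^esub> pvolt p0) (sec (initial X (emap \<pi> (hd q))))"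
      using path_lift_terminal[OF q(1) q0 h] q(2) pv by simp
    also have "\<dots> = act (pvolt p0) ?w"
      using h pin act_mult[OF pin h(1) sec(1)[OF initial_in[OF finX emap_in[OF hq(1)]]]] by (simp add: G.m_comm)
    finally have "terminal Y (last q) = act (pvolt p0) ?w" .
    moreover have "act g ?w = terminal Y (last q)" using gv by (simp add: act_def)
    ultimately show ?thesis using act_free[OF g pin w] by simp
  qed
  have ex: "\<exists>p\<in>P. \<exists>q. is_path Y q \<and> map (emap \<pi>) q = p \<and> pvolt p0 (Vertex (initial Y (hd q))) = Vertex (terminal Y (last q))"
  proof -
    have pin: "pvolt p0 \<in> carrier G" by (rule pvolt_in[OF set0])
    have p0P: "p0 \<in> P" unfolding P by (rule necklace_self)
    have cp: "closed_path X p0" using rc[OF p0P] by (simp add: reduced_cycle_def)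
    have hp: "hd p0 \<in> oedges X" "p0 \<noteq> []" using closed_path_subset[OF cp] by auto
    let ?v = "initial X (hd p0)"
    have v: "?v \<in> verts X" by (rule initial_in[OF finX hp(1)])
    obtain q where q: "is_path Y q" "map (emap \<pi>) q = p0" "initial Y (hd q) = sec ?v"
      using path_lift_exists[of p0 "sec ?v"] cp hp sec[OF v] by (auto simp: closed_path_def)
    have q0: "q \<noteq> []" using q(2) hp by auto
    have e: "emap \<pi> (hd q) = hd p0" "emap \<pi> (last q) = last p0" using q(2) q0 by (auto simp: hd_map last_map)
    have lv: "terminal X (last p0) = ?v" using cp by (simp add: closed_path_def)
    have "terminal Y (last q) = act (\<one>\<^bsub>G\<^esub> \<otimes>\<^bsub>G\<^esub> pvolt p0) (sec ?v)"
      using path_lift_terminal[OF q(1) q0 G.one_closed] q act_one[OF sec(1)[OF v]] e lv by simp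
    then have "pvolt p0 (Vertex (initial Y (hd q))) = Vertex (terminal Y (last q))"
      using deck_Vertex(1)[of "pvolt p0" "sec ?v"] pin sec(1)[OF v] q(3) by (simp add: deck_def)
    then show ?thesis using q p0P by blast
  qed
  show ?thesis
    unfolding frobenius_def
  proof (rule the_equality)
    show "pvolt p0 \<in> carrier G \<and> (\<exists>p\<in>P. \<exists>q. is_path Y q \<and> map (emap \<pi>) q = p \<and>
        pvolt p0 (Vertex (initial Y (hd q))) = Vertex (terminal Y (last q)))"
      using ex pvolt_in[OF set0] by blast
  qed (use key in blast)
qed

lemma frobenius_weight:
  assumes \<psi>: "\<psi> \<in> characters G" and P: "P \<in> graph_primes X"
  shows "\<psi> (frobenius Y X \<pi> P) * u ^ prime_length P = necklace_weight (edge_matrix X (\<lambda>a. \<psi> (volt a))) u P"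
proof -
  obtain p where p: "prime_path X p" "P = necklace p" using P by (auto simp: graph_primes_eq)
  have rp: "reduced_cycle X p" using p(1) by (simp add: prime_path_iff)
  have s: "p \<noteq> [] \<and> set p \<subseteq> oedges X" using rp closed_path_subset by (auto simp: reduced_cycle_def)
  have "(SOME q. q \<in> P) \<in> P" unfolding p(2) using necklace_self by (rule someI)
  then have "prime_length P = length p" unfolding prime_length_def p(2) by (rule necklace_length)
  then show ?thesis
    using necklace_weight_eq[OF necklace_self, of "edge_matrix X (\<lambda>a. \<psi> (volt a))" u p]
      frobenius_eq[OF p(2,1)] character_pvolt[OF \<psi>, of p] cyc_edge_matrix[of p X "\<lambda>a. \<psi> (volt a)"] rp s p(2) by simp
qed

text \<open>Finite partial sums of logarithms over primes exponentiate to finite Euler products, so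
  continuity of exp turns the unordered sum of \<open>euler_product_necklaces\<close> into the
  unordered product.\<close>

theorem L_function_edge_poly:
  assumes \<psi>: "\<psi> \<in> characters G"
  shows "\<forall>\<^sub>F u in nhds 0. poly (edge_poly X (\<lambda>a. \<psi> (volt a))) u = inverse (L_function Y X \<pi> \<psi> u)"
proof -
  let ?c = "\<lambda>a. \<psi> (volt a)" and ?S = "oedges X"
  let ?W = "edge_matrix X ?c"
  obtain r where r: "r > 0" "\<And>u. norm u < r \<Longrightarrow> (\<forall>N\<in>necklaces ?S. norm (necklace_weight ?W u N) < 1) \<and>
    (\<exists>l. ((\<lambda>N. - Ln (1 - necklace_weight ?W u N)) has_sum l) (necklaces ?S) \<and>
    exp l * fdet ?S (\<lambda>i j. (if i = j then 1 else 0) - u * ?W i j) = 1)"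
    using euler_product_necklaces[OF finite_oedges[OF finX], of ?W] by blast
  have main: "poly (edge_poly X ?c) u = inverse (L_function Y X \<pi> \<psi> u)" if u: "norm u < r" for u
  proof -
    obtain l where n1: "\<forall>N\<in>necklaces ?S. norm (necklace_weight ?W u N) < 1"
      and l: "((\<lambda>N. - Ln (1 - necklace_weight ?W u N)) has_sum l) (necklaces ?S)"
        "exp l * fdet ?S (\<lambda>i j. (if i = j then 1 else 0) - u * ?W i j) = 1" using r(2)[OF u] by blast
    have "((\<lambda>N. - Ln (1 - necklace_weight ?W u N)) has_sum l) (graph_primes X)"
    proof (rule has_sum_cong_neutral[THEN iffD1, OF _ _ _ l(1)])
      show "- Ln (1 - necklace_weight ?W u N) = 0" if "N \<in> graph_primes X - necklaces ?S" for N
        using that graph_primes_subset by blast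
      show "- Ln (1 - necklace_weight ?W u N) = 0" if "N \<in> necklaces ?S - graph_primes X" for N
        using that necklace_weight_not_prime[of N X ?c u] by simp
    qed simp
    then have "(sum (\<lambda>N. - Ln (1 - necklace_weight ?W u N)) \<longlongrightarrow> l) (finite_subsets_at_top (graph_primes X))"
      unfolding has_sum_def .
    then have e: "((\<lambda>F. exp (sum (\<lambda>N. - Ln (1 - necklace_weight ?W u N)) F)) \<longlongrightarrow> exp l) (finite_subsets_at_top (graph_primes X))"
      by (rule tendsto_exp)
    have "((\<lambda>F. \<Prod>P\<in>F. inverse (1 - \<psi> (frobenius Y X \<pi> P) * u ^ prime_length P)) \<longlongrightarrow> exp l) (finite_subsets_at_top (graph_primes X))"
    proof (rule Lim_transform_eventually[OF e])
      show "\<forall>\<^sub>F F in finite_subsets_at_top (graph_primes X). exp (sum (\<lambda>N. - Ln (1 - necklace_weight ?W u N)) F) =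
        (\<Prod>P\<in>F. inverse (1 - \<psi> (frobenius Y X \<pi> P) * u ^ prime_length P))"
      proof (rule eventually_finite_subsets_at_top_weakI)
        fix F assume F: "finite F" "F \<subseteq> graph_primes X"
        have "exp (sum (\<lambda>N. - Ln (1 - necklace_weight ?W u N)) F) = (\<Prod>N\<in>F. exp (- Ln (1 - necklace_weight ?W u N)))"
          by (rule exp_sum[OF F(1)])
        also have "\<dots> = (\<Prod>P\<in>F. inverse (1 - \<psi> (frobenius Y X \<pi> P) * u ^ prime_length P))"
        proof (rule prod.cong[OF refl])
          fix P assume "P \<in> F"
          then have P: "P \<in> graph_primes X" using F by blast
          then have "norm (necklace_weight ?W u P) < 1" using n1 graph_primes_subset by blast
          then have "1 - necklace_weight ?W u P \<noteq> 0" by auto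
          then show "exp (- Ln (1 - necklace_weight ?W u P)) = inverse (1 - \<psi> (frobenius Y X \<pi> P) * u ^ prime_length P)"
            unfolding frobenius_weight[OF \<psi> P] by (simp add: exp_minus)
        qed
        finally show "exp (sum (\<lambda>N. - Ln (1 - necklace_weight ?W u N)) F) =
          (\<Prod>P\<in>F. inverse (1 - \<psi> (frobenius Y X \<pi> P) * u ^ prime_length P))" .
      qed
    qed
    then have "L_function Y X \<pi> \<psi> u = exp l"
      unfolding L_function_def by (intro tendsto_Lim) simp_all
    moreover have "poly (edge_poly X ?c) u = inverse (exp l)"
      unfolding poly_edge_poly using l(2) by (simp add: inverse_unique)
    ultimately show ?thesis by simp
  qed
  have "\<forall>\<^sub>F u in nhds (0::complex). norm u < r"
    using r(1) eventually_nhds_metric[of "\<lambda>u::complex. norm u < r" 0] by (auto simp: dist_norm)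
  then show ?thesis by (rule eventually_mono) (rule main)
qed

text \<open>Two polynomials that agree near 0 agree on an infinite set, so the defining description
  has a unique solution.\<close>

lemma L_inverse_eq:
  assumes \<psi>: "\<psi> \<in> characters G"
  shows "L_inverse Y X \<pi> \<psi> = edge_poly X (\<lambda>a. \<psi> (volt a))"
  unfolding L_inverse_def
proof (rule the_equality)
  let ?Q = "edge_poly X (\<lambda>a. \<psi> (volt a))"
  show "\<forall>\<^sub>F u in nhds 0. poly ?Q u = inverse (L_function Y X \<pi> \<psi> u)" by (rule L_function_edge_poly[OF \<psi>])
  fix R :: "complex poly" assume R: "\<forall>\<^sub>F u in nhds 0. poly R u = inverse (L_function Y X \<pi> \<psi> u)"
  have "\<forall>\<^sub>F u in nhds 0. poly (R - ?Q) u = 0"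
    using R L_function_edge_poly[OF \<psi>] by eventually_elim simp
  then obtain S where S: "open S" "0 \<in> S" "\<forall>u\<in>S. poly (R - ?Q) u = 0" by (auto simp: eventually_nhds)
  then have "S \<subseteq> {u. poly (R - ?Q) u = 0}" by blast
  moreover have "infinite S" using S(1,2) finite_imp_not_open[of S] by blast
  ultimately have "infinite {u. poly (R - ?Q) u = 0}" using infinite_super by blast
  then have "R - ?Q = 0" using poly_roots_finite by blast
  then show "R = ?Q" by simp
qed

theorem L_star_eq:
  assumes \<psi>: "\<psi> \<in> characters G" "\<psi> \<noteq> trivial_character G"
  shows "card (verts X) \<le> card (edges X)"
    and "L_star Y X \<pi> \<psi> = (-2) ^ (card (edges X) - card (verts X)) * fdet (verts X) (L \<psi>)"
proof -
  have c: "\<psi> (volt a) * \<psi> (volt (orev a)) = 1" if "a \<in> oedges X" for a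
    using volt_orev[OF that] G.character_mult[OF \<psi>(1) volt_in[OF that] volt_in[of "orev a"]] that
      G.character_one[OF \<psi>(1)] by simp
  show "card (verts X) \<le> card (edges X)"
    by (rule leading_coeff_edge_poly(1)[OF finX c fdet_L_nonzero[OF \<psi>]])
  show "L_star Y X \<pi> \<psi> = (-2) ^ (card (edges X) - card (verts X)) * fdet (verts X) (L \<psi>)"
    unfolding L_star_def L_inverse_eq[OF \<psi>(1)]
    using leading_coeff_edge_poly(2)[OF finX c fdet_L_nonzero[OF \<psi>]] by (simp only: Let_def)
qed

end

section \<open>The augmentation ideal\<close>

context comm_group
begin

text \<open>Such functions of \<psi> form a ring, with convolution behind the product. A determinant
  whose entries are of this kind is therefore of this kind as well.\<close>

definition integral_fourier :: "(('a \<Rightarrow> complex) \<Rightarrow> complex) \<Rightarrow> bool" where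
  "integral_fourier F \<longleftrightarrow> (\<exists>z::'a \<Rightarrow> int. \<forall>\<psi>\<in>characters G. F \<psi> = (\<Sum>k\<in>carrier G. of_int (z k) * \<psi> k))"

lemma integral_fourier_character:
  assumes fin: "finite (carrier G)" and g: "g \<in> carrier G"
  shows "integral_fourier (\<lambda>\<psi>. of_int c * \<psi> g)"
proof -
  have "of_int c * \<psi> g = (\<Sum>k\<in>carrier G. of_int (if k = g then c else 0) * \<psi> k)" for \<psi> :: "'a \<Rightarrow> complex"
  proof -
    have "(\<Sum>k\<in>carrier G. of_int (if k = g then c else 0) * \<psi> k) = (\<Sum>k\<in>carrier G. if k = g then of_int c * \<psi> k else 0)"
      by (rule sum.cong) auto
    then show ?thesis using fin g by simp
  qed
  then show ?thesis unfolding integral_fourier_def by (intro exI[of _ "\<lambda>k. if k = g then c else 0"] ballI)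
qed

lemma integral_fourier_const:
  assumes fin: "finite (carrier G)"
  shows "integral_fourier (\<lambda>\<psi>. of_int c)"
proof -
  obtain z where z: "\<forall>\<psi>\<in>characters G. of_int c * \<psi> \<one> = (\<Sum>k\<in>carrier G. of_int (z k) * \<psi> k)"
    using integral_fourier_character[OF fin one_closed, of c] unfolding integral_fourier_def by (rule exE)
  have "of_int c = (\<Sum>k\<in>carrier G. of_int (z k) * \<psi> k)" if "\<psi> \<in> characters G" for \<psi>
    using bspec[OF z that] character_one[OF that] by simp
  then show ?thesis unfolding integral_fourier_def by (intro exI[of _ z] ballI)
qed

lemma integral_fourier_add:
  assumes "integral_fourier F" "integral_fourier H"
  shows "integral_fourier (\<lambda>\<psi>. F \<psi> + H \<psi>)"
proof -
  obtain z where z: "\<forall>\<psi>\<in>characters G. F \<psi> = (\<Sum>k\<in>carrier G. of_int (z k) * \<psi> k)"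
    using assms(1) unfolding integral_fourier_def by (rule exE)
  obtain w where w: "\<forall>\<psi>\<in>characters G. H \<psi> = (\<Sum>k\<in>carrier G. of_int (w k) * \<psi> k)"
    using assms(2) unfolding integral_fourier_def by (rule exE)
  have "F \<psi> + H \<psi> = (\<Sum>k\<in>carrier G. of_int (z k + w k) * \<psi> k)" if "\<psi> \<in> characters G" for \<psi>
    using bspec[OF z that] bspec[OF w that] by (simp add: distrib_right sum.distrib)
  then show ?thesis unfolding integral_fourier_def by (intro exI[of _ "\<lambda>k. z k + w k"] ballI)
qed

lemma integral_fourier_mult:
  assumes "integral_fourier F" "integral_fourier H"
  shows "integral_fourier (\<lambda>\<psi>. F \<psi> * H \<psi>)"
proof -
  obtain z where z: "\<forall>\<psi>\<in>characters G. F \<psi> = (\<Sum>k\<in>carrier G. of_int (z k) * \<psi> k)"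
    using assms(1) unfolding integral_fourier_def by (rule exE)
  obtain w where w: "\<forall>\<psi>\<in>characters G. H \<psi> = (\<Sum>k\<in>carrier G. of_int (w k) * \<psi> k)"
    using assms(2) unfolding integral_fourier_def by (rule exE)
  let ?y = "\<lambda>k. \<Sum>h\<in>carrier G. z h * w (inv h \<otimes> k)"
  have "F \<psi> * H \<psi> = (\<Sum>k\<in>carrier G. of_int (?y k) * \<psi> k)" if \<psi>: "\<psi> \<in> characters G" for \<psi>
  proof -
    have "F \<psi> * H \<psi> = (\<Sum>h\<in>carrier G. \<Sum>l\<in>carrier G. of_int (z h) * \<psi> h * (of_int (w l) * \<psi> l))"
      unfolding bspec[OF z \<psi>] bspec[OF w \<psi>] by (rule sum_product)
    also have "\<dots> = (\<Sum>h\<in>carrier G. \<Sum>k\<in>carrier G. of_int (z h * w (inv h \<otimes> k)) * \<psi> k)"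
    proof (rule sum.cong[OF refl])
      fix h assume h: "h \<in> carrier G"
      have "(\<Sum>k\<in>carrier G. of_int (z h * w (inv h \<otimes> k)) * \<psi> k) = (\<Sum>l\<in>carrier G. of_int (z h * w l) * \<psi> (h \<otimes> l))"
        by (rule sum.reindex_bij_witness[of _ "\<lambda>l. h \<otimes> l" "\<lambda>k. inv h \<otimes> k"]) (use h in \<open>auto simp: m_assoc[symmetric]\<close>)
      also have "\<dots> = (\<Sum>l\<in>carrier G. of_int (z h) * \<psi> h * (of_int (w l) * \<psi> l))"
        by (rule sum.cong) (use h in \<open>simp_all add: character_mult[OF \<psi>] mult_ac\<close>)
      finally show "(\<Sum>l\<in>carrier G. of_int (z h) * \<psi> h * (of_int (w l) * \<psi> l)) =
        (\<Sum>k\<in>carrier G. of_int (z h * w (inv h \<otimes> k)) * \<psi> k)" ..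
    qed
    also have "\<dots> = (\<Sum>k\<in>carrier G. \<Sum>h\<in>carrier G. of_int (z h * w (inv h \<otimes> k)) * \<psi> k)" by (rule sum.swap)
    also have "\<dots> = (\<Sum>k\<in>carrier G. of_int (?y k) * \<psi> k)" by (simp add: sum_distrib_right)
    finally show ?thesis .
  qed
  then show ?thesis unfolding integral_fourier_def by (intro exI[of _ ?y] ballI)
qed

lemma integral_fourier_sum:
  assumes "finite (carrier G)" "\<And>i. i \<in> I \<Longrightarrow> integral_fourier (F i)"
  shows "integral_fourier (\<lambda>\<psi>. \<Sum>i\<in>I. F i \<psi>)"
  using assms(2)
proof (induction I rule: infinite_finite_induct)
  case (insert i I)
  then show ?case using integral_fourier_add[of "F i" "\<lambda>\<psi>. \<Sum>i\<in>I. F i \<psi>"] by simp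
qed (use integral_fourier_const[OF assms(1), of 0] in simp_all)

lemma integral_fourier_prod:
  assumes "finite (carrier G)" "\<And>i. i \<in> I \<Longrightarrow> integral_fourier (F i)"
  shows "integral_fourier (\<lambda>\<psi>. \<Prod>i\<in>I. F i \<psi>)"
  using assms(2)
proof (induction I rule: infinite_finite_induct)
  case (insert i I)
  then show ?case using integral_fourier_mult[of "F i" "\<lambda>\<psi>. \<Prod>i\<in>I. F i \<psi>"] by simp
qed (use integral_fourier_const[OF assms(1), of 1] in simp_all)

lemma integral_fourier_fdet:
  assumes fin: "finite (carrier G)" and M: "\<And>i j. i \<in> S \<Longrightarrow> integral_fourier (\<lambda>\<psi>. M \<psi> i j)"
  shows "integral_fourier (\<lambda>\<psi>. fdet S (M \<psi>))"
  unfolding fdet_def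
  by (intro integral_fourier_sum[OF fin] integral_fourier_mult integral_fourier_const[OF fin] integral_fourier_prod[OF fin] M)

section \<open>Coordinates on the augmentation ideal\<close>

lemma char_idempotent_eq:
  assumes fin: "finite (carrier G)"
  shows "char_idempotent G \<phi> \<tau> = (if \<tau> \<in> carrier G then \<phi> (inv \<tau>) / of_nat (card (carrier G)) else 0)"
proof -
  have "(\<Sum>\<sigma>\<in>carrier G. \<phi> \<sigma> * group_elem (inv \<sigma>) \<tau>) = (if \<tau> \<in> carrier G then \<phi> (inv \<tau>) else 0)"
  proof (cases "\<tau> \<in> carrier G")
    case True
    have "(\<Sum>\<sigma>\<in>carrier G. \<phi> \<sigma> * group_elem (inv \<sigma>) \<tau>) = (\<Sum>\<sigma>\<in>carrier G. if \<sigma> = inv \<tau> then \<phi> \<sigma> else 0)"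
      by (rule sum.cong) (use True in \<open>auto simp: group_elem_def\<close>)
    then show ?thesis using fin True by simp
  next
    case False
    then show ?thesis by (auto simp: group_elem_def intro!: sum.neutral)
  qed
  then show ?thesis unfolding char_idempotent_def by simp
qed

text \<open>The additive inverse is computed from its defining description, without first
  establishing that the group ring is a ring.\<close>

lemma complex_group_ring_minus:
  assumes f: "f \<in> carrier (complex_group_ring G)"
  shows "h \<ominus>\<^bsub>complex_group_ring G\<^esub> f = (\<lambda>\<tau>. h \<tau> - f \<tau>)"
proof -
  have "(\<ominus>\<^bsub>complex_group_ring G\<^esub> f) = (\<lambda>\<tau>. - f \<tau>)"
    unfolding a_inv_def m_inv_def
  proof (rule the_equality)
    show "(\<lambda>\<tau>. - f \<tau>) \<in> carrier (add_monoid (complex_group_ring G)) \<and>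
      f \<otimes>\<^bsub>add_monoid (complex_group_ring G)\<^esub> (\<lambda>\<tau>. - f \<tau>) = \<one>\<^bsub>add_monoid (complex_group_ring G)\<^esub> \<and>
      (\<lambda>\<tau>. - f \<tau>) \<otimes>\<^bsub>add_monoid (complex_group_ring G)\<^esub> f = \<one>\<^bsub>add_monoid (complex_group_ring G)\<^esub>"
      using f by (simp add: group_ring_def)
    fix y assume "y \<in> carrier (add_monoid (complex_group_ring G)) \<and>
      f \<otimes>\<^bsub>add_monoid (complex_group_ring G)\<^esub> y = \<one>\<^bsub>add_monoid (complex_group_ring G)\<^esub> \<and>
      y \<otimes>\<^bsub>add_monoid (complex_group_ring G)\<^esub> f = \<one>\<^bsub>add_monoid (complex_group_ring G)\<^esub>"
    then have "(\<lambda>\<tau>. f \<tau> + y \<tau>) = (\<lambda>_. 0)" by (simp add: group_ring_def)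
    then have "f \<tau> + y \<tau> = 0" for \<tau> by (rule fun_cong)
    then show "y = (\<lambda>\<tau>. - f \<tau>)" by (intro ext) (simp add: add_eq_0_iff)
  qed
  then show ?thesis unfolding a_minus_def by (simp add: group_ring_def)
qed

text \<open>An element of the augmentation ideal is determined by its coefficients away from the identity.\<close>

definition augmentation_embed :: "('a \<Rightarrow> int) \<Rightarrow> 'a \<Rightarrow> complex" where
  "augmentation_embed x = (\<lambda>\<tau>. if \<tau> \<in> carrier G - {\<one>} then of_int (x \<tau>)
     else if \<tau> = \<one> then - of_int (\<Sum>\<sigma>\<in>carrier G - {\<one>}. x \<sigma>) else 0)"

lemma augmentation_embed_add:
  "augmentation_embed (\<lambda>i. x i + y i) = (\<lambda>\<tau>. augmentation_embed x \<tau> + augmentation_embed y \<tau>)"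
  by (auto simp: augmentation_embed_def fun_eq_iff sum.distrib)

lemma augmentation_embed_inj:
  assumes "x \<in> vecs (carrier G - {\<one>})" "y \<in> vecs (carrier G - {\<one>})" "augmentation_embed x = augmentation_embed y"
  shows "x = y"
proof
  fix \<tau>
  show "x \<tau> = y \<tau>"
  proof (cases "\<tau> \<in> carrier G - {\<one>}")
    case True
    then show ?thesis using fun_cong[OF assms(3), of \<tau>] by (simp add: augmentation_embed_def)
  next
    case False
    then show ?thesis using assms(1,2) by (simp add: vecs_def)
  qed
qed

lemma augmentation_ideal_eq:
  assumes fin: "finite (carrier G)"
  shows "augmentation_ideal G = augmentation_embed ` vecs (carrier G - {\<one>})"
proof (intro equalityI subsetI)
  let ?S = "carrier G - {\<one>}"
  fix f assume "f \<in> augmentation_ideal G"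
  then have f: "\<forall>\<sigma>\<in>carrier G. f \<sigma> \<in> \<int>" "\<forall>\<sigma>. \<sigma> \<notin> carrier G \<longrightarrow> f \<sigma> = 0" "(\<Sum>\<sigma>\<in>carrier G. f \<sigma>) = 0"
    by (auto simp: augmentation_ideal_def group_ring_def)
  have "\<forall>\<sigma>\<in>carrier G. \<exists>i. f \<sigma> = of_int i" using f(1) by (auto elim: Ints_cases)
  then obtain x0 where x0: "\<forall>\<sigma>\<in>carrier G. f \<sigma> = of_int (x0 \<sigma>)" by (rule bchoice[THEN exE])
  let ?x = "\<lambda>\<sigma>. if \<sigma> \<in> ?S then x0 \<sigma> else 0"
  have "f \<one> + (\<Sum>\<sigma>\<in>?S. f \<sigma>) = 0" using f(3) sum.remove[OF fin one_closed, of f] by simp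
  then have f1: "f \<one> = - (\<Sum>\<sigma>\<in>?S. f \<sigma>)" by (simp add: add_eq_0_iff2)
  also have "(\<Sum>\<sigma>\<in>?S. f \<sigma>) = of_int (\<Sum>\<sigma>\<in>?S. ?x \<sigma>)"
    unfolding of_int_sum by (rule sum.cong) (use x0 in auto)
  finally have "f = augmentation_embed ?x"
    using x0 f(2) by (auto simp: augmentation_embed_def fun_eq_iff)
  then show "f \<in> augmentation_embed ` vecs ?S" by (rule image_eqI[of _ _ ?x]) (simp add: vecs_def)
next
  let ?S = "carrier G - {\<one>}"
  fix f assume "f \<in> augmentation_embed ` vecs ?S"
  then obtain x where x: "f = augmentation_embed x" by blast
  have "(\<Sum>\<sigma>\<in>carrier G. f \<sigma>) = f \<one> + (\<Sum>\<sigma>\<in>?S. f \<sigma>)" by (rule sum.remove[OF fin one_closed])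
  also have "\<dots> = 0" by (simp add: x augmentation_embed_def)
  finally show "f \<in> augmentation_ideal G"
    unfolding augmentation_ideal_def group_ring_def
    by (auto simp: x augmentation_embed_def)
qed

lemma mult_inv_cancel: "a \<in> carrier G \<Longrightarrow> b \<in> carrier G \<Longrightarrow> a \<otimes> (inv a \<otimes> b) = b"
  by (simp add: m_assoc[symmetric])

text \<open>Multiplication by \<theta> is given by the group matrix of \<open>\<zeta>\<close>, whose
  rows and columns sum to zero. Zero row sums allow a constant to be subtracted from the multiplier
  so that its identity coefficient vanishes. Zero column sums make the identity coefficient of the
  product redundant. This deletes one column and one row.\<close>

lemma principal_ideal_lattice:
  fixes \<zeta> :: "'a \<Rightarrow> int"
  assumes fin: "finite (carrier G)" and z0: "(\<Sum>\<sigma>\<in>carrier G. \<zeta> \<sigma>) = 0"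
    and \<theta>: "\<And>\<sigma>. \<sigma> \<in> carrier G \<Longrightarrow> \<theta> \<sigma> = of_int (\<zeta> \<sigma>)"
  shows "{\<theta> \<otimes>\<^bsub>complex_group_ring G\<^esub> z | z. z \<in> carrier (int_group_ring G)} =
    augmentation_embed ` lat (carrier G - {\<one>}) (\<lambda>\<tau> \<sigma>. \<zeta> (\<tau> \<otimes> inv \<sigma>))"
proof -
  let ?S = "carrier G - {\<one>}" and ?A = "\<lambda>\<tau> \<sigma>. \<zeta> (\<tau> \<otimes> inv \<sigma>)"
  have S: "finite ?S" using fin by simp
  have zrow: "(\<Sum>\<rho>\<in>carrier G. \<zeta> (\<tau> \<otimes> inv \<rho>)) = 0" if "\<tau> \<in> carrier G" for \<tau>
  proof -
    have "(\<Sum>\<rho>\<in>carrier G. \<zeta> (\<tau> \<otimes> inv \<rho>)) = (\<Sum>\<sigma>\<in>carrier G. \<zeta> \<sigma>)"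
      by (rule sum.reindex_bij_witness[of _ "\<lambda>\<sigma>. inv \<sigma> \<otimes> \<tau>" "\<lambda>\<rho>. \<tau> \<otimes> inv \<rho>"])
        (use that in \<open>simp_all add: inv_mult_group m_assoc mult_inv_cancel\<close>)
    then show ?thesis using z0 by simp
  qed
  have zcol: "(\<Sum>\<tau>\<in>carrier G. \<zeta> (\<tau> \<otimes> inv \<rho>)) = 0" if "\<rho> \<in> carrier G" for \<rho>
  proof -
    have "(\<Sum>\<tau>\<in>carrier G. \<zeta> (\<tau> \<otimes> inv \<rho>)) = (\<Sum>\<sigma>\<in>carrier G. \<zeta> \<sigma>)"
      by (rule sum.reindex_bij_witness[of _ "\<lambda>\<sigma>. \<sigma> \<otimes> \<rho>" "\<lambda>\<tau>. \<tau> \<otimes> inv \<rho>"])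
        (use that in \<open>auto simp: m_assoc\<close>)
    then show ?thesis using z0 by simp
  qed
  have key: "\<theta> \<otimes>\<^bsub>complex_group_ring G\<^esub> x =
      augmentation_embed (lincomb ?S ?A (\<lambda>\<rho>. if \<rho> \<in> ?S then xi \<rho> - xi \<one> else 0))"
    if x: "\<forall>\<rho>\<in>carrier G. x \<rho> = of_int (xi \<rho>)" for x and xi :: "'a \<Rightarrow> int"
  proof -
    let ?y = "\<lambda>\<rho>. if \<rho> \<in> ?S then xi \<rho> - xi \<one> else 0"
    define cv where "cv \<tau> = (\<Sum>\<rho>\<in>carrier G. \<zeta> (\<tau> \<otimes> inv \<rho>) * xi \<rho>)" for \<tau>
    have conv: "(\<theta> \<otimes>\<^bsub>complex_group_ring G\<^esub> x) \<tau> = (if \<tau> \<in> carrier G then of_int (cv \<tau>) else 0)" for \<tau>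
    proof (cases "\<tau> \<in> carrier G")
      case True
      have "(\<Sum>\<sigma>\<in>carrier G. \<theta> \<sigma> * x (inv \<sigma> \<otimes> \<tau>)) = (\<Sum>\<sigma>\<in>carrier G. of_int (\<zeta> \<sigma> * xi (inv \<sigma> \<otimes> \<tau>)))"
        by (rule sum.cong) (use True \<theta> x in auto)
      also have "\<dots> = (\<Sum>\<rho>\<in>carrier G. of_int (\<zeta> (\<tau> \<otimes> inv \<rho>) * xi \<rho>))"
        by (rule sum.reindex_bij_witness[of _ "\<lambda>\<rho>. \<tau> \<otimes> inv \<rho>" "\<lambda>\<sigma>. inv \<sigma> \<otimes> \<tau>"])
          (use True in \<open>simp_all add: inv_mult_group m_assoc mult_inv_cancel\<close>)
      finally show ?thesis using True by (simp add: group_ring_def cv_def)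
    qed (simp add: group_ring_def)
    have lc: "lincomb ?S ?A ?y \<tau> = cv \<tau>" if \<tau>: "\<tau> \<in> ?S" for \<tau>
    proof -
      have "lincomb ?S ?A ?y \<tau> = (\<Sum>\<rho>\<in>?S. \<zeta> (\<tau> \<otimes> inv \<rho>) * (xi \<rho> - xi \<one>))"
        unfolding lincomb_def using \<tau> by simp
      also have "\<dots> = (\<Sum>\<rho>\<in>carrier G. \<zeta> (\<tau> \<otimes> inv \<rho>) * (xi \<rho> - xi \<one>))"
        using sum.remove[OF fin one_closed, of "\<lambda>\<rho>. \<zeta> (\<tau> \<otimes> inv \<rho>) * (xi \<rho> - xi \<one>)"] by simp
      also have "\<dots> = cv \<tau> - (\<Sum>\<rho>\<in>carrier G. \<zeta> (\<tau> \<otimes> inv \<rho>)) * xi \<one>"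
        by (simp add: cv_def right_diff_distrib sum_subtractf sum_distrib_right)
      finally show ?thesis using zrow \<tau> by simp
    qed
    have "(\<Sum>\<tau>\<in>carrier G. cv \<tau>) = (\<Sum>\<rho>\<in>carrier G. (\<Sum>\<tau>\<in>carrier G. \<zeta> (\<tau> \<otimes> inv \<rho>)) * xi \<rho>)"
      unfolding cv_def by (subst sum.swap) (simp add: sum_distrib_right)
    also have "\<dots> = 0" by (rule sum.neutral) (simp add: zcol)
    finally have "cv \<one> + (\<Sum>\<tau>\<in>?S. cv \<tau>) = 0" using sum.remove[OF fin one_closed, of cv] by simp
    then have cv1: "cv \<one> = - (\<Sum>\<tau>\<in>?S. cv \<tau>)" by simp
    have sl: "(\<Sum>\<tau>\<in>?S. lincomb ?S ?A ?y \<tau>) = (\<Sum>\<tau>\<in>?S. cv \<tau>)" by (rule sum.cong[OF refl]) (rule lc)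
    show ?thesis
    proof
      fix \<tau>
      consider "\<tau> \<in> ?S" | "\<tau> = \<one>" | "\<tau> \<notin> carrier G" by blast
      then show "(\<theta> \<otimes>\<^bsub>complex_group_ring G\<^esub> x) \<tau> = augmentation_embed (lincomb ?S ?A ?y) \<tau>"
      proof cases
        case 1
        then show ?thesis unfolding conv augmentation_embed_def using lc[OF 1] by simp
      next
        case 2
        then show ?thesis unfolding conv augmentation_embed_def sl by (simp add: cv1)
      next
        case 3
        then have "\<tau> \<noteq> \<one>" by auto
        then show ?thesis unfolding conv augmentation_embed_def using 3 by simp
      qed
    qed
  qed
  show ?thesis
  proof (intro equalityI subsetI)
    fix f assume "f \<in> {\<theta> \<otimes>\<^bsub>complex_group_ring G\<^esub> z | z. z \<in> carrier (int_group_ring G)}"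
    then obtain x where x: "f = \<theta> \<otimes>\<^bsub>complex_group_ring G\<^esub> x" "x \<in> carrier (int_group_ring G)" by blast
    from x(2) have "\<forall>\<rho>\<in>carrier G. x \<rho> \<in> \<int>" by (auto simp: group_ring_def)
    then have "\<forall>\<rho>\<in>carrier G. \<exists>i. x \<rho> = of_int i" by (auto elim: Ints_cases)
    then obtain xi where xi: "\<forall>\<rho>\<in>carrier G. x \<rho> = of_int (xi \<rho>)" by (rule bchoice[THEN exE])
    show "f \<in> augmentation_embed ` lat ?S ?A"
      unfolding x(1) key[OF xi] lat_def by (intro imageI) (simp add: vecs_def)
  next
    fix f assume "f \<in> augmentation_embed ` lat ?S ?A"
    then obtain y where y: "y \<in> vecs ?S" "f = augmentation_embed (lincomb ?S ?A y)" unfolding lat_def by blast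
    \<comment> \<open>\<open>y\<close> vanishes at the identity, so the normalisation in
      \<open>key\<close> leaves it unchanged.\<close>
    let ?x = "\<lambda>\<rho>. of_int (y \<rho>) :: complex"
    have "(\<lambda>\<rho>. if \<rho> \<in> ?S then y \<rho> - y \<one> else 0) = y" using y(1) by (auto simp: vecs_def fun_eq_iff)
    then have "f = \<theta> \<otimes>\<^bsub>complex_group_ring G\<^esub> ?x" using key[of ?x y] y(2) by simp
    moreover have "?x \<in> carrier (int_group_ring G)" using y(1) by (auto simp: group_ring_def vecs_def)
    ultimately show "f \<in> {\<theta> \<otimes>\<^bsub>complex_group_ring G\<^esub> z | z. z \<in> carrier (int_group_ring G)}" by blast
  qed
qed

text \<open>The additive embedding carries cosets of the lattice to cosets of \<open>J\<close>, so a
  transversal of the lattice counts the quotient.\<close>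

theorem card_augmentation_quotient:
  assumes fin: "finite (carrier G)" and J: "J = augmentation_embed ` lat (carrier G - {\<one>}) A"
    and nz: "fdet (carrier G - {\<one>}) A \<noteq> 0"
  shows "int (card (carrier (((add_monoid (int_group_ring G))\<lparr>carrier := augmentation_ideal G\<rparr>) Mod J))) =
    \<bar>fdet (carrier G - {\<one>}) A\<bar>"
proof -
  let ?S = "carrier G - {\<one>}" and ?\<Phi> = augmentation_embed
  let ?L = "lat ?S A"
  let ?K = "\<lambda>x. (\<lambda>l. (\<lambda>\<tau>. ?\<Phi> l \<tau> + ?\<Phi> x \<tau>)) ` ?L"
  have S: "finite ?S" using fin by simp
  obtain R where R: "transversal ?S ?L R" "int (card R) = \<bar>fdet ?S A\<bar>"
    using lattice_transversal[OF S nz] by blast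
  have Lv: "?L \<subseteq> vecs ?S" by (auto simp: lat_def lincomb_def vecs_def)
  have "carrier (((add_monoid (int_group_ring G))\<lparr>carrier := augmentation_ideal G\<rparr>) Mod J) = ?K ` vecs ?S"
    unfolding FactGroup_def RCOSETS_def r_coset_def augmentation_ideal_eq[OF fin] J
    by (simp add: group_ring_def UNION_singleton_eq_range image_image)
  also have "?K ` vecs ?S = ?K ` R"
  proof (intro equalityI subsetI)
    fix k assume "k \<in> ?K ` vecs ?S"
    then obtain x where x: "x \<in> vecs ?S" "k = ?K x" by blast
    obtain r where r: "r \<in> R" "(\<lambda>i. x i - r i) \<in> ?L" using R(1) x(1) unfolding transversal_def by blast
    have sub: "?K x \<subseteq> ?K r" if xr: "(\<lambda>i. x i - r i) \<in> ?L" for x r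
    proof (rule image_subsetI)
      fix l assume l: "l \<in> ?L"
      have "(\<lambda>i. l i + (x i - r i)) \<in> ?L" by (rule lattice_add[OF l xr])
      moreover have "(\<lambda>\<tau>. ?\<Phi> l \<tau> + ?\<Phi> x \<tau>) = (\<lambda>\<tau>. ?\<Phi> (\<lambda>i. l i + (x i - r i)) \<tau> + ?\<Phi> r \<tau>)"
        unfolding augmentation_embed_add[symmetric] by (simp add: algebra_simps)
      ultimately show "(\<lambda>\<tau>. ?\<Phi> l \<tau> + ?\<Phi> x \<tau>) \<in> ?K r" by blast
    qed
    have "(\<lambda>i. 0 - (x i - r i)) \<in> ?L" by (rule lattice_diff[OF lattice_zero r(2)])
    then have "(\<lambda>i. r i - x i) \<in> ?L" by simp
    then have "k = ?K r" using sub[OF r(2)] sub[of r x] x(2) by blast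
    then show "k \<in> ?K ` R" using r(1) by blast
  next
    fix k assume "k \<in> ?K ` R"
    then show "k \<in> ?K ` vecs ?S" using R(1) unfolding transversal_def by blast
  qed
  finally have c: "carrier (((add_monoid (int_group_ring G))\<lparr>carrier := augmentation_ideal G\<rparr>) Mod J) = ?K ` R" .
  have "inj_on ?K R"
  proof (rule inj_onI)
    fix r r' assume r: "r \<in> R" "r' \<in> R" and eq: "?K r = ?K r'"
    have rv: "r \<in> vecs ?S" "r' \<in> vecs ?S" using R(1) r unfolding transversal_def by blast+
    have "(\<lambda>\<tau>. ?\<Phi> (\<lambda>_. 0) \<tau> + ?\<Phi> r \<tau>) \<in> ?K r" using lattice_zero by blast
    then obtain l where l: "l \<in> ?L" "(\<lambda>\<tau>. ?\<Phi> (\<lambda>_. 0) \<tau> + ?\<Phi> r \<tau>) = (\<lambda>\<tau>. ?\<Phi> l \<tau> + ?\<Phi> r' \<tau>)"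
      unfolding eq by blast
    then have e: "?\<Phi> r = ?\<Phi> (\<lambda>i. l i + r' i)"
      unfolding augmentation_embed_add[symmetric] by simp
    have "(\<lambda>i. l i + r' i) \<in> vecs ?S" using l(1) Lv rv(2) by (auto simp: vecs_def)
    then have "r = (\<lambda>i. l i + r' i)" by (rule augmentation_embed_inj[OF rv(1) _ e])
    then have "(\<lambda>i. r i - r' i) = l" by simp
    then show "r = r'" using R(1) r l(1) unfolding transversal_def by blast
  qed
  then have "card (?K ` R) = card R" by (rule card_image)
  then show ?thesis unfolding c using R(2) by simp
qed

end

section \<open>The index of the ideal generated by the theta element\<close>

context abelian_graph_cover
begin

lemma fdet_L_integral: "\<exists>z. \<forall>\<psi>\<in>characters G. fdet (verts X) (L \<psi>) = (\<Sum>k\<in>carrier G. of_int (z k) * \<psi> k)"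
proof -
  have "G.integral_fourier (\<lambda>\<psi>. fdet (verts X) (L \<psi>))"
  proof (rule G.integral_fourier_fdet[OF finite_G])
    fix v w
    show "G.integral_fourier (\<lambda>\<psi>. L \<psi> v w)"
      unfolding twisted_laplacian_def
    proof (rule G.integral_fourier_sum[OF finite_G])
      fix a assume "a \<in> out X v"
      then have a: "volt a \<in> carrier G" using volt_in by (simp add: out_def)
      have "G.integral_fourier (\<lambda>\<psi>. of_int (if v = w then 1 else 0) + of_int (if terminal X a = w then - 1 else 0) * \<psi> (volt a))"
        by (intro G.integral_fourier_add G.integral_fourier_const[OF finite_G] G.integral_fourier_character[OF finite_G a])
      moreover have "(\<lambda>\<psi>. of_int (if v = w then 1 else 0) + of_int (if terminal X a = w then - 1 else 0) * \<psi> (volt a)) =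
        (\<lambda>\<psi>. (if v = w then 1 else 0) - (if terminal X a = w then \<psi> (volt a) else (0::complex)))"
        by (auto simp: fun_eq_iff)
      ultimately show "G.integral_fourier (\<lambda>\<psi>. (if v = w then 1 else 0) - (if terminal X a = w then \<psi> (volt a) else 0))" by simp
    qed
  qed
  then show ?thesis unfolding G.integral_fourier_def .
qed

lemma d_pos: "d > 0"
  using card_G finite_G G.one_closed by (metis card_gt_0_iff empty_iff)

text \<open>In \<theta> the conjugated character and the inverse inside the idempotent cancel, so
  the coefficient at \<sigma> is the average of \<open>L_star\<close> times \<psi> \<sigma>.
  Multiplication by e subtracts the trivial term, and inverting the Fourier transform of what
  remains gives \<open>z\<close> at the inverse of \<tau>.\<close>

lemma theta_star_idempotent:
  assumes z: "\<And>\<psi>. \<psi> \<in> characters G \<Longrightarrow> fdet (verts X) (L \<psi>) = (\<Sum>k\<in>carrier G. of_int (z k) * \<psi> k)"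
    and \<tau>: "\<tau> \<in> carrier G"
  shows "(theta_star Y X \<pi> \<otimes>\<^bsub>complex_group_ring G\<^esub>
      (\<one>\<^bsub>complex_group_ring G\<^esub> \<ominus>\<^bsub>complex_group_ring G\<^esub> char_idempotent G (trivial_character G))) \<tau> =
    of_int ((-2) ^ (card (edges X) - card (verts X)) * z (inv\<^bsub>G\<^esub> \<tau>))"
proof -
  let ?C = "(-2) ^ (card (edges X) - card (verts X)) :: complex" and ?\<chi> = "trivial_character G"
  have fc: "finite (characters G)" by (rule G.finite_characters[OF finite_G])
  have d0: "(of_nat d :: complex) \<noteq> 0" using d_pos by simp
  have \<theta>: "theta_star Y X \<pi> \<sigma> = (\<Sum>\<psi>\<in>characters G. L_star Y X \<pi> \<psi> * \<psi> \<sigma>) / of_nat d" if "\<sigma> \<in> carrier G" for \<sigma>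
    unfolding theta_star_def sum_divide_distrib
  proof (rule sum.cong[OF refl])
    fix \<psi> assume \<psi>: "\<psi> \<in> characters G"
    show "L_star Y X \<pi> \<psi> * char_idempotent G (\<lambda>\<sigma>. cnj (\<psi> \<sigma>)) \<sigma> = L_star Y X \<pi> \<psi> * \<psi> \<sigma> / of_nat d"
      using that by (simp add: G.char_idempotent_eq[OF finite_G] G.character_inv[OF finite_G \<psi>] card_G)
  qed
  have ce: "char_idempotent G ?\<chi> \<sigma> = (if \<sigma> \<in> carrier G then 1 / of_nat d else 0)" for \<sigma>
    by (simp add: G.char_idempotent_eq[OF finite_G] trivial_character_def card_G)
  have "char_idempotent G ?\<chi> \<in> carrier (complex_group_ring G)" by (simp add: group_ring_def ce)
  then have e: "\<one>\<^bsub>complex_group_ring G\<^esub> \<ominus>\<^bsub>complex_group_ring G\<^esub> char_idempotent G ?\<chi> =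
      (\<lambda>\<sigma>. \<one>\<^bsub>complex_group_ring G\<^esub> \<sigma> - char_idempotent G ?\<chi> \<sigma>)"
    by (rule G.complex_group_ring_minus)
  have one: "\<one>\<^bsub>complex_group_ring G\<^esub> = group_elem \<one>\<^bsub>G\<^esub>" by (simp add: group_ring_def)
  have "(theta_star Y X \<pi> \<otimes>\<^bsub>complex_group_ring G\<^esub> (\<lambda>\<sigma>. \<one>\<^bsub>complex_group_ring G\<^esub> \<sigma> - char_idempotent G ?\<chi> \<sigma>)) \<tau> =
    (\<Sum>\<sigma>\<in>carrier G. theta_star Y X \<pi> \<sigma> * (group_elem \<one>\<^bsub>G\<^esub> (inv\<^bsub>G\<^esub> \<sigma> \<otimes>\<^bsub>G\<^esub> \<tau>) - char_idempotent G ?\<chi> (inv\<^bsub>G\<^esub> \<sigma> \<otimes>\<^bsub>G\<^esub> \<tau>)))"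
    unfolding one using \<tau> by (simp add: group_ring_def)
  also have "\<dots> = (\<Sum>\<sigma>\<in>carrier G. (if \<sigma> = \<tau> then theta_star Y X \<pi> \<sigma> else 0) - theta_star Y X \<pi> \<sigma> / of_nat d)"
  proof (rule sum.cong[OF refl])
    fix \<sigma> assume \<sigma>: "\<sigma> \<in> carrier G"
    have "inv\<^bsub>G\<^esub> \<sigma> \<otimes>\<^bsub>G\<^esub> \<tau> = \<one>\<^bsub>G\<^esub> \<longleftrightarrow> \<sigma> = \<tau>"
      using \<sigma> \<tau> by (metis G.inv_closed G.inv_equality G.inv_inv G.l_inv)
    then show "theta_star Y X \<pi> \<sigma> * (group_elem \<one>\<^bsub>G\<^esub> (inv\<^bsub>G\<^esub> \<sigma> \<otimes>\<^bsub>G\<^esub> \<tau>) - char_idempotent G ?\<chi> (inv\<^bsub>G\<^esub> \<sigma> \<otimes>\<^bsub>G\<^esub> \<tau>)) =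
      (if \<sigma> = \<tau> then theta_star Y X \<pi> \<sigma> else 0) - theta_star Y X \<pi> \<sigma> / of_nat d"
      using \<sigma> \<tau> by (simp add: group_elem_def ce right_diff_distrib)
  qed
  also have "\<dots> = theta_star Y X \<pi> \<tau> - (\<Sum>\<sigma>\<in>carrier G. theta_star Y X \<pi> \<sigma>) / of_nat d"
    using \<tau> finite_G by (simp add: sum_subtractf sum_divide_distrib)
  also have "(\<Sum>\<sigma>\<in>carrier G. theta_star Y X \<pi> \<sigma>) = L_star Y X \<pi> ?\<chi>"
  proof -
    have "(\<Sum>\<sigma>\<in>carrier G. theta_star Y X \<pi> \<sigma>) = (\<Sum>\<sigma>\<in>carrier G. \<Sum>\<psi>\<in>characters G. L_star Y X \<pi> \<psi> * \<psi> \<sigma>) / of_nat d"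
      unfolding sum_divide_distrib[symmetric] by (simp add: \<theta> sum_divide_distrib)
    also have "(\<Sum>\<sigma>\<in>carrier G. \<Sum>\<psi>\<in>characters G. L_star Y X \<pi> \<psi> * \<psi> \<sigma>) = (\<Sum>\<psi>\<in>characters G. L_star Y X \<pi> \<psi> * (\<Sum>\<sigma>\<in>carrier G. \<psi> \<sigma>))"
      unfolding sum_distrib_left by (rule sum.swap)
    also have "\<dots> = (\<Sum>\<psi>\<in>characters G. if \<psi> = ?\<chi> then L_star Y X \<pi> \<psi> * of_nat d else 0)"
      by (rule sum.cong) (simp_all add: G.sum_character[OF finite_G] card_G)
    also have "\<dots> = L_star Y X \<pi> ?\<chi> * of_nat d" using fc G.trivial_character_in by simp
    finally show ?thesis using d0 by simp
  qed
  also have "theta_star Y X \<pi> \<tau> - L_star Y X \<pi> ?\<chi> / of_nat d =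
    (\<Sum>\<psi>\<in>characters G - {?\<chi>}. L_star Y X \<pi> \<psi> * \<psi> \<tau>) / of_nat d"
    unfolding \<theta>[OF \<tau>] sum.remove[OF fc G.trivial_character_in]
    using \<tau> by (simp add: trivial_character_def add_divide_distrib)
  also have "(\<Sum>\<psi>\<in>characters G - {?\<chi>}. L_star Y X \<pi> \<psi> * \<psi> \<tau>) = (\<Sum>\<psi>\<in>characters G - {?\<chi>}. ?C * fdet (verts X) (L \<psi>) * \<psi> \<tau>)"
    by (rule sum.cong) (auto simp: L_star_eq(2))
  \<comment> \<open>The restored term of the trivial character is zero. Summing over all characters
    makes their orthogonality applicable.\<close>
  also have "\<dots> = (\<Sum>\<psi>\<in>characters G. ?C * fdet (verts X) (L \<psi>) * \<psi> \<tau>)"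
    unfolding sum.remove[OF fc G.trivial_character_in] by (simp add: fdet_L_trivial)
  also have "\<dots> = (\<Sum>\<psi>\<in>characters G. \<Sum>k\<in>carrier G. ?C * of_int (z k) * \<psi> (k \<otimes>\<^bsub>G\<^esub> \<tau>))"
    by (intro sum.cong refl) (simp add: z sum_distrib_left sum_distrib_right G.character_mult \<tau> mult.assoc)
  also have "\<dots> = (\<Sum>k\<in>carrier G. ?C * of_int (z k) * (\<Sum>\<psi>\<in>characters G. \<psi> (k \<otimes>\<^bsub>G\<^esub> \<tau>)))"
    unfolding sum_distrib_left by (rule sum.swap)
  also have "\<dots> = (\<Sum>k\<in>carrier G. if k = inv\<^bsub>G\<^esub> \<tau> then ?C * of_int (z k) * of_nat d else 0)"
  proof (rule sum.cong[OF refl])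
    fix k assume k: "k \<in> carrier G"
    have "k \<otimes>\<^bsub>G\<^esub> \<tau> = \<one>\<^bsub>G\<^esub> \<longleftrightarrow> k = inv\<^bsub>G\<^esub> \<tau>" using k \<tau> by (metis G.inv_equality G.l_inv)
    then show "?C * of_int (z k) * (\<Sum>\<psi>\<in>characters G. \<psi> (k \<otimes>\<^bsub>G\<^esub> \<tau>)) = (if k = inv\<^bsub>G\<^esub> \<tau> then ?C * of_int (z k) * of_nat d else 0)"
      using k \<tau> by (simp add: G.sum_over_characters[OF finite_G] card_G)
  qed
  also have "\<dots> = ?C * of_int (z (inv\<^bsub>G\<^esub> \<tau>)) * of_nat d" using \<tau> finite_G by simp
  finally show ?thesis unfolding e using d0 by simp
qed

text \<open>Differentiate the group determinant, shifted by t, at t = 0: the trivial character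
  contributes the bare factor t. Right translations identify all principal minors of size d - 1, so
  their sum is d times the minor at the identity.\<close>

lemma group_matrix_minor:
  assumes z: "\<And>\<psi>. \<psi> \<in> characters G \<Longrightarrow> fdet (verts X) (L \<psi>) = (\<Sum>k\<in>carrier G. of_int (z k) * \<psi> k)"
  shows "of_nat d * fdet (carrier G - {\<one>\<^bsub>G\<^esub>}) (\<lambda>\<tau> \<sigma>. of_int (c * z (inv\<^bsub>G\<^esub> (\<tau> \<otimes>\<^bsub>G\<^esub> inv\<^bsub>G\<^esub> \<sigma>)))) =
    of_int c ^ (d - 1) * (\<Prod>\<psi>\<in>characters G - {trivial_character G}. fdet (verts X) (L \<psi>))"
proof -
  let ?\<chi> = "trivial_character G"
  have fc: "finite (characters G)" by (rule G.finite_characters[OF finite_G])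
  define N where "N \<tau> \<sigma> = (of_int (c * z (inv\<^bsub>G\<^esub> (\<tau> \<otimes>\<^bsub>G\<^esub> inv\<^bsub>G\<^esub> \<sigma>))) :: complex)" for \<tau> \<sigma>
  have det: "fdet (carrier G) (\<lambda>\<tau> \<sigma>. N \<tau> \<sigma> + (if \<tau> = \<sigma> then t else 0)) =
      (\<Prod>\<psi>\<in>characters G. of_int c * fdet (verts X) (L \<psi>) + t)" for t
  proof -
    \<comment> \<open>The block group determinant is applied with a single base vertex, so each
      block is a 1 by 1 matrix.\<close>
    define f where "f k u v = of_int (c * z k) + (if k = \<one>\<^bsub>G\<^esub> then t else 0)" for k and u v :: unit
    have b: "bij_betw (\<lambda>g. (g, ())) (carrier G) (carrier G \<times> {()})" by (auto simp: bij_betw_def inj_on_def)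
    have "fdet (carrier G) (\<lambda>\<tau> \<sigma>. N \<tau> \<sigma> + (if \<tau> = \<sigma> then t else 0)) =
      fdet (carrier G \<times> {()}) (\<lambda>p q. f (inv\<^bsub>G\<^esub> (fst p) \<otimes>\<^bsub>G\<^esub> fst q) (snd p) (snd q))"
      unfolding fdet_reindex[OF b finite_G]
    proof (rule fdet_cong[OF refl])
      fix \<tau> \<sigma> assume m: "\<tau> \<in> carrier G" "\<sigma> \<in> carrier G"
      have "inv\<^bsub>G\<^esub> (\<tau> \<otimes>\<^bsub>G\<^esub> inv\<^bsub>G\<^esub> \<sigma>) = inv\<^bsub>G\<^esub> \<tau> \<otimes>\<^bsub>G\<^esub> \<sigma>" using m by (simp add: G.inv_mult_group G.m_comm)
      moreover have "inv\<^bsub>G\<^esub> \<tau> \<otimes>\<^bsub>G\<^esub> \<sigma> = \<one>\<^bsub>G\<^esub> \<longleftrightarrow> \<tau> = \<sigma>"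
        using m G.inv_solve_left'[of "\<one>\<^bsub>G\<^esub>" \<tau> \<sigma>] by auto
      ultimately show "N \<tau> \<sigma> + (if \<tau> = \<sigma> then t else 0) =
        f (inv\<^bsub>G\<^esub> (fst (\<tau>, ())) \<otimes>\<^bsub>G\<^esub> fst (\<sigma>, ())) (snd (\<tau>, ())) (snd (\<sigma>, ()))" by (simp add: N_def f_def)
    qed
    also have "\<dots> = (\<Prod>\<psi>\<in>characters G. fdet {()} (\<lambda>u v. \<Sum>k\<in>carrier G. f k u v * \<psi> k))"
      by (rule G.group_determinant[OF finite_G]) simp
    also have "\<dots> = (\<Prod>\<psi>\<in>characters G. of_int c * fdet (verts X) (L \<psi>) + t)"
    proof (rule prod.cong[OF refl])
      fix \<psi> assume \<psi>: "\<psi> \<in> characters G"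
      have "(\<Sum>k\<in>carrier G. f k () () * \<psi> k) = (\<Sum>k\<in>carrier G. of_int c * (of_int (z k) * \<psi> k) + (if k = \<one>\<^bsub>G\<^esub> then t * \<psi> k else 0))"
        by (rule sum.cong) (auto simp: f_def algebra_simps)
      also have "\<dots> = of_int c * fdet (verts X) (L \<psi>) + t"
        using finite_G G.character_one[OF \<psi>] by (simp add: sum.distrib z[OF \<psi>] sum_distrib_left)
      finally show "fdet {()} (\<lambda>u v. \<Sum>k\<in>carrier G. f k u v * \<psi> k) = of_int c * fdet (verts X) (L \<psi>) + t"
        by (simp add: fdet_singleton)
    qed
    finally show ?thesis .
  qed
  have d1: "((\<lambda>t. \<Prod>\<psi>\<in>characters G. of_int c * fdet (verts X) (L \<psi>) + t) has_field_derivative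
      (1 * (\<Prod>\<psi>\<in>characters G - {?\<chi>}. of_int c * fdet (verts X) (L \<psi>) + 0))) (at 0)"
  proof (rule DERIV_prod_zero_factor[where D = "\<lambda>_. 1" and f = "\<lambda>\<psi> t. of_int c * fdet (verts X) (L \<psi>) + t"])
    show "finite (characters G)" by (rule fc)
    show "?\<chi> \<in> characters G" by (rule G.trivial_character_in)
    show "of_int c * fdet (verts X) (L ?\<chi>) + 0 = 0" by (simp only: fdet_L_trivial mult_zero_right add_0_right)
    show "((+) (of_int c * fdet (verts X) (L \<psi>)) has_field_derivative 1) (at 0)" for \<psi>
      by (rule DERIV_cong[OF DERIV_add[OF DERIV_const DERIV_ident]]) simp
  qed
  have d2: "((\<lambda>t. \<Prod>\<psi>\<in>characters G. of_int c * fdet (verts X) (L \<psi>) + t) has_field_derivative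
      (\<Sum>s\<in>carrier G. fdet (carrier G - {s}) N)) (at 0)"
    unfolding det[symmetric] by (rule DERIV_fdet_add_scalar[OF finite_G])
  have deriv: "(\<Sum>s\<in>carrier G. fdet (carrier G - {s}) N) = (\<Prod>\<psi>\<in>characters G - {?\<chi>}. of_int c * fdet (verts X) (L \<psi>))"
    using DERIV_unique[OF d2 d1] by (simp only: mult_1 add_0_right)
  have shift: "fdet (carrier G - {s}) N = fdet (carrier G - {\<one>\<^bsub>G\<^esub>}) N" if s: "s \<in> carrier G" for s
  proof -
    have b: "bij_betw (\<lambda>g. g \<otimes>\<^bsub>G\<^esub> s) (carrier G - {\<one>\<^bsub>G\<^esub>}) (carrier G - {s})"
    proof (rule bij_betw_byWitness[where f' = "\<lambda>g. g \<otimes>\<^bsub>G\<^esub> inv\<^bsub>G\<^esub> s"])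
      show "(\<lambda>g. g \<otimes>\<^bsub>G\<^esub> s) ` (carrier G - {\<one>\<^bsub>G\<^esub>}) \<subseteq> carrier G - {s}"
      proof (rule image_subsetI)
        fix g assume g: "g \<in> carrier G - {\<one>\<^bsub>G\<^esub>}"
        then have "g \<otimes>\<^bsub>G\<^esub> s \<noteq> s" using s G.r_cancel_one[of s g] by simp
        then show "g \<otimes>\<^bsub>G\<^esub> s \<in> carrier G - {s}" using g s by simp
      qed
      show "(\<lambda>g. g \<otimes>\<^bsub>G\<^esub> inv\<^bsub>G\<^esub> s) ` (carrier G - {s}) \<subseteq> carrier G - {\<one>\<^bsub>G\<^esub>}"
      proof (rule image_subsetI)
        fix g assume g: "g \<in> carrier G - {s}"
        have "g \<otimes>\<^bsub>G\<^esub> inv\<^bsub>G\<^esub> s \<noteq> \<one>\<^bsub>G\<^esub>"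
        proof
          assume "g \<otimes>\<^bsub>G\<^esub> inv\<^bsub>G\<^esub> s = \<one>\<^bsub>G\<^esub>"
          then have "inv\<^bsub>G\<^esub> (inv\<^bsub>G\<^esub> s) = g" using g s by (intro G.inv_equality) simp_all
          then show False using g s by simp
        qed
        then show "g \<otimes>\<^bsub>G\<^esub> inv\<^bsub>G\<^esub> s \<in> carrier G - {\<one>\<^bsub>G\<^esub>}" using g s by simp
      qed
    qed (use s in \<open>simp_all add: G.m_assoc\<close>)
    have "fdet (carrier G - {s}) N = fdet (carrier G - {\<one>\<^bsub>G\<^esub>}) (\<lambda>g h. N (g \<otimes>\<^bsub>G\<^esub> s) (h \<otimes>\<^bsub>G\<^esub> s))"
      by (rule fdet_reindex[OF b]) (simp add: finite_G)
    also have "\<dots> = fdet (carrier G - {\<one>\<^bsub>G\<^esub>}) N"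
    proof (rule fdet_cong[OF refl])
      fix g h assume m: "g \<in> carrier G - {\<one>\<^bsub>G\<^esub>}" "h \<in> carrier G - {\<one>\<^bsub>G\<^esub>}"
      have "(g \<otimes>\<^bsub>G\<^esub> s) \<otimes>\<^bsub>G\<^esub> inv\<^bsub>G\<^esub> (h \<otimes>\<^bsub>G\<^esub> s) = g \<otimes>\<^bsub>G\<^esub> (s \<otimes>\<^bsub>G\<^esub> inv\<^bsub>G\<^esub> s) \<otimes>\<^bsub>G\<^esub> inv\<^bsub>G\<^esub> h"
        using m s by (simp add: G.inv_mult_group G.m_assoc G.mult_inv_cancel)
      also have "\<dots> = g \<otimes>\<^bsub>G\<^esub> inv\<^bsub>G\<^esub> h" using m s by simp
      finally show "N (g \<otimes>\<^bsub>G\<^esub> s) (h \<otimes>\<^bsub>G\<^esub> s) = N g h" by (simp add: N_def)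
    qed
    finally show ?thesis .
  qed
  have "(\<Sum>s\<in>carrier G. fdet (carrier G - {s}) N) = (\<Sum>s\<in>carrier G. fdet (carrier G - {\<one>\<^bsub>G\<^esub>}) N)"
    by (rule sum.cong[OF refl shift])
  with deriv have "of_nat d * fdet (carrier G - {\<one>\<^bsub>G\<^esub>}) N = (\<Prod>\<psi>\<in>characters G - {?\<chi>}. of_int c * fdet (verts X) (L \<psi>))"
    by (simp add: card_G)
  also have "\<dots> = of_int c ^ (d - 1) * (\<Prod>\<psi>\<in>characters G - {?\<chi>}. fdet (verts X) (L \<psi>))"
    using G.trivial_character_in fc by (simp add: prod.distrib G.card_characters[OF finite_G] card_G)
  finally show ?thesis unfolding N_def .
qed

text \<open>\<open>minor\<close> and \<open>ratio\<close> both express a multiple by d in terms of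
  the same product \<open>P\<close>. Eliminating \<open>P\<close> cancels d and leaves an identity
  between integers.\<close>

theorem card_quotient_theta_star:
  fixes J
  defines "J \<equiv> {theta_star Y X \<pi> \<otimes>\<^bsub>complex_group_ring G\<^esub>
      (\<one>\<^bsub>complex_group_ring G\<^esub> \<ominus>\<^bsub>complex_group_ring G\<^esub> char_idempotent G (trivial_character G))
      \<otimes>\<^bsub>complex_group_ring G\<^esub> z | z. z \<in> carrier (int_group_ring G)}"
  shows "real (card (carrier (((add_monoid (int_group_ring G))\<lparr>carrier := augmentation_ideal G\<rparr>) Mod J))) =
    2 powi ((int d - 1) * (betti X - 1)) * (real (num_spanning_trees Y) / real (num_spanning_trees X))"
proof -
  let ?m = "card (edges X) - card (verts X)"
  let ?kX = "num_spanning_trees X" and ?kY = "num_spanning_trees Y" and ?S = "carrier G - {\<one>\<^bsub>G\<^esub>}"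
  obtain z where z: "\<And>\<psi>. \<psi> \<in> characters G \<Longrightarrow> fdet (verts X) (L \<psi>) = (\<Sum>k\<in>carrier G. of_int (z k) * \<psi> k)"
    using fdet_L_integral by blast
  define c where "c = ((-2) ^ ?m :: int)"
  define \<zeta> where "\<zeta> \<tau> = c * z (inv\<^bsub>G\<^esub> \<tau>)" for \<tau>
  let ?A = "\<lambda>\<tau> \<sigma>. \<zeta> (\<tau> \<otimes>\<^bsub>G\<^esub> inv\<^bsub>G\<^esub> \<sigma>)"
  have "(\<Sum>k\<in>carrier G. of_int (z k)) = (0::complex)"
  proof -
    have "(\<Sum>k\<in>carrier G. of_int (z k)) = (\<Sum>k\<in>carrier G. of_int (z k) * trivial_character G k)"
      by (rule sum.cong) (simp_all add: trivial_character_def)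
    then show ?thesis using z[OF G.trivial_character_in] fdet_L_trivial by simp
  qed
  then have "of_int (\<Sum>k\<in>carrier G. z k) = (0::complex)" by simp
  then have z0: "(\<Sum>k\<in>carrier G. z k) = 0" by (simp only: of_int_eq_0_iff)
  have "(\<Sum>\<sigma>\<in>carrier G. z (inv\<^bsub>G\<^esub> \<sigma>)) = (\<Sum>k\<in>carrier G. z k)"
    by (rule sum.reindex_bij_witness[of _ "\<lambda>k. inv\<^bsub>G\<^esub> k" "\<lambda>k. inv\<^bsub>G\<^esub> k"]) auto
  then have \<zeta>0: "(\<Sum>\<sigma>\<in>carrier G. \<zeta> \<sigma>) = 0" using z0 by (simp add: \<zeta>_def sum_distrib_left[symmetric])
  have J: "J = G.augmentation_embed ` lat ?S ?A"
    unfolding J_def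
    by (rule G.principal_ideal_lattice[OF finite_G \<zeta>0]) (simp add: theta_star_idempotent[OF z] \<zeta>_def c_def)
  define P where "P = (\<Prod>\<psi>\<in>characters G - {trivial_character G}. fdet (verts X) (L \<psi>))"
  have minor: "of_nat d * of_int (fdet ?S ?A) = of_int c ^ (d - 1) * P"
    unfolding of_int_fdet \<zeta>_def P_def by (rule group_matrix_minor[OF z])
  have ratio: "of_nat (d * ?kY) = of_nat ?kX * P" unfolding P_def by (rule spanning_trees_ratio)
  have "of_nat d * (of_int (fdet ?S ?A) * of_nat ?kX) = (of_nat d * of_int (fdet ?S ?A)) * of_nat ?kX"
    by (simp only: mult.assoc)
  also have "\<dots> = of_int c ^ (d - 1) * (of_nat ?kX * P)" unfolding minor by (simp only: mult_ac)
  also have "\<dots> = of_nat d * (of_int c ^ (d - 1) * of_nat ?kY :: complex)"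
    unfolding ratio[symmetric] by (simp only: of_nat_mult mult_ac)
  finally have "of_nat d * (of_int (fdet ?S ?A) * of_nat ?kX) = of_nat d * (of_int c ^ (d - 1) * of_nat ?kY :: complex)" .
  then have "of_int (fdet ?S ?A) * of_nat ?kX = (of_int c ^ (d - 1) * of_nat ?kY :: complex)" using d_pos by simp
  then have "of_int (fdet ?S ?A * int ?kX) = (of_int (c ^ (d - 1) * int ?kY) :: complex)" by simp
  then have eq: "fdet ?S ?A * int ?kX = c ^ (d - 1) * int ?kY" by (simp only: of_int_eq_iff)
  have kX: "?kX > 0" and kY: "?kY > 0" using num_spanning_trees_pos[OF finX connX] num_spanning_trees_pos[OF finY connY] by auto
  have nz: "fdet ?S ?A \<noteq> 0" using eq kY by (auto simp: c_def)
  have "\<bar>fdet ?S ?A\<bar> * int ?kX = \<bar>c ^ (d - 1)\<bar> * int ?kY" using arg_cong[OF eq, of abs] by (simp add: abs_mult)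
  moreover have "int (card (carrier (((add_monoid (int_group_ring G))\<lparr>carrier := augmentation_ideal G\<rparr>) Mod J))) = \<bar>fdet ?S ?A\<bar>"
    by (rule G.card_augmentation_quotient[OF finite_G J nz])
  ultimately have I: "int (card (carrier (((add_monoid (int_group_ring G))\<lparr>carrier := augmentation_ideal G\<rparr>) Mod J))) * int ?kX =
     \<bar>c ^ (d - 1)\<bar> * int ?kY" by simp
  from arg_cong[OF I, of real_of_int]
  have "real (card (carrier (((add_monoid (int_group_ring G))\<lparr>carrier := augmentation_ideal G\<rparr>) Mod J))) * real ?kX =
     real_of_int \<bar>c ^ (d - 1)\<bar> * real ?kY"
    by (simp only: of_int_mult of_int_of_nat_eq)
  moreover have "real_of_int \<bar>c ^ (d - 1)\<bar> = 2 powi ((int d - 1) * (betti X - 1))"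
  proof -
    have "real_of_int \<bar>c ^ (d - 1)\<bar> = 2 ^ ((d - 1) * ?m)"
      by (simp add: c_def power_abs abs_mult power_mult[symmetric] mult.commute)
    also have "\<dots> = 2 powi (int ((d - 1) * ?m))" by (simp only: power_int_of_nat)
    also have "int ((d - 1) * ?m) = (int d - 1) * (betti X - 1)"
    \<comment> \<open>For d > 1 a nontrivial character exists, which gives |V| at most |E|, so the
      truncated difference \<open>?m\<close> is the true one. For d = 1 both exponents are
      zero.\<close>
    proof (cases "d = 1")
      case False
      have "characters G \<noteq> {trivial_character G}"
        using G.card_characters[OF finite_G] card_G False by auto
      then obtain \<psi> where "\<psi> \<in> characters G" "\<psi> \<noteq> trivial_character G" using G.trivial_character_in by blast
      then have "card (verts X) \<le> card (edges X)" by (rule L_star_eq(1))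
      then show ?thesis using d_pos by (simp add: betti_def of_nat_diff Suc_leI)
    qed simp
    finally show ?thesis .
  qed
  ultimately show ?thesis using kX by (simp add: field_simps)
qed

end

theorem theorem4p8:
  fixes X :: "('v, 'e) multigraph" and Y :: "('w, 'f) multigraph"
    and \<pi> :: "('w, 'f, 'v, 'e) multigraph_map" and d :: nat
  assumes "finite_multigraph X" and "connected_multigraph X" and "\<forall>v\<in>verts X. vdegree X v \<noteq> 1"
    and "finite_multigraph Y" and "connected_multigraph Y" and "\<forall>w\<in>verts Y. vdegree Y w \<noteq> 1"
    and "abelian_cover Y X \<pi>" and "has_cover_degree Y X \<pi> d"
  defines "G \<equiv> deck_group Y X \<pi>"
  defines "CG \<equiv> complex_group_ring G" and "ZG \<equiv> int_group_ring G"
  defines "e \<equiv> \<one>\<^bsub>CG\<^esub> \<ominus>\<^bsub>CG\<^esub> char_idempotent G (trivial_character G)"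
  defines "J \<equiv> {theta_star Y X \<pi> \<otimes>\<^bsub>CG\<^esub> e \<otimes>\<^bsub>CG\<^esub> z | z. z \<in> carrier ZG}"
  shows "real (card (carrier (((add_monoid ZG)\<lparr>carrier := augmentation_ideal G\<rparr>) Mod J))) =
    2 powi ((int d - 1) * (betti X - 1)) *
    (real (num_spanning_trees Y) / real (num_spanning_trees X))"
proof -
  have "cover Y X \<pi>" using assms(7) by (simp add: abelian_cover_def galois_cover_def)
  then interpret abelian_graph_cover X Y \<pi> d
    using assms(1,2,4,5,7,8) by unfold_locales
  show ?thesis unfolding J_def e_def ZG_def CG_def G_def by (rule card_quotient_theta_star)
qed

end
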